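(* Let $P=((V,E),(V_1,V_R),\delta)$ be an MDP with $n=|V|$ vertices and $m=|E|$ edges, and let $T_1,\dots,T_k\subseteq V$ be target sets. Then the almost-sure winning set for the disjunctive query of the reachability objectives, $\bigcup_{i=1}^k \langle\langle 1\rangle\rangle_{as}(P,\mathrm{Reach}(T_i))$, can be computed in $O(k\cdot m+\textsc{MEC})$ time, where $\textsc{MEC}$ is the time needed to compute the maximal end-component decomposition of $P$.
   Context: An MDP $P=((V,E),(V_1,V_R),\delta)$ consists of a finite directed graph $(V,E)$, a partition of $V$ into player-1 vertices $V_1$ and random vertices $V_R$, and a probabilistic transition function $\delta$ assigning to each $v\in V_R$ a probability distribution over $V$ with $\delta(v)[w]>0$ iff $(v,w)\in E$. A play is an infinite path $\langle v_0,v_1,\dots\rangle$ with $(v_i,v_{i+1})\in E$. A player-1 strategy maps every finite path prefix ending in a vertex $v\in V_1$ to a successor of $v$. For an objective $\psi$ (a set of plays), $\langle\langle 1\rangle\rangle_{as}(P,\psi)$ is the set of vertices $v$ from which player 1 has a strategy $\sigma$ with $\Pr^\sigma_v(\psi)=1$. $\mathrm{Reach}(T)$ is the set of plays visiting some vertex of $T$ at least once. An end-component is a set $X\subseteq V$ such that the sub-MDP induced by $X$ is strongly connected and contains at least one edge, and no random vertex in $X$ has an edge leaving $X$; a maximal end-component (MEC) is one maximal under inclusion; the MEC-decomposition consists of all MECs. It is assumed $\textsc{MEC}=\Omega(m)$ and $m\ge n$. *)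

theory Defs
  imports "HOL-Probability.Probability"
begin

section \<open>Markov decision processes\<close>

record 'v mdp =
  verts :: "'v set"
  edges :: "('v \<times> 'v) set"
  player1 :: "'v set"
  random :: "'v set"
  delta :: "'v \<Rightarrow> 'v pmf"

text \<open>Only the values of \<^const>\<open>delta\<close> on random vertices are meaningful.  Player-1
  vertices without successors are not excluded.\<close>

definition is_mdp :: "'v mdp \<Rightarrow> bool" where
  "is_mdp P \<longleftrightarrow>
     finite (verts P) \<and> edges P \<subseteq> verts P \<times> verts P \<and>
     player1 P \<union> random P = verts P \<and> player1 P \<inter> random P = {} \<and>
     (\<forall>v\<in>random P. \<forall>w. pmf (delta P v) w > 0 \<longleftrightarrow> (v, w) \<in> edges P)"

definition plays :: "'v mdp \<Rightarrow> (nat \<Rightarrow> 'v) set" where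
  "plays P = {\<omega>. \<forall>i. (\<omega> i, \<omega> (Suc i)) \<in> edges P}"

definition finite_path :: "'v mdp \<Rightarrow> 'v list \<Rightarrow> bool" where
  "finite_path P h \<longleftrightarrow>
     h \<noteq> [] \<and> set h \<subseteq> verts P \<and> successively (\<lambda>u v. (u, v) \<in> edges P) h"

definition strategy :: "'v mdp \<Rightarrow> ('v list \<Rightarrow> 'v) \<Rightarrow> bool" where
  "strategy P \<sigma> \<longleftrightarrow>
     (\<forall>h. finite_path P h \<and> last h \<in> player1 P \<longrightarrow> (last h, \<sigma> h) \<in> edges P)"

definition step_pmf :: "'v mdp \<Rightarrow> ('v list \<Rightarrow> 'v) \<Rightarrow> 'v list \<Rightarrow> 'v pmf" where
  "step_pmf P \<sigma> h = (if last h \<in> player1 P then return_pmf (\<sigma> h) else delta P (last h))"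

text \<open>The law of the vertex at position \<open>i\<close> of a play from \<open>v\<close>, given the vertices
  \<open>\<omega> 0, \<dots>, \<omega> (i - 1)\<close> before it.\<close>

definition play_kernel ::
    "'v mdp \<Rightarrow> ('v list \<Rightarrow> 'v) \<Rightarrow> 'v \<Rightarrow> nat \<Rightarrow> (nat \<Rightarrow> 'v) \<Rightarrow> 'v measure" where
  "play_kernel P \<sigma> v i \<omega> =
     measure_pmf (if i = 0 then return_pmf v else step_pmf P \<sigma> (map \<omega> [0..<i]))"

text \<open>The measure on infinite vertex sequences determined by the kernels above
  (Ionescu-Tulcea), on the product of the discrete sigma-algebras.\<close>

definition play_measure ::
    "'v mdp \<Rightarrow> ('v list \<Rightarrow> 'v) \<Rightarrow> 'v \<Rightarrow> (nat \<Rightarrow> 'v) measure" where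
  "play_measure P \<sigma> v =
     projective_family.lim UNIV
       (Ionescu_Tulcea.CI (play_kernel P \<sigma> v) (\<lambda>_. count_space UNIV)) (\<lambda>_. count_space UNIV)"

lemma Ionescu_Tulcea_play_kernel:
  fixes P :: "'v::countable mdp"
  shows "Ionescu_Tulcea (play_kernel P \<sigma> v) (\<lambda>_. count_space UNIV)"
proof (rule Ionescu_Tulcea.intro)
  fix i :: nat
  have "PiM {0..<i} (\<lambda>_. count_space (UNIV :: 'v set)) = count_space (PiE {0..<i} (\<lambda>_. UNIV))"
    by (rule count_space_PiM_finite) auto
  then show "play_kernel P \<sigma> v i \<in>
      measurable (PiM {0..<i} (\<lambda>_. count_space UNIV)) (subprob_algebra (count_space UNIV))"
    by (auto simp: play_kernel_def measure_pmf_in_subprob_space)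
next
  show "prob_space (play_kernel P \<sigma> v i x)" for i x
    by (simp add: play_kernel_def prob_space_measure_pmf)
qed

definition almost_sure :: "'v mdp \<Rightarrow> (nat \<Rightarrow> 'v) set \<Rightarrow> 'v set" where
  "almost_sure P \<psi> =
     {v \<in> verts P. \<exists>\<sigma>. strategy P \<sigma> \<and> measure (play_measure P \<sigma> v) \<psi> = 1}"

definition Reach :: "'v mdp \<Rightarrow> 'v set \<Rightarrow> (nat \<Rightarrow> 'v) set" where
  "Reach P T = {\<omega> \<in> plays P. \<exists>i. \<omega> i \<in> T}"

lemma sets_play_measure:
  fixes P :: "'v::countable mdp"
  shows "sets (play_measure P \<sigma> v) = sets (PiM UNIV (\<lambda>_. count_space UNIV))"
    and "prob_space (play_measure P \<sigma> v)"
    and "Reach P T \<in> sets (play_measure P \<sigma> v)"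
proof -
  interpret Ionescu_Tulcea "play_kernel P \<sigma> v" "\<lambda>_. count_space UNIV"
    by (rule Ionescu_Tulcea_play_kernel)
  show 1: "sets (play_measure P \<sigma> v) = sets (PiM UNIV (\<lambda>_. count_space UNIV))"
    by (simp add: play_measure_def)
  show "prob_space (play_measure P \<sigma> v)"
  proof (rule prob_spaceI)
    have "emeasure (play_measure P \<sigma> v) (space (play_measure P \<sigma> v)) =
        emeasure (CI {}) (space (PiM {} (\<lambda>_. count_space UNIV)))"
      by (subst lim[symmetric])
        (auto simp: play_measure_def prod_emb_def space_PiM PiM_empty intro!: arg_cong2[where f = emeasure])
    also have "\<dots> = 1"
      using prob_space.emeasure_space_1[OF PF.prob_space_P[of "{}"]] by (simp add: CI_def)
    finally show "emeasure (play_measure P \<sigma> v) (space (play_measure P \<sigma> v)) = 1" .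
  qed
  have "Reach P T = {\<omega> \<in> space (PiM UNIV (\<lambda>_. count_space UNIV)).
      (\<forall>i. (\<omega> i, \<omega> (Suc i)) \<in> edges P) \<and> (\<exists>i. \<omega> i \<in> T)}"
    by (auto simp: Reach_def plays_def space_PiM)
  also have "\<dots> \<in> sets (PiM UNIV (\<lambda>_. count_space UNIV))"
    by measurable
  finally show "Reach P T \<in> sets (play_measure P \<sigma> v)"
    by (simp add: 1)
qed

definition end_component :: "'v mdp \<Rightarrow> 'v set \<Rightarrow> bool" where
  "end_component P X \<longleftrightarrow>
     X \<subseteq> verts P \<and>
     (\<forall>u\<in>X. \<forall>v\<in>X. (u, v) \<in> (edges P \<inter> X \<times> X)\<^sup>*) \<and>
     edges P \<inter> X \<times> X \<noteq> {} \<and>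
     (\<forall>v\<in>X \<inter> random P. \<forall>w. (v, w) \<in> edges P \<longrightarrow> w \<in> X)"

definition MECs :: "'v mdp \<Rightarrow> 'v set set" where
  "MECs P = {X. end_component P X \<and> (\<forall>Y. end_component P Y \<and> X \<subseteq> Y \<longrightarrow> Y = X)}"


section \<open>A random access machine\<close>

text \<open>The model is the uniform-cost RAM with addition and truncated subtraction, as a structured
  language.  Instead of one memory addressed by natural numbers there are arrays of unbounded
  length, indexed by natural numbers; each program mentions only finitely many of them, so the
  arrays can be interleaved in a single memory.  Assignments and tests have unit cost: the
  expressions in a fixed program have bounded size, so charging each operation in them would
  change running times by a constant factor only.\<close>

type_synonym state = "nat \<Rightarrow> nat \<Rightarrow> nat"

datatype aexp =
    Const nat
  | Read nat aexp
  | Plus aexp aexp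
  | Minus aexp aexp

datatype bexp =
    Less aexp aexp
  | Neg bexp
  | And bexp bexp

datatype com =
    Skip
  | Write nat aexp aexp
  | Seq com com
  | Cond bexp com com
  | While bexp com

fun aval :: "aexp \<Rightarrow> state \<Rightarrow> nat" where
  "aval (Const n) s = n"
| "aval (Read a i) s = s a (aval i s)"
| "aval (Plus x y) s = aval x s + aval y s"
| "aval (Minus x y) s = aval x s - aval y s"

fun bval :: "bexp \<Rightarrow> state \<Rightarrow> bool" where
  "bval (Less x y) s = (aval x s < aval y s)"
| "bval (Neg b) s = (\<not> bval b s)"
| "bval (And b c) s = (bval b s \<and> bval c s)"

text \<open>\<open>exec c s t s'\<close>: started in \<open>s\<close>, the program \<open>c\<close> halts in \<open>s'\<close> after \<open>t\<close> steps.\<close>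

inductive exec :: "com \<Rightarrow> state \<Rightarrow> nat \<Rightarrow> state \<Rightarrow> bool" where
  exec_Skip: "exec Skip s 1 s"
| exec_Write: "exec (Write a i x) s 1 (s(a := (s a)(aval i s := aval x s)))"
| exec_Seq: "exec c s t s' \<Longrightarrow> exec d s' u s'' \<Longrightarrow> exec (Seq c d) s (t + u) s''"
| exec_Cond_True: "bval b s \<Longrightarrow> exec c s t s' \<Longrightarrow> exec (Cond b c d) s (Suc t) s'"
| exec_Cond_False: "\<not> bval b s \<Longrightarrow> exec d s t s' \<Longrightarrow> exec (Cond b c d) s (Suc t) s'"
| exec_While_False: "\<not> bval b s \<Longrightarrow> exec (While b c) s 1 s"
| exec_While_True: "bval b s \<Longrightarrow> exec c s t s' \<Longrightarrow> exec (While b c) s' u s'' \<Longrightarrow>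
    exec (While b c) s (Suc (t + u)) s''"

inductive_cases exec_SkipE: "exec Skip s t s'"
inductive_cases exec_WriteE: "exec (Write a i x) s t s'"
inductive_cases exec_SeqE: "exec (Seq c d) s t s'"
inductive_cases exec_CondE: "exec (Cond b c d) s t s'"
inductive_cases exec_WhileE: "exec (While b c) s t s'"

lemma exec_deterministic:
  "exec c s t s' \<Longrightarrow> exec c s u s'' \<Longrightarrow> u = t \<and> s'' = s'"
proof (induction arbitrary: u s'' rule: exec.induct)
  case exec_Skip then show ?case by (auto elim: exec_SkipE)
next
  case exec_Write then show ?case by (auto elim: exec_WriteE)
next
  case exec_Seq from exec_Seq.prems show ?case
    by (rule exec_SeqE) (use exec_Seq.IH in blast)
next
  case exec_Cond_True from exec_Cond_True.prems show ?case
    by (rule exec_CondE) (use exec_Cond_True.IH exec_Cond_True.hyps in blast)+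
next
  case exec_Cond_False from exec_Cond_False.prems show ?case
    by (rule exec_CondE) (use exec_Cond_False.IH exec_Cond_False.hyps in blast)+
next
  case exec_While_False then show ?case by (auto elim: exec_WhileE)
next
  case exec_While_True from exec_While_True.prems show ?case
    by (rule exec_WhileE) (use exec_While_True.IH exec_While_True.hyps in blast)+
qed


section \<open>Representation of inputs and outputs\<close>

definition array_of :: "nat list \<Rightarrow> nat \<Rightarrow> nat" where
  "array_of xs i = (if i < length xs then xs ! i else 0)"

text \<open>A list of lists is stored in three consecutive arrays: the number of lists, the positions
  at which the individual lists begin (followed by the total length), and the concatenation.\<close>

definition offsets :: "nat list list \<Rightarrow> nat list" where
  "offsets xss = map (\<lambda>i. length (concat (take i xss))) [0..<Suc (length xss)]"

definition store_lists :: "nat \<Rightarrow> nat list list \<Rightarrow> state \<Rightarrow> state" where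
  "store_lists a xss s =
     s(a := array_of [length xss], a + 1 := array_of (offsets xss), a + 2 := array_of (concat xss))"

definition holds_list :: "state \<Rightarrow> nat \<Rightarrow> nat list \<Rightarrow> bool" where
  "holds_list s a xs \<longleftrightarrow> (\<forall>i<length xs. s a i = xs ! i)"

definition holds_lists :: "state \<Rightarrow> nat \<Rightarrow> nat list list \<Rightarrow> bool" where
  "holds_lists s a xss \<longleftrightarrow>
     holds_list s a [length xss] \<and> holds_list s (a + 1) (offsets xss) \<and>
     holds_list s (a + 2) (concat xss)"

definition list_of_set :: "nat list \<Rightarrow> nat set \<Rightarrow> bool" where
  "list_of_set xs X \<longleftrightarrow> distinct xs \<and> set xs = X"

text \<open>As input to a program, the vertices are numbered \<open>0, \<dots>, n - 1\<close> and the graph is given by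
  adjacency lists, in arbitrary order.  The probabilities are not part of the input: both
  the maximal end-components and the almost-sure winning sets have to be computed from
  the graph and the partition of its vertices alone.\<close>

definition adjacency_lists :: "nat mdp \<Rightarrow> nat list list \<Rightarrow> bool" where
  "adjacency_lists P adj \<longleftrightarrow>
     verts P = {..<length adj} \<and>
     (\<forall>v<length adj. list_of_set (adj ! v) {w. (v, w) \<in> edges P})"

definition mdp_input :: "nat mdp \<Rightarrow> nat list list \<Rightarrow> state" where
  "mdp_input P adj =
     (store_lists 0 adj (\<lambda>_ _. 0))(3 := (\<lambda>v. if v \<in> player1 P then 1 else 0))"

definition query_input :: "nat mdp \<Rightarrow> nat list list \<Rightarrow> nat list list \<Rightarrow> state" where
  "query_input P adj ts = store_lists 4 ts (mdp_input P adj)"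

text \<open>The program \<open>c\<close> computes the MEC-decomposition of every MDP \<open>P\<close> with \<open>m \<ge> n\<close>, as a list of
  vertex lists in the arrays 7, 8, 9, within \<open>time P\<close> steps.\<close>

definition computes_MECs :: "com \<Rightarrow> (nat mdp \<Rightarrow> nat) \<Rightarrow> bool" where
  "computes_MECs c time \<longleftrightarrow>
     (\<forall>P adj. is_mdp P \<and> card (verts P) \<le> card (edges P) \<and> adjacency_lists P adj \<longrightarrow>
        (\<exists>t s mecs. exec c (mdp_input P adj) t s \<and> t \<le> time P \<and> holds_lists s 7 mecs \<and>
           (\<forall>xs\<in>set mecs. distinct xs) \<and> distinct (map set mecs) \<and>
           set (map set mecs) = MECs P))"

text \<open>The program \<open>c\<close> computes the almost-sure winning set of the disjunctive reachability query
  for every MDP \<open>P\<close> with \<open>m \<ge> n\<close> and all target sets \<open>Ts\<close>, as a list of vertices in the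
  arrays 7 (its length) and 8, within \<open>time P Ts\<close> steps.\<close>

definition computes_disjunctive_reach ::
    "com \<Rightarrow> (nat mdp \<Rightarrow> nat set list \<Rightarrow> nat) \<Rightarrow> bool" where
  "computes_disjunctive_reach c time \<longleftrightarrow>
     (\<forall>P adj Ts ts. is_mdp P \<and> card (verts P) \<le> card (edges P) \<and> adjacency_lists P adj \<and>
        (\<forall>T\<in>set Ts. T \<subseteq> verts P) \<and> list_all2 list_of_set ts Ts \<longrightarrow>
        (\<exists>t s xs. exec c (query_input P adj ts) t s \<and> t \<le> time P Ts \<and>
           holds_list s 7 [length xs] \<and> holds_list s 8 xs \<and>
           list_of_set xs (\<Union>i<length Ts. almost_sure P (Reach P (Ts ! i)))))"

end

theory Submission
  imports Defs
begin

text \<open>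
  Inside a maximal end component player 1 can almost surely reach every vertex and leave by any
  edge, so each such component behaves like a single player-1 vertex.  Once the components are
  contracted, every play almost surely ends up in one that it cannot or does not want to leave, and
  \<open>Reach(T)\<close> is almost surely winning unless the environment can push the play into a component
  without \<open>T\<close> and without useful exits.  The losing set is thus an attractor in the contracted graph,
  computed in linear time per target set by a worklist with a counter per block.

  That a losing vertex loses is certified by a positive function, zero on \<open>T\<close>, that does not decrease
  in expectation whatever player 1 does.  That any other vertex wins follows from the graph alone:
  \<open>T\<close> is reachable inside the nonlosing set, and always moving closer to \<open>T\<close> reaches it almost surely,
  because \<open>1 - q ^ d\<close>, with \<open>d\<close> the distance to \<open>T\<close> and \<open>q\<close> small, shrinks in expectation by a constant
  factor in every step.
\<close>

section \<open>Histories and plays\<close>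

text \<open>Two features of the model shape the argument. A strategy must answer every path ending
  in a player-1 vertex, so one player-1 dead end anywhere leaves no strategy and empties every
  winning set; dead ends are split off, and the program tests for them. And the program for the
  components is specified only from one exact initial state, so it runs on renamed arrays holding a
  verbatim copy of the input.

  The rules for losing blocks become one numerical condition: a block is lost once the number of its
  edges into lost blocks reaches a threshold. The threshold is the number of exits for a block
  controlled by player 1, \<open>1\<close> for a random vertex outside all components, and m + 1,
  hence unreachable, for a block that meets \<open>T\<close>. Only the last kind depends on
  \<open>T\<close>. Components, edge lists and initial counters are shared by all queries, so each
  query costs O(m + n), which is O(m) as n \<le> m. The preprocessing costs O(m) beyond MEC, which
  is absorbed because MEC = Omega(m).\<close>

definition next_pmf :: "'v mdp \<Rightarrow> ('v list \<Rightarrow> 'v) \<Rightarrow> 'v \<Rightarrow> 'v list \<Rightarrow> 'v pmf" where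
  "next_pmf P \<sigma> v h = (if h = [] then return_pmf v else step_pmf P \<sigma> h)"

text \<open>The law of the first \<open>n\<close> vertices of a play as a discrete distribution on
  lists. Probability estimates are made here, where no measurability questions arise; the measure on
  infinite plays enters only through its prefixes and a limit.\<close>

primrec history_pmf :: "'v mdp \<Rightarrow> ('v list \<Rightarrow> 'v) \<Rightarrow> 'v \<Rightarrow> nat \<Rightarrow> 'v list pmf" where
  "history_pmf P \<sigma> v 0 = return_pmf []"
| "history_pmf P \<sigma> v (Suc n) =
     bind_pmf (history_pmf P \<sigma> v n) (\<lambda>h. map_pmf (\<lambda>w. h @ [w]) (next_pmf P \<sigma> v h))"

lemma nn_integral_history_Suc:
  "(\<integral>\<^sup>+h. g h \<partial>history_pmf P \<sigma> v (Suc n)) =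
     (\<integral>\<^sup>+h. (\<integral>\<^sup>+w. g (h @ [w]) \<partial>next_pmf P \<sigma> v h) \<partial>history_pmf P \<sigma> v n)"
  by simp

lemma set_pmf_history_SucE:
  assumes "h \<in> set_pmf (history_pmf P \<sigma> v (Suc n))"
  obtains h' w where "h' \<in> set_pmf (history_pmf P \<sigma> v n)" "w \<in> set_pmf (next_pmf P \<sigma> v h')"
    "h = h' @ [w]"
  using assms by auto

declare history_pmf.simps(2) [simp del]

lemma history_pmf_1: "history_pmf P \<sigma> v (Suc 0) = return_pmf [v]"
  by (simp add: history_pmf.simps next_pmf_def bind_return_pmf)

lemma play_kernel_eq: "play_kernel P \<sigma> v i \<omega> = measure_pmf (next_pmf P \<sigma> v (map \<omega> [0..<i]))"
  by (simp add: play_kernel_def next_pmf_def)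

text \<open>The Ionescu-Tulcea limit, restricted to the coordinates below \<open>n\<close>, is the
  composition \<open>C 0 n\<close> of the first \<open>n\<close> kernels, and this composition obeys
  the same recursion as \<open>history_pmf\<close>.\<close>

lemma nn_integral_play_prefix:
  fixes P :: "'v::countable mdp"
  shows "(\<integral>\<^sup>+\<omega>. g (map \<omega> [0..<n]) \<partial>play_measure P \<sigma> v) = (\<integral>\<^sup>+h. g h \<partial>history_pmf P \<sigma> v n)"
proof -
  let ?M = "\<lambda>_. count_space (UNIV :: 'v set)"
  interpret IT: Ionescu_Tulcea "play_kernel P \<sigma> v" ?M
    by (rule Ionescu_Tulcea_play_kernel)
  \<comment> \<open>Countability of the vertex type makes a finite product of the discrete spaces
    discrete, so every function of a prefix is measurable.\<close>
  have meas: "f \<in> borel_measurable (PiM {0..<n} ?M)" for f :: "(nat \<Rightarrow> 'v) \<Rightarrow> ennreal" and n :: nat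
  proof -
    have "PiM {0..<n} ?M = count_space (PiE {0..<n} (\<lambda>_. UNIV))"
      by (rule count_space_PiM_finite) auto
    then show ?thesis by simp
  qed
  have C: "(\<integral>\<^sup>+\<omega>. g (map \<omega> [0..<n]) \<partial>IT.C 0 n (\<lambda>_. undefined)) = (\<integral>\<^sup>+h. g h \<partial>history_pmf P \<sigma> v n)"
    for n g
  proof (induction n arbitrary: g)
    case 0
    show ?case
      using nn_integral_return[of "\<lambda>_. undefined" "PiM {} ?M" "\<lambda>_. g []"]
      by (simp add: space_PiM del: nn_integral_const)
  next
    case (Suc n)
    have "(\<integral>\<^sup>+\<omega>. g (map \<omega> [0..<Suc n]) \<partial>IT.C 0 (Suc n) (\<lambda>_. undefined)) =
       (\<integral>\<^sup>+\<omega>. (\<integral>\<^sup>+x. g (map x [0..<Suc n]) \<partial>IT.eP n \<omega>) \<partial>IT.C 0 n (\<lambda>_. undefined))"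
      unfolding IT.C.simps add_0
    proof (rule nn_integral_bind[where B = "PiM {0..<Suc n} ?M"])
      have eq: "sets (IT.C 0 n (\<lambda>_. undefined)) = sets (PiM {0..<n} ?M)"
        using IT.sets_C[of "\<lambda>_. undefined" 0 n] by (simp add: space_PiM)
      show "IT.eP n \<in> measurable (IT.C 0 n (\<lambda>_. undefined)) (subprob_algebra (PiM {0..<Suc n} ?M))"
        unfolding measurable_cong_sets[OF eq refl] by (rule IT.measurable_eP)
    qed (rule meas)
    also have "\<dots> = (\<integral>\<^sup>+\<omega>. (\<integral>\<^sup>+w. g (map \<omega> [0..<n] @ [w]) \<partial>next_pmf P \<sigma> v (map \<omega> [0..<n]))
        \<partial>IT.C 0 n (\<lambda>_. undefined))"
    proof (rule nn_integral_cong)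
      fix \<omega> :: "nat \<Rightarrow> 'v"
      have upd: "map (fun_upd \<omega> n w) [0..<Suc n] = map \<omega> [0..<n] @ [w]" for w
        by auto
      assume "\<omega> \<in> space (IT.C 0 n (\<lambda>_. undefined))"
      then have "\<omega> \<in> space (PiM {0..<n} ?M)"
        using IT.space_C[of "\<lambda>_. undefined" 0 n] by (simp add: space_PiM)
      then have "(\<integral>\<^sup>+x. g (map x [0..<Suc n]) \<partial>IT.eP n \<omega>) =
          (\<integral>\<^sup>+w. g (map (fun_upd \<omega> n w) [0..<Suc n]) \<partial>play_kernel P \<sigma> v n \<omega>)"
        by (rule IT.nn_integral_eP) (rule meas)
      then show "(\<integral>\<^sup>+x. g (map x [0..<Suc n]) \<partial>IT.eP n \<omega>) =
          (\<integral>\<^sup>+w. g (map \<omega> [0..<n] @ [w]) \<partial>next_pmf P \<sigma> v (map \<omega> [0..<n]))"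
        by (simp only: play_kernel_eq upd)
    qed
    also have "\<dots> = (\<integral>\<^sup>+h. (\<integral>\<^sup>+w. g (h @ [w]) \<partial>next_pmf P \<sigma> v h) \<partial>history_pmf P \<sigma> v n)"
      by (rule Suc.IH)
    finally show ?case by (simp only: nn_integral_history_Suc)
  qed
  have up: "IT.up_to {0..<n} = n"
  proof (rule antisym)
    show "IT.up_to {0..<n} \<le> n" by (simp add: IT.up_to_iff)
    show "n \<le> IT.up_to {0..<n}" using IT.up_to_iff_Ico[of "{0..<n}"] by (simp del: ivl_subset) force
  qed
  have map_restrict: "map (restrict \<omega> {0..<n}) [0..<n] = map \<omega> [0..<n]" for \<omega> :: "nat \<Rightarrow> 'v"
    by auto
  have CI: "distr (play_measure P \<sigma> v) (PiM {0..<n} ?M) (\<lambda>\<omega>. restrict \<omega> {0..<n}) =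
      distr (IT.C 0 n (\<lambda>_. undefined)) (PiM {0..<n} ?M) (\<lambda>\<omega>. restrict \<omega> {0..<n})"
    using IT.distr_lim[of "{0..<n}"] by (simp add: play_measure_def IT.CI_def up)
  have r1: "(\<lambda>\<omega>. restrict \<omega> {0..<n}) \<in> measurable (play_measure P \<sigma> v) (PiM {0..<n} ?M)"
    unfolding measurable_cong_sets[OF sets_play_measure(1) refl]
    by (rule measurable_restrict_subset) auto
  have r2: "(\<lambda>\<omega>. restrict \<omega> {0..<n}) \<in> measurable (IT.C 0 n (\<lambda>_. undefined)) (PiM {0..<n} ?M)"
    using IT.sets_C[of "\<lambda>_. undefined" 0 n]
    by (subst measurable_cong_sets[OF _ refl, where M' = "PiM {0..<n} ?M"])
      (auto simp: space_PiM intro!: measurable_restrict_subset)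
  have "(\<integral>\<^sup>+\<omega>. g (map \<omega> [0..<n]) \<partial>play_measure P \<sigma> v) =
      (\<integral>\<^sup>+\<omega>. g (map \<omega> [0..<n]) \<partial>distr (play_measure P \<sigma> v) (PiM {0..<n} ?M) (\<lambda>\<omega>. restrict \<omega> {0..<n}))"
    by (subst nn_integral_distr[OF r1]) (simp_all only: map_restrict measurable_distr_eq1 meas)
  also have "\<dots> = (\<integral>\<^sup>+\<omega>. g (map \<omega> [0..<n]) \<partial>IT.C 0 n (\<lambda>_. undefined))"
    unfolding CI
    by (subst nn_integral_distr[OF r2]) (simp_all only: map_restrict measurable_distr_eq1 meas)
  finally show ?thesis by (simp only: C)
qed

lemma emeasure_play_prefix:
  fixes P :: "'v::countable mdp"
  shows "emeasure (play_measure P \<sigma> v) {\<omega>. Q (map \<omega> [0..<n])} =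
     emeasure (history_pmf P \<sigma> v n) {h. Q h}"
    and "{\<omega>. Q (map \<omega> [0..<n])} \<in> sets (play_measure P \<sigma> v)"
proof -
  have "{\<omega>. Q (map \<omega> [0..<n])} = {\<omega> \<in> space (PiM UNIV (\<lambda>_. count_space (UNIV :: 'v set))).
      Q (map \<omega> [0..<n])}"
    by (auto simp: space_PiM)
  also have "\<dots> \<in> sets (PiM UNIV (\<lambda>_. count_space UNIV))"
  proof -
    have "(\<lambda>\<omega>. map \<omega> [0..<n]) \<in> measurable (PiM UNIV (\<lambda>_. count_space (UNIV :: 'v set))) (count_space UNIV)"
    proof (induction n)
      case (Suc n)
      note [measurable] = Suc
      have "(\<lambda>\<omega>. (\<lambda>(h, w). h @ [w]) (map \<omega> [0..<n], \<omega> n)) \<in>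
          measurable (PiM UNIV (\<lambda>_. count_space (UNIV :: 'v set))) (count_space UNIV)"
        by (rule measurable_compose[where N = "count_space UNIV \<Otimes>\<^sub>M count_space UNIV"])
          (auto simp: pair_measure_countable)
      then show ?case by simp
    qed simp
    then show ?thesis by measurable
  qed
  finally show sets: "{\<omega>. Q (map \<omega> [0..<n])} \<in> sets (play_measure P \<sigma> v)"
    by (simp add: sets_play_measure)
  have "emeasure (play_measure P \<sigma> v) {\<omega>. Q (map \<omega> [0..<n])} =
      (\<integral>\<^sup>+\<omega>. indicator {h. Q h} (map \<omega> [0..<n]) \<partial>play_measure P \<sigma> v)"
    by (subst nn_integral_indicator[OF sets, symmetric]) (auto intro!: nn_integral_cong simp: indicator_def)
  also have "\<dots> = emeasure (history_pmf P \<sigma> v n) {h. Q h}"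
    by (subst nn_integral_play_prefix) simp
  finally show "emeasure (play_measure P \<sigma> v) {\<omega>. Q (map \<omega> [0..<n])} =
     emeasure (history_pmf P \<sigma> v n) {h. Q h}" .
qed


lemma set_pmf_history_path:
  assumes P: "is_mdp P" and \<sigma>: "strategy P \<sigma>" and v: "v \<in> verts P"
    and h: "h \<in> set_pmf (history_pmf P \<sigma> v (Suc n))"
  shows "finite_path P h"
  using h
proof (induction n arbitrary: h)
  case 0
  then show ?case using v by (auto simp: history_pmf_1 finite_path_def)
next
  case (Suc n)
  then obtain h' w where h': "h' \<in> set_pmf (history_pmf P \<sigma> v (Suc n))"
    and w: "w \<in> set_pmf (next_pmf P \<sigma> v h')" and h: "h = h' @ [w]"
    by (subst (asm) history_pmf.simps(2)) auto
  from Suc.IH[OF h'] have path: "finite_path P h'" .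
  then have ne: "h' \<noteq> []" and last: "last h' \<in> verts P" by (auto simp: finite_path_def)
  have "(last h', w) \<in> edges P"
  proof (cases "last h' \<in> player1 P")
    case True
    with w ne have "w = \<sigma> h'" by (simp add: next_pmf_def step_pmf_def)
    with \<sigma> path True show ?thesis by (simp add: strategy_def)
  next
    case False
    with last P have "last h' \<in> random P" by (auto simp: is_mdp_def)
    moreover from w ne False have "pmf (delta P (last h')) w > 0"
      by (simp add: next_pmf_def step_pmf_def pmf_positive)
    ultimately show ?thesis using P by (auto simp: is_mdp_def)
  qed
  moreover from this P have "w \<in> verts P" by (auto simp: is_mdp_def)
  ultimately show ?case using path ne
    by (auto simp: h finite_path_def successively_append_iff)
qed

text \<open>Each prefix is almost surely a path, and countably many prefixes decide whether a
  sequence is a play. \<open>Reach\<close> contains only plays, while the measure lives on all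
  vertex sequences.\<close>

lemma AE_plays:
  fixes P :: "'v::countable mdp"
  assumes "is_mdp P" "strategy P \<sigma>" "v \<in> verts P"
  shows "AE \<omega> in play_measure P \<sigma> v. \<omega> \<in> plays P"
proof -
  have "AE \<omega> in play_measure P \<sigma> v. finite_path P (map \<omega> [0..<Suc n])" for n
  proof (rule AE_I')
    have "emeasure (history_pmf P \<sigma> v (Suc n)) {h. \<not> finite_path P h} = 0"
      using set_pmf_history_path[OF assms]
      by (auto simp: measure_pmf.emeasure_eq_measure measure_pmf_zero_iff )
    then show "{\<omega>. \<not> finite_path P (map \<omega> [0..<Suc n])} \<in> null_sets (play_measure P \<sigma> v)"
      using emeasure_play_prefix[where P = P and Q = "\<lambda>h. \<not> finite_path P h" and n = "Suc n" and \<sigma> = \<sigma> and v = v]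
      by (intro null_setsI) simp_all
  qed auto
  then have "AE \<omega> in play_measure P \<sigma> v. \<forall>n. finite_path P (map \<omega> [0..<Suc n])"
    by (simp add: AE_all_countable)
  then show ?thesis
  proof (rule AE_mp[OF _ AE_I2], intro impI)
    fix \<omega> assume path: "\<forall>n. finite_path P (map \<omega> [0..<Suc n])"
    have "(\<omega> i, \<omega> (Suc i)) \<in> edges P" for i
      using path[rule_format, of "Suc i"]
      by (auto simp: finite_path_def successively_append_iff)
    then show "\<omega> \<in> plays P" by (simp add: plays_def)
  qed
qed

section \<open>Bounds on the probability of avoiding a target\<close>

definition avoids :: "'v set \<Rightarrow> 'v list \<Rightarrow> bool" where
  "avoids T h \<longleftrightarrow> set h \<inter> T = {}"

lemma avoids_append: "avoids T (h @ [w]) \<longleftrightarrow> avoids T h \<and> w \<notin> T"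
  by (auto simp: avoids_def)

lemma avoids_last: "avoids T h \<Longrightarrow> h \<noteq> [] \<Longrightarrow> last h \<notin> T"
  by (auto simp: avoids_def disjoint_iff)

text \<open>Continuity from above: avoiding \<open>T\<close> forever is the decreasing limit of
  avoiding it on longer and longer prefixes.\<close>

lemma avoid_forever:
  fixes P :: "'v::countable mdp" and T :: "'v set"
  defines "N \<equiv> {\<omega>. \<forall>i. \<omega> i \<notin> T}"
  shows "N \<in> sets (play_measure P \<sigma> v)"
    and "emeasure (play_measure P \<sigma> v) N = (INF n. emeasure (history_pmf P \<sigma> v (Suc n)) {h. avoids T h})"
proof -
  interpret prob_space "play_measure P \<sigma> v" by (rule sets_play_measure)
  let ?A = "\<lambda>n. {\<omega>. avoids T (map \<omega> [0..<Suc n])}"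
  have N: "N = (\<Inter>n. ?A n)"
    by (auto simp: N_def avoids_def disjoint_iff)
  have A: "?A n \<in> sets (play_measure P \<sigma> v)" for n
    by (rule emeasure_play_prefix)
  show "N \<in> sets (play_measure P \<sigma> v)"
    unfolding N by (rule sets.countable_INT) (use A in auto)
  have "(INF n. emeasure (play_measure P \<sigma> v) (?A n)) = emeasure (play_measure P \<sigma> v) (\<Inter>n. ?A n)"
  proof (rule INF_emeasure_decseq)
    have "set (map \<omega> [0..<Suc m]) \<subseteq> set (map \<omega> [0..<Suc n])" if "m \<le> n" for m n and \<omega> :: "nat \<Rightarrow> 'v"
      using that unfolding set_map set_upt by (intro image_mono) auto
    then show "decseq ?A" unfolding decseq_def avoids_def by blast
  qed (use A in auto)
  then show "emeasure (play_measure P \<sigma> v) N = (INF n. emeasure (history_pmf P \<sigma> v (Suc n)) {h. avoids T h})"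
    unfolding N emeasure_play_prefix(1) by simp
qed

text \<open>A certificate valid against every strategy, since the player-1 condition ranges over all
  moves. Values in \<open>ennreal\<close> allow suprema and integrals without side
  conditions.\<close>

definition subharmonic :: "'v mdp \<Rightarrow> 'v set \<Rightarrow> ('v \<Rightarrow> ennreal) \<Rightarrow> bool" where
  "subharmonic P T f \<longleftrightarrow>
     (\<forall>v. f v \<le> 1) \<and> (\<forall>v\<in>T. f v = 0) \<and>
     (\<forall>v\<in>player1 P - T. \<forall>w. (v, w) \<in> edges P \<longrightarrow> f v \<le> f w) \<and>
     (\<forall>v\<in>random P - T. f v \<le> (\<integral>\<^sup>+w. f w \<partial>delta P v))"

text \<open>A submartingale argument: the expectation of \<open>f\<close> at the current vertex,
  counted only while \<open>T\<close> is avoided, never falls below \<open>f v\<close>. Entering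
  \<open>T\<close> loses nothing because \<open>f\<close> vanishes there, and
  \<open>f \<le> 1\<close> turns the expectation into a lower bound for the probability.\<close>

lemma avoid_ge_subharmonic:
  assumes P: "is_mdp P" and \<sigma>: "strategy P \<sigma>" and v: "v \<in> verts P" and f: "subharmonic P T f"
  shows "f v \<le> emeasure (history_pmf P \<sigma> v (Suc n)) {h. avoids T h}"
proof -
  let ?F = "\<lambda>h. f (last h) * indicator {h. avoids T h} h"
  have "f v \<le> (\<integral>\<^sup>+h. ?F h \<partial>history_pmf P \<sigma> v (Suc n))"
  proof (induction n)
    case 0
    show ?case using f
      by (auto simp: history_pmf_1 avoids_def subharmonic_def indicator_def)
  next
    case (Suc n)
    have "(\<integral>\<^sup>+h. ?F h \<partial>history_pmf P \<sigma> v (Suc n)) \<le>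
        (\<integral>\<^sup>+h. (\<integral>\<^sup>+w. ?F (h @ [w]) \<partial>next_pmf P \<sigma> v h) \<partial>history_pmf P \<sigma> v (Suc n))"
    proof (intro nn_integral_mono_AE AE_pmfI)
      fix h assume h: "h \<in> set_pmf (history_pmf P \<sigma> v (Suc n))"
      then have path: "finite_path P h" by (rule set_pmf_history_path[OF P \<sigma> v])
      then have ne: "h \<noteq> []" and last: "last h \<in> verts P" by (auto simp: finite_path_def)
      show "?F h \<le> (\<integral>\<^sup>+w. ?F (h @ [w]) \<partial>next_pmf P \<sigma> v h)"
      proof (cases "avoids T h")
        case True
        then have F: "?F (h @ [w]) = f w" for w
          using f by (auto simp: avoids_append subharmonic_def indicator_def)
        have nT: "last h \<notin> T" using True ne by (rule avoids_last)
        have "f (last h) \<le> (\<integral>\<^sup>+w. f w \<partial>step_pmf P \<sigma> h)"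
        proof (cases "last h \<in> player1 P")
          case True
          with \<sigma> path have "(last h, \<sigma> h) \<in> edges P" by (simp add: strategy_def)
          with True nT f show ?thesis by (auto simp: step_pmf_def subharmonic_def)
        next
          case False
          with last P have "last h \<in> random P" by (auto simp: is_mdp_def)
          with False nT f show ?thesis by (auto simp: step_pmf_def subharmonic_def)
        qed
        with True ne show ?thesis by (simp only: F) (simp add: next_pmf_def)
      qed simp
    qed
    with Suc show ?case
      by (simp only: nn_integral_history_Suc[where g = ?F and n = "Suc n"])
  qed
  also have "\<dots> \<le> (\<integral>\<^sup>+h. indicator {h. avoids T h} h \<partial>history_pmf P \<sigma> v (Suc n))"
    using f by (intro nn_integral_mono) (auto simp: subharmonic_def indicator_def)
  finally show ?thesis by simp
qed

lemma not_almost_sure_if_subharmonic: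
  fixes P :: "'v::countable mdp"
  assumes P: "is_mdp P" and f: "subharmonic P T f" and pos: "f v > 0"
  shows "v \<notin> almost_sure P (Reach P T)"
proof
  assume "v \<in> almost_sure P (Reach P T)"
  then obtain \<sigma> where v: "v \<in> verts P" and \<sigma>: "strategy P \<sigma>"
    and one: "measure (play_measure P \<sigma> v) (Reach P T) = 1"
    by (auto simp: almost_sure_def)
  interpret prob_space "play_measure P \<sigma> v" by (rule sets_play_measure)
  let ?N = "{\<omega>. \<forall>i. \<omega> i \<notin> T}"
  have "f v \<le> emeasure (play_measure P \<sigma> v) ?N"
    unfolding avoid_forever(2) by (rule INF_greatest) (rule avoid_ge_subharmonic[OF P \<sigma> v f])
  with pos have "0 < ennreal (prob ?N)"
    unfolding emeasure_eq_measure by (rule less_le_trans)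
  then have "prob ?N > 0" by (simp only: ennreal_less_zero_iff)
  moreover have "prob (?N \<union> Reach P T) = prob ?N + prob (Reach P T)"
    by (rule finite_measure_Union) (auto intro: avoid_forever(1) sets_play_measure(3), auto simp: Reach_def)
  ultimately show False using one prob_le_1[of "?N \<union> Reach P T"] by simp
qed

text \<open>The expectation of \<open>g\<close> over histories that still avoid \<open>T\<close>
  decays geometrically, but it is at least \<open>c\<close> times their probability; hence that
  probability tends to 0. Membership in \<open>W\<close> has to persist only until \<open>T\<close>
  is hit.\<close>

lemma almost_sure_if_contracting:
  fixes P :: "'v::countable mdp" and g :: "'v \<Rightarrow> ennreal"
  assumes P: "is_mdp P" and \<sigma>: "strategy P \<sigma>" and W: "W \<subseteq> verts P" and v: "v \<in> W"
    and closed: "\<And>h w. finite_path P h \<Longrightarrow> last h \<in> W - T \<Longrightarrow> w \<in> set_pmf (step_pmf P \<sigma> h) \<Longrightarrow> w \<in> W"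
    and le_1: "\<And>v. g v \<le> 1" and c: "0 < c" "\<And>v. v \<in> W - T \<Longrightarrow> c \<le> g v"
    and r: "0 \<le> r" "r < 1"
    and step: "\<And>h. finite_path P h \<Longrightarrow> last h \<in> W - T \<Longrightarrow> (\<integral>\<^sup>+w. g w \<partial>step_pmf P \<sigma> h) \<le> ennreal r * g (last h)"
  shows "v \<in> almost_sure P (Reach P T)"
proof -
  from v W have v': "v \<in> verts P" by auto
  note path = set_pmf_history_path[OF P \<sigma> v']
  have inW: "last h \<in> W" if "h \<in> set_pmf (history_pmf P \<sigma> v (Suc n))" "avoids T h" for h n
    using that
  proof (induction n arbitrary: h)
    case 0
    then show ?case using v by (auto simp: history_pmf_1)
  next
    case (Suc n)
    then obtain h' w where h': "h' \<in> set_pmf (history_pmf P \<sigma> v (Suc n))"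
      and w: "w \<in> set_pmf (next_pmf P \<sigma> v h')" and h: "h = h' @ [w]"
      by (auto elim: set_pmf_history_SucE[of _ _ _ _ "Suc n"])
    from path[OF h'] have ne: "h' \<noteq> []" by (auto simp: finite_path_def)
    from Suc.prems(2) have av: "avoids T h'" by (simp add: h avoids_append)
    with Suc.IH[OF h'] ne have "last h' \<in> W - T" by (auto dest: avoids_last)
    from closed[OF path[OF h'] this, of w] w ne show ?case by (simp add: h next_pmf_def)
  qed
  let ?F = "\<lambda>h. g (last h) * indicator {h. avoids T h} h"
  have E: "(\<integral>\<^sup>+h. ?F h \<partial>history_pmf P \<sigma> v (Suc n)) \<le> ennreal (r ^ n)" for n
  proof (induction n)
    case 0
    show ?case using le_1
      by (auto simp: history_pmf_1 indicator_def)
  next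
    case (Suc n)
    have "(\<integral>\<^sup>+h. (\<integral>\<^sup>+w. ?F (h @ [w]) \<partial>next_pmf P \<sigma> v h) \<partial>history_pmf P \<sigma> v (Suc n)) \<le>
        (\<integral>\<^sup>+h. ennreal r * ?F h \<partial>history_pmf P \<sigma> v (Suc n))"
    proof (intro nn_integral_mono_AE AE_pmfI)
      fix h assume h: "h \<in> set_pmf (history_pmf P \<sigma> v (Suc n))"
      from path[OF this] have ne: "h \<noteq> []" by (auto simp: finite_path_def)
      show "(\<integral>\<^sup>+w. ?F (h @ [w]) \<partial>next_pmf P \<sigma> v h) \<le> ennreal r * ?F h"
      proof (cases "avoids T h")
        case True
        have "(\<integral>\<^sup>+w. ?F (h @ [w]) \<partial>next_pmf P \<sigma> v h) \<le> (\<integral>\<^sup>+w. g w \<partial>step_pmf P \<sigma> h)"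
          using ne by (auto simp: next_pmf_def intro!: nn_integral_mono split: split_indicator)
        also have "\<dots> \<le> ennreal r * g (last h)"
          using True ne inW[OF h] by (intro step path[OF h]) (auto dest: avoids_last)
        finally show ?thesis using True by simp
      qed (simp add: avoids_append)
    qed
    also have "\<dots> = ennreal r * (\<integral>\<^sup>+h. ?F h \<partial>history_pmf P \<sigma> v (Suc n))"
      by (rule nn_integral_cmult) simp
    also have "\<dots> \<le> ennreal r * ennreal (r ^ n)"
      using Suc by (intro mult_left_mono) auto
    also have "\<dots> = ennreal (r ^ Suc n)"
      using r by (simp add: ennreal_mult)
    finally show ?case by (simp only: nn_integral_history_Suc[where g = ?F and n = "Suc n"])
  qed
  interpret prob_space "play_measure P \<sigma> v" by (rule sets_play_measure)
  let ?N = "{\<omega>. \<forall>i. \<omega> i \<notin> T}"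
  have le: "c * emeasure (play_measure P \<sigma> v) ?N \<le> ennreal (r ^ n)" for n
  proof -
    have "c * emeasure (play_measure P \<sigma> v) ?N \<le> c * emeasure (history_pmf P \<sigma> v (Suc n)) {h. avoids T h}"
      unfolding avoid_forever(2) by (intro mult_left_mono INF_lower) auto
    also have "\<dots> = (\<integral>\<^sup>+h. c * indicator {h. avoids T h} h \<partial>history_pmf P \<sigma> v (Suc n))"
      by (subst nn_integral_cmult) simp_all
    also have "\<dots> \<le> (\<integral>\<^sup>+h. ?F h \<partial>history_pmf P \<sigma> v (Suc n))"
    proof (intro nn_integral_mono_AE AE_pmfI)
      fix h assume h: "h \<in> set_pmf (history_pmf P \<sigma> v (Suc n))"
      from path[OF this] have "h \<noteq> []" by (auto simp: finite_path_def)
      with inW[OF h] c(2)[of "last h"] show "c * indicator {h. avoids T h} h \<le> ?F h"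
        by (auto simp: indicator_def dest: avoids_last)
    qed
    finally show ?thesis using E[of n] by (rule order_trans)
  qed
  have "(\<lambda>n. ennreal (r ^ n)) \<longlonglongrightarrow> ennreal 0"
    using r by (intro tendsto_ennrealI LIMSEQ_realpow_zero) auto
  then have "c * emeasure (play_measure P \<sigma> v) ?N \<le> ennreal 0"
    by (rule LIMSEQ_le_const) (use le in auto)
  with c(1) have "emeasure (play_measure P \<sigma> v) ?N = 0" by auto
  then have "AE \<omega> in play_measure P \<sigma> v. \<omega> \<notin> ?N"
    by (intro AE_not_in null_setsI avoid_forever)
  with AE_plays[OF P \<sigma> v'] have "AE \<omega> in play_measure P \<sigma> v. \<omega> \<in> Reach P T"
    by eventually_elim (auto simp: Reach_def)
  then have "prob (Reach P T) = 1"
    by (subst prob_eq_1) (auto intro: sets_play_measure(3))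
  with v' \<sigma> show ?thesis by (auto simp: almost_sure_def)
qed

section \<open>Almost-sure reachability and end components\<close>

lemma end_component_Un:
  assumes X: "end_component P X" and Y: "end_component P Y" and XY: "X \<inter> Y \<noteq> {}"
  shows "end_component P (X \<union> Y)"
proof -
  obtain z where z: "z \<in> X" "z \<in> Y" using XY by auto
  let ?R = "\<lambda>X. (edges P \<inter> X \<times> X)\<^sup>*"
  have mono: "?R X \<subseteq> ?R (X \<union> Y)" "?R Y \<subseteq> ?R (X \<union> Y)"
    by (intro rtrancl_mono; auto)+
  \<comment> \<open>Any two vertices of the union are joined by a walk through the common vertex
    \<open>z\<close>.\<close>
  have "(u, z) \<in> ?R (X \<union> Y)" "(z, u) \<in> ?R (X \<union> Y)" if "u \<in> X \<union> Y" for u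
    using that X Y z mono unfolding end_component_def by blast+
  then have "(u, v) \<in> ?R (X \<union> Y)" if "u \<in> X \<union> Y" "v \<in> X \<union> Y" for u v
    using that by (meson rtrancl_trans)
  then show ?thesis
    using X Y unfolding end_component_def by blast
qed

lemma MECs_disjoint:
  assumes "M \<in> MECs P" "N \<in> MECs P" "M \<inter> N \<noteq> {}"
  shows "M = N"
  using assms end_component_Un[of P M N] unfolding MECs_def
  by (metis (mono_tags, lifting) mem_Collect_eq sup.cobounded1 sup.cobounded2)

lemma end_component_subset_MEC:
  assumes "finite (verts P)" "end_component P X"
  obtains M where "M \<in> MECs P" "X \<subseteq> M"
proof -
  let ?A = "{Y. end_component P Y \<and> X \<subseteq> Y}"
  have "?A \<subseteq> Pow (verts P)" by (auto simp: end_component_def)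
  then have "finite ?A" using assms(1) by (auto intro: finite_subset)
  moreover have "?A \<noteq> {}" using assms(2) by auto
  ultimately obtain M where "M \<in> ?A" "\<forall>Y\<in>?A. M \<le> Y \<longrightarrow> M = Y"
    by (meson finite_has_maximal)
  then have "M \<in> MECs P" "X \<subseteq> M" by (auto simp: MECs_def)
  then show thesis by (rule that)
qed

lemma MEC_nonempty: "M \<in> MECs P \<Longrightarrow> M \<noteq> {}"
  by (auto simp: MECs_def end_component_def)

lemma MEC_subset_verts: "M \<in> MECs P \<Longrightarrow> M \<subseteq> verts P"
  by (auto simp: MECs_def end_component_def)

lemma MEC_random_closed:
  "M \<in> MECs P \<Longrightarrow> v \<in> M \<Longrightarrow> v \<in> random P \<Longrightarrow> (v, w) \<in> edges P \<Longrightarrow> w \<in> M"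
  by (auto simp: MECs_def end_component_def)

lemma MEC_connected:
  "M \<in> MECs P \<Longrightarrow> u \<in> M \<Longrightarrow> v \<in> M \<Longrightarrow> (u, v) \<in> (edges P \<inter> M \<times> M)\<^sup>*"
  by (auto simp: MECs_def end_component_def)

lemma MEC_successor:
  assumes M: "M \<in> MECs P" and u: "u \<in> M"
  obtains w where "(u, w) \<in> edges P" "w \<in> M"
proof -
  from M obtain a b where ab: "(a, b) \<in> edges P" "a \<in> M" "b \<in> M"
    by (auto simp: MECs_def end_component_def)
  from MEC_connected[OF M u ab(2)] show thesis
    by (cases rule: converse_rtranclE) (use ab that in auto)
qed

text \<open>The vertices of the contracted graph. Maximal end components are disjoint, so the union
  has at most one member, and a block is either a whole component or a single vertex outside all of
  them.\<close>

definition block :: "'v mdp \<Rightarrow> 'v \<Rightarrow> 'v set" where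
  "block P v = insert v (\<Union>{M \<in> MECs P. v \<in> M})"

lemma block_self: "v \<in> block P v"
  by (simp add: block_def)

lemma block_MEC: "M \<in> MECs P \<Longrightarrow> v \<in> M \<Longrightarrow> block P v = M"
  by (auto simp: block_def dest: MECs_disjoint)

lemma block_not_MEC: "v \<notin> \<Union>(MECs P) \<Longrightarrow> block P v = {v}"
  by (auto simp: block_def)

lemma block_eq: "u \<in> block P v \<Longrightarrow> block P u = block P v"
  by (cases "v \<in> \<Union>(MECs P)") (auto simp: block_MEC block_not_MEC)

text \<open>The vertices from which, whatever player 1 does, the play misses \<open>T\<close> with positive
  probability.\<close>

inductive_set losing :: "'v mdp \<Rightarrow> 'v set \<Rightarrow> 'v set" for P T where
  choice: "v \<in> verts P \<Longrightarrow> v \<in> player1 P \<or> v \<in> \<Union>(MECs P) \<Longrightarrow> block P v \<inter> T = {} \<Longrightarrow>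
    (\<And>u w. u \<in> block P v \<Longrightarrow> (u, w) \<in> edges P \<Longrightarrow> w \<notin> block P v \<Longrightarrow> w \<in> losing P T) \<Longrightarrow>
    v \<in> losing P T"
| chance: "v \<in> random P \<Longrightarrow> v \<notin> \<Union>(MECs P) \<Longrightarrow> v \<notin> T \<Longrightarrow> (v, w) \<in> edges P \<Longrightarrow> w \<in> losing P T \<Longrightarrow>
    v \<in> losing P T"

text \<open>Inside a component only the rule \<open>choice\<close> applies, and its premises depend
  on the vertex only through its block; outside, blocks are singletons.\<close>

lemma losing_block:
  assumes P: "is_mdp P" and v: "v \<in> losing P T" and u: "u \<in> block P v"
  shows "u \<in> losing P T"
proof (cases "v \<in> \<Union>(MECs P)")
  case True
  then obtain M where M: "M \<in> MECs P" "v \<in> M" by auto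
  then have b: "block P v = M" "block P u = M" using u by (auto simp: block_MEC)
  from v show ?thesis
  proof cases
    case choice
    show ?thesis
    proof (rule losing.choice)
      show "u \<in> verts P" using b u MEC_subset_verts[OF M(1)] by auto
      show "u \<in> player1 P \<or> u \<in> \<Union>(MECs P)" using b u M by auto
      show "block P u \<inter> T = {}" using choice b by simp
      show "w \<in> losing P T" if "x \<in> block P u" "(x, w) \<in> edges P" "w \<notin> block P u" for x w
        using choice(4)[of x w] that b by simp
    qed
  qed (use True in auto)
qed (use v u in \<open>simp add: block_not_MEC\<close>)

section \<open>Certificates for losing vertices\<close>

definition max_subharmonic :: "'v mdp \<Rightarrow> 'v set \<Rightarrow> 'v \<Rightarrow> ennreal" where
  "max_subharmonic P T v = (SUP f \<in> {f. subharmonic P T f}. f v)"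

lemma max_subharmonic_upper: "subharmonic P T f \<Longrightarrow> f v \<le> max_subharmonic P T v"
  unfolding max_subharmonic_def by (rule SUP_upper) simp

text \<open>All conditions survive suprema, so there is a largest certificate. This spares combining
  separate certificates for the many premises of \<open>choice\<close>: positivity at every exit
  refers to one and the same function.\<close>

lemma subharmonic_max_subharmonic: "subharmonic P T (max_subharmonic P T)"
  unfolding subharmonic_def
proof (intro conjI ballI allI impI)
  fix v show "max_subharmonic P T v \<le> 1"
    unfolding max_subharmonic_def by (rule SUP_least) (auto simp: subharmonic_def)
next
  fix v assume "v \<in> T"
  then have "max_subharmonic P T v \<le> 0"
    unfolding max_subharmonic_def by (intro SUP_least) (auto simp: subharmonic_def)
  then show "max_subharmonic P T v = 0" by simp
next
  fix v w assume v: "v \<in> player1 P - T" "(v, w) \<in> edges P"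
  then have "f v \<le> f w" if "subharmonic P T f" for f
    using that by (auto simp: subharmonic_def)
  then have "f v \<le> max_subharmonic P T w" if "subharmonic P T f" for f
    using order_trans[OF _ max_subharmonic_upper[OF that]] that by blast
  then show "max_subharmonic P T v \<le> max_subharmonic P T w"
    by (subst max_subharmonic_def) (auto intro: SUP_least)
next
  fix v assume v: "v \<in> random P - T"
  have "f v \<le> (\<integral>\<^sup>+w. max_subharmonic P T w \<partial>delta P v)" if "subharmonic P T f" for f
  proof -
    have "f v \<le> (\<integral>\<^sup>+w. f w \<partial>delta P v)" using v that by (simp add: subharmonic_def)
    also have "\<dots> \<le> (\<integral>\<^sup>+w. max_subharmonic P T w \<partial>delta P v)"
      by (intro nn_integral_mono max_subharmonic_upper that)
    finally show ?thesis .
  qed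
  then show "max_subharmonic P T v \<le> (\<integral>\<^sup>+w. max_subharmonic P T w \<partial>delta P v)"
    by (subst (1) max_subharmonic_def) (auto intro: SUP_least)
qed

text \<open>Raising \<open>f\<close> on \<open>B\<close> to at least \<open>e\<close> only enlarges
  the right-hand sides, so the old inequalities are inherited. What remains is to bound
  \<open>e\<close> on \<open>B\<close>: by the values at player-1 moves that leave \<open>B\<close>,
  and by the expectation at random vertices.\<close>

lemma subharmonic_raise:
  assumes f: "subharmonic P T f"
    and B: "B \<inter> T = {}" and e: "e \<le> 1"
    and p1: "\<And>u w. u \<in> B \<inter> player1 P \<Longrightarrow> (u, w) \<in> edges P \<Longrightarrow> w \<notin> B \<Longrightarrow> e \<le> f w"
    and r: "\<And>u. u \<in> B \<inter> random P \<Longrightarrow>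
      e \<le> (\<integral>\<^sup>+w. (if w \<in> B then max (f w) e else f w) \<partial>delta P u)"
  shows "subharmonic P T (\<lambda>v. if v \<in> B then max (f v) e else f v)" (is "subharmonic P T ?g")
proof -
  have le: "f v \<le> ?g v" for v by auto
  show ?thesis unfolding subharmonic_def
  proof (intro conjI ballI allI impI)
    show "?g v \<le> 1" for v using f e by (auto simp: subharmonic_def)
    show "?g v = 0" if "v \<in> T" for v using f B that by (auto simp: subharmonic_def)
  next
    fix v w assume vw: "v \<in> player1 P - T" "(v, w) \<in> edges P"
    then have "f v \<le> f w" using f by (auto simp: subharmonic_def)
    then have "f v \<le> ?g w" using le[of w] by (rule order_trans)
    moreover have "e \<le> ?g w" if "v \<in> B" using p1[of v w] vw that by auto
    ultimately show "?g v \<le> ?g w" by auto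
  next
    fix v assume v: "v \<in> random P - T"
    then have "f v \<le> (\<integral>\<^sup>+w. f w \<partial>delta P v)" using f by (simp add: subharmonic_def)
    also have "\<dots> \<le> (\<integral>\<^sup>+w. ?g w \<partial>delta P v)" by (intro nn_integral_mono le)
    finally have "f v \<le> (\<integral>\<^sup>+w. ?g w \<partial>delta P v)" .
    moreover have "e \<le> (\<integral>\<^sup>+w. ?g w \<partial>delta P v)" if "v \<in> B" using r[of v] v that by auto
    ultimately show "?g v \<le> (\<integral>\<^sup>+w. ?g w \<partial>delta P v)" by auto
  qed
qed

lemma set_pmf_delta:
  "is_mdp P \<Longrightarrow> v \<in> random P \<Longrightarrow> w \<in> set_pmf (delta P v) \<longleftrightarrow> (v, w) \<in> edges P"
  by (auto simp: is_mdp_def set_pmf_iff less_le)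

text \<open>In each case of the induction the largest certificate is raised at the new vertices to
  some \<open>e > 0\<close>; by maximality its value there was at least \<open>e\<close>
  already.\<close>

lemma max_subharmonic_pos:
  assumes P: "is_mdp P" and v: "v \<in> losing P T"
  shows "max_subharmonic P T v > 0"
  using v
proof induction
  case (choice v)
  let ?F = "max_subharmonic P T" and ?B = "block P v"
  let ?X = "{w. \<exists>u\<in>?B. (u, w) \<in> edges P \<and> w \<notin> ?B}"
  have "?X \<subseteq> verts P" using P by (auto simp: is_mdp_def)
  then have fin: "finite (insert 1 (?F ` ?X))" using P by (auto simp: is_mdp_def intro: finite_subset)
  \<comment> \<open>The inserted \<open>1\<close> caps \<open>e\<close> and covers a block without
    exits; \<open>e\<close> is positive because there are only finitely many exits.\<close>
  define e where "e = Min (insert 1 (?F ` ?X))"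
  have e_pos: "0 < e" using choice.IH fin unfolding e_def by (subst Min_gr_iff) auto
  have e1: "e \<le> 1" using fin unfolding e_def by (intro Min_le) auto
  have eX: "e \<le> ?F w" if "w \<in> ?X" for w using fin that unfolding e_def by (intro Min_le) auto
  have "subharmonic P T (\<lambda>v. if v \<in> ?B then max (?F v) e else ?F v)"
  proof (rule subharmonic_raise[OF subharmonic_max_subharmonic])
    fix u assume u: "u \<in> ?B \<inter> random P"
    \<comment> \<open>A block with a random vertex that comes from \<open>choice\<close> is a
      component: a player-1 vertex outside all components forms its block alone.\<close>
    from choice.hyps(2) have "v \<in> \<Union>(MECs P)"
    proof
      assume "v \<in> player1 P"
      then have "u \<noteq> v" using u P by (auto simp: is_mdp_def)
      then show ?thesis using u by (auto simp: block_def)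
    qed
    then obtain M where M: "M \<in> MECs P" "v \<in> M" by auto
    then have b: "?B = M" by (simp add: block_MEC)
    have "e = (\<integral>\<^sup>+w. e \<partial>delta P u)" by simp
    also have "\<dots> \<le> (\<integral>\<^sup>+w. (if w \<in> ?B then max (?F w) e else ?F w) \<partial>delta P u)"
    proof (intro nn_integral_mono_AE AE_pmfI)
      fix w assume "w \<in> set_pmf (delta P u)"
      then have "(u, w) \<in> edges P" using u P by (simp add: set_pmf_delta)
      then have "w \<in> ?B" using MEC_random_closed[OF M(1), of u w] u b by auto
      then show "e \<le> (if w \<in> ?B then max (?F w) e else ?F w)" by auto
    qed
    finally show "e \<le> (\<integral>\<^sup>+w. (if w \<in> ?B then max (?F w) e else ?F w) \<partial>delta P u)" .
  qed (use choice.hyps(3) e1 in \<open>auto intro!: eX\<close>)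
  from max_subharmonic_upper[OF this, of v] have "e \<le> ?F v" by (simp add: block_self)
  with e_pos show ?case by simp
next
  case (chance v w)
  let ?F = "max_subharmonic P T"
  have pos: "pmf (delta P v) w > 0" using P chance.hyps by (auto simp: is_mdp_def)
  have "ennreal (pmf (delta P v) w) * ?F w = (\<integral>\<^sup>+x. ?F x * indicator {w} x \<partial>delta P v)"
    by (simp add: emeasure_pmf_single mult.commute)
  also have "\<dots> \<le> (\<integral>\<^sup>+x. ?F x \<partial>delta P v)"
    by (intro nn_integral_mono) (auto split: split_indicator)
  finally have le: "ennreal (pmf (delta P v) w) * ?F w \<le> (\<integral>\<^sup>+x. ?F x \<partial>delta P v)" .
  \<comment> \<open>The share that the single successor \<open>w\<close> contributes to the
    expectation at \<open>v\<close>.\<close>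
  define e where "e = ennreal (pmf (delta P v) w) * ?F w"
  have e1: "e \<le> 1"
  proof -
    have "e \<le> 1 * 1" unfolding e_def
      using subharmonic_max_subharmonic[of P T] by (intro mult_mono) (auto simp: pmf_le_1 subharmonic_def)
    then show ?thesis by simp
  qed
  have "subharmonic P T (\<lambda>u. if u \<in> {v} then max (?F u) e else ?F u)"
  proof (rule subharmonic_raise[OF subharmonic_max_subharmonic])
    fix u assume "u \<in> {v} \<inter> random P"
    then have "e \<le> (\<integral>\<^sup>+x. ?F x \<partial>delta P u)" using le by (simp add: e_def)
    also have "\<dots> \<le> (\<integral>\<^sup>+x. (if x \<in> {v} then max (?F x) e else ?F x) \<partial>delta P u)"
      by (intro nn_integral_mono) auto
    finally show "e \<le> (\<integral>\<^sup>+x. (if x \<in> {v} then max (?F x) e else ?F x) \<partial>delta P u)" .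
  qed (use chance.hyps e1 P in \<open>auto simp: is_mdp_def\<close>)
  from max_subharmonic_upper[OF this, of v] have "e \<le> ?F v" by simp
  moreover have "e > 0" unfolding e_def using pos chance.IH by (simp add: ennreal_zero_less_mult_iff)
  ultimately show ?case by simp
qed

lemma losing_not_almost_sure:
  fixes P :: "'v::countable mdp"
  shows "is_mdp P \<Longrightarrow> v \<in> losing P T \<Longrightarrow> v \<notin> almost_sure P (Reach P T)"
  by (rule not_almost_sure_if_subharmonic[OF _ subharmonic_max_subharmonic max_subharmonic_pos])

section \<open>Almost-sure reachability from nonlosing vertices\<close>

lemma exists_bottom_component:
  assumes fin: "finite U" and ne: "U \<noteq> {}" and R: "R \<subseteq> U \<times> U"
  obtains X where "X \<noteq> {}" "X \<subseteq> U" "\<And>x y. x \<in> X \<Longrightarrow> (x, y) \<in> R \<Longrightarrow> y \<in> X"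
    "\<And>x y. x \<in> X \<Longrightarrow> y \<in> X \<Longrightarrow> (x, y) \<in> (R \<inter> X \<times> X)\<^sup>*"
proof -
  \<comment> \<open>The vertex \<open>u\<close> is chosen with the fewest reachable vertices.
    Whatever \<open>u\<close> reaches then reaches just as many, hence the same set, including
    \<open>u\<close> itself.\<close>
  define c where "c u = card (R\<^sup>* `` {u})" for u
  from ne obtain u where u: "u \<in> U" "\<And>x. x \<in> U \<Longrightarrow> c u \<le> c x"
    by (metis arg_min_if_finite(1) arg_min_least fin)
  define X where "X = R\<^sup>* `` {u}"
  have sub: "R\<^sup>* `` {x} \<subseteq> U" if "x \<in> U" for x
  proof
    fix y assume "y \<in> R\<^sup>* `` {x}"
    then have "(x, y) \<in> R\<^sup>*" by simp
    then show "y \<in> U" using that by induction (use R in auto)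
  qed
  have to_u: "(x, u) \<in> R\<^sup>*" if "x \<in> X" for x
  proof -
    have "R\<^sup>* `` {x} \<subseteq> X" using that by (auto simp: X_def)
    moreover have "card X \<le> card (R\<^sup>* `` {x})"
      using u(2)[of x] sub[OF u(1)] that by (auto simp: X_def c_def)
    moreover have "finite X" using sub[OF u(1)] fin by (auto simp: X_def intro: finite_subset)
    ultimately have "R\<^sup>* `` {x} = X" by (simp add: card_seteq)
    then show ?thesis by (auto simp: X_def)
  qed
  have closed: "y \<in> X" if "x \<in> X" "(x, y) \<in> R" for x y using that by (auto simp: X_def)
  have restrict: "(x, y) \<in> (R \<inter> X \<times> X)\<^sup>*" if "(x, y) \<in> R\<^sup>*" "x \<in> X" for x y
  proof -
    from that have "y \<in> X \<and> (x, y) \<in> (R \<inter> X \<times> X)\<^sup>*"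
    proof induction
      case (step y z)
      then show ?case using closed by (auto intro: rtrancl_into_rtrancl)
    qed simp
    then show ?thesis by simp
  qed
  show thesis
  proof (rule that[of X])
    show "(x, y) \<in> (R \<inter> X \<times> X)\<^sup>*" if "x \<in> X" "y \<in> X" for x y
      by (rule restrict) (use that to_u[OF that(1)] in \<open>auto simp: X_def\<close>)
  qed (use sub[OF u(1)] closed in \<open>auto simp: X_def\<close>)
qed

text \<open>Otherwise let \<open>U\<close> be the nonlosing vertices that cannot reach
  \<open>T\<close> through nonlosing ones. Random vertices keep all successors in \<open>U\<close>,
  and every vertex of \<open>U\<close> has a successor there, so a bottom component of
  \<open>U\<close> is an end component. The maximal end component around it does not extend beyond
  it and avoids \<open>T\<close>; being nonlosing, it has a nonlosing exit, and this exit leads back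
  into the bottom component, a contradiction.\<close>

lemma target_reachable_from_nonlosing:
  fixes P :: "'v mdp"
  assumes P: "is_mdp P" and v: "v \<in> verts P - losing P T"
  defines "W \<equiv> verts P - losing P T"
  shows "\<exists>t\<in>T. (v, t) \<in> (edges P \<inter> W \<times> W)\<^sup>*"
proof (rule ccontr)
  assume no: "\<not> ?thesis"
  let ?E = "edges P \<inter> W \<times> W"
  define U where "U = {u \<in> W. \<forall>t\<in>T. (u, t) \<notin> ?E\<^sup>*}"
  have fin: "finite U" using P by (auto simp: U_def W_def is_mdp_def)
  have ne: "U \<noteq> {}" using no v by (auto simp: U_def W_def)
  have UT: "U \<inter> T = {}" by (auto simp: U_def)
  have U_closed: "w \<in> U" if "u \<in> U" "(u, w) \<in> edges P" "w \<in> W" for u w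
    using that by (auto simp: U_def intro: converse_rtrancl_into_rtrancl)
  have M_W: "M \<subseteq> W" if "M \<in> MECs P" "u \<in> M" "u \<in> W" for M u
  proof
    fix x assume x: "x \<in> M"
    then have "u \<in> block P x" using that by (simp add: block_MEC)
    then have "x \<notin> losing P T" using losing_block[OF P, of x T u] that by (auto simp: W_def)
    then show "x \<in> W" using x MEC_subset_verts[OF that(1)] by (auto simp: W_def)
  qed
  have succ: "\<exists>w\<in>U. (u, w) \<in> edges P" if u: "u \<in> U" for u
  proof (cases "u \<in> \<Union>(MECs P)")
    case True
    then obtain M where M: "M \<in> MECs P" "u \<in> M" by auto
    then obtain w where w: "(u, w) \<in> edges P" "w \<in> M" by (rule MEC_successor)
    then have "w \<in> W" using M_W[OF M] u by (auto simp: U_def)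
    then show ?thesis using U_closed u w by blast
  next
    case nM: False
    then have b: "block P u = {u}" by (rule block_not_MEC)
    have uW: "u \<in> verts P" "u \<notin> losing P T" "u \<notin> T" using u UT by (auto simp: U_def W_def)
    show ?thesis
    proof (cases "u \<in> player1 P")
      case True
      \<comment> \<open>Otherwise \<open>choice\<close> would make \<open>u\<close> losing; for a
        dead end its last premise would hold vacuously.\<close>
      then obtain w where "(u, w) \<in> edges P" "w \<notin> losing P T"
        using losing.choice[of u P T] uW b by auto
      moreover from this P have "w \<in> verts P" by (auto simp: is_mdp_def)
      ultimately show ?thesis using U_closed[OF u] by (auto simp: W_def)
    next
      case False
      then have r: "u \<in> random P" using uW P by (auto simp: is_mdp_def)
      obtain w where "w \<in> set_pmf (delta P u)" using set_pmf_not_empty[of "delta P u"] by auto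
      then have w: "(u, w) \<in> edges P" using P r by (simp add: set_pmf_delta)
      then have "w \<notin> losing P T" using losing.chance[OF r nM uW(3) w] uW by auto
      moreover from w P have "w \<in> verts P" by (auto simp: is_mdp_def)
      ultimately show ?thesis using U_closed[OF u w] w by (auto simp: W_def)
    qed
  qed
  have r_closed: "w \<in> U" if u: "u \<in> U" "u \<in> random P" "(u, w) \<in> edges P" for u w
  proof (cases "u \<in> \<Union>(MECs P)")
    case True
    then obtain M where M: "M \<in> MECs P" "u \<in> M" by auto
    then have "w \<in> M" using MEC_random_closed u by fastforce
    then show ?thesis using U_closed[OF u(1,3)] M_W[OF M] u by (auto simp: U_def)
  next
    case False
    have uW: "u \<notin> losing P T" "u \<notin> T" using u UT by (auto simp: U_def W_def)
    then have "w \<notin> losing P T" using losing.chance[OF u(2) False uW(2) u(3)] by auto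
    moreover from u P have "w \<in> verts P" by (auto simp: is_mdp_def)
    ultimately show ?thesis using U_closed[OF u(1,3)] by (auto simp: W_def)
  qed
  obtain X where X: "X \<noteq> {}" "X \<subseteq> U"
    and bottom: "\<And>x y. x \<in> X \<Longrightarrow> (x, y) \<in> edges P \<inter> U \<times> U \<Longrightarrow> y \<in> X"
    and conn: "\<And>x y. x \<in> X \<Longrightarrow> y \<in> X \<Longrightarrow> (x, y) \<in> ((edges P \<inter> U \<times> U) \<inter> X \<times> X)\<^sup>*"
    using exists_bottom_component[OF fin ne, of "edges P \<inter> U \<times> U"] by auto
  have "(edges P \<inter> U \<times> U) \<inter> X \<times> X = edges P \<inter> X \<times> X" using X by auto
  with conn have conn: "(x, y) \<in> (edges P \<inter> X \<times> X)\<^sup>*" if "x \<in> X" "y \<in> X" for x y using that by simp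
  have "end_component P X"
    unfolding end_component_def
  proof (intro conjI ballI allI impI)
    show "X \<subseteq> verts P" using X by (auto simp: U_def W_def)
    from X obtain x where x: "x \<in> X" by auto
    with X succ obtain w where "w \<in> U" "(x, w) \<in> edges P" by blast
    with bottom[OF x, of w] x X show "edges P \<inter> X \<times> X \<noteq> {}" by auto
    show "w \<in> X" if "u \<in> X \<inter> random P" "(u, w) \<in> edges P" for u w
      using bottom[of u w] r_closed[of u w] that X by auto
  qed (rule conn)
  then obtain M where M: "M \<in> MECs P" "X \<subseteq> M"
    using end_component_subset_MEC P unfolding is_mdp_def by metis
  from X obtain x where x: "x \<in> X" by auto
  then have xM: "x \<in> M" "x \<in> U" using M X by auto
  have MW: "M \<subseteq> W" using M_W[OF M(1) xM(1)] xM(2) by (auto simp: U_def)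
  \<comment> \<open>A walk inside \<open>M\<close> from \<open>x\<close> stays among nonlosing
    vertices, hence in \<open>U\<close>, hence in the bottom component \<open>X\<close>.\<close>
  have MX: "y \<in> X" if "y \<in> M" for y
  proof -
    from MEC_connected[OF M(1) xM(1) that] show "y \<in> X"
    proof induction
      case (step y z)
      then have "z \<in> U" using U_closed[of y z] MW X by auto
      then show ?case using bottom[of y z] step X by auto
    qed (rule x)
  qed
  have b: "block P x = M" using M(1) xM(1) by (rule block_MEC)
  have "M \<inter> T = {}" using MX X UT by auto
  \<comment> \<open>The rule \<open>choice\<close> must fail for the block \<open>M\<close>, which
    is free of targets; only an exit to a nonlosing vertex can make it fail.\<close>
  then obtain u w where uw: "u \<in> M" "(u, w) \<in> edges P" "w \<notin> M" "w \<notin> losing P T"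
    using losing.choice[of x P T] xM M b by (auto simp: U_def W_def)
  then have "w \<in> W" using P by (auto simp: W_def is_mdp_def)
  then have "w \<in> U" using U_closed[of u w] uw MX X by auto
  then have "w \<in> X" using bottom[of u w] uw MX X by auto
  with M uw show False by auto
qed

definition no_dead_ends :: "'v mdp \<Rightarrow> bool" where
  "no_dead_ends P \<longleftrightarrow> (\<forall>v\<in>player1 P. \<exists>w. (v, w) \<in> edges P)"

text \<open>The one-vertex path at the dead end already rules out every strategy, whether or not the
  dead end is reachable from the start.\<close>

lemma almost_sure_dead_end:
  assumes "is_mdp P" "\<not> no_dead_ends P"
  shows "almost_sure P \<psi> = {}"
proof -
  obtain v where v: "v \<in> player1 P" "\<And>w. (v, w) \<notin> edges P"
    using assms(2) by (auto simp: no_dead_ends_def)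
  then have "finite_path P [v]" using assms(1) by (auto simp: finite_path_def is_mdp_def)
  then have "\<not> strategy P \<sigma>" for \<sigma> using v by (auto simp: strategy_def intro!: exI[of _ "[v]"])
  then show ?thesis by (auto simp: almost_sure_def)
qed


lemma nonlosing_random_closed:
  assumes P: "is_mdp P" and v: "v \<in> verts P - losing P T" "v \<notin> T" "v \<in> random P" and vw: "(v, w) \<in> edges P"
  shows "w \<in> verts P - losing P T"
proof -
  have "w \<notin> losing P T"
  proof (cases "v \<in> \<Union>(MECs P)")
    case True
    then obtain M where M: "M \<in> MECs P" "v \<in> M" by auto
    then have "w \<in> M" using MEC_random_closed v vw by fastforce
    then have "v \<in> block P w" using M by (simp add: block_MEC)
    then show ?thesis using losing_block[OF P, of w T v] v by auto
  next
    case False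
    then show ?thesis using losing.chance[OF v(3) False v(2) vw] v by auto
  qed
  then show ?thesis using P vw by (auto simp: is_mdp_def)
qed

text \<open>A single successor of probability at least \<open>p\<close>, at which \<open>g\<close>
  stays below its bound \<open>1\<close> by \<open>a\<close>, lowers the expectation by
  \<open>p * a\<close>: compare \<open>g\<close> with \<open>1 - a * indicator {w}\<close>.\<close>

lemma nn_integral_pmf_le:
  assumes g: "\<And>w. 0 \<le> g w" "\<And>w. g w \<le> (1::real)" and w: "g w \<le> 1 - a" and p: "p \<le> pmf M w" and a: "0 \<le> a"
  shows "(\<integral>\<^sup>+x. ennreal (g x) \<partial>measure_pmf M) \<le> ennreal (1 - p * a)"
proof -
  have int: "integrable (measure_pmf M) g"
    by (rule measure_pmf.integrable_const_bound[where B = 1]) (use g in auto)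
  have ind: "integrable (measure_pmf M) (indicator {w} :: _ \<Rightarrow> real)"
    by (rule measure_pmf.integrable_const_bound[where B = 1]) auto
  have "(\<integral>\<^sup>+x. ennreal (g x) \<partial>measure_pmf M) = ennreal (measure_pmf.expectation M g)"
    using g int by (intro nn_integral_eq_integral) auto
  also have "measure_pmf.expectation M g \<le> measure_pmf.expectation M (\<lambda>x. 1 - a * indicator {w} x)"
    using int ind g w
    by (intro integral_mono Bochner_Integration.integrable_diff) (auto split: split_indicator)
  also have "\<dots> = 1 - a * pmf M w"
    by (subst Bochner_Integration.integral_diff) (auto simp: measure_pmf_single measure_pmf.emeasure_eq_measure)
  also have "\<dots> \<le> 1 - p * a" using p a by (simp add: mult.commute mult_left_mono)
  finally show ?thesis by (simp add: ennreal_leI)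
qed

lemma nonlosing_almost_sure:
  fixes P :: "'v::countable mdp"
  assumes P: "is_mdp P" and dead: "no_dead_ends P" and v0: "v0 \<in> verts P - losing P T"
  shows "v0 \<in> almost_sure P (Reach P T)"
proof -
  define W where "W = verts P - losing P T"
  define E where "E = edges P \<inter> W \<times> W"
  \<comment> \<open>Where \<open>T\<close> cannot be reached, \<open>LEAST\<close> yields some
    unspecified number; the bounds \<open>0 \<le> g \<le> 1\<close> below hold for any
    number.\<close>
  define d where "d v = (LEAST n. \<exists>t\<in>T. (v, t) \<in> E ^^ n)" for v
  have fin: "finite W" "finite (edges P)" using P
    by (auto simp: W_def is_mdp_def intro: finite_subset)
  have d: "\<exists>t\<in>T. (v, t) \<in> E ^^ d v" if v: "v \<in> W" for v
  proof -
    from target_reachable_from_nonlosing[OF P, of v T] v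
    obtain t where "t \<in> T" "(v, t) \<in> E\<^sup>*" by (auto simp: W_def E_def)
    then obtain n where "\<exists>t\<in>T. (v, t) \<in> E ^^ n" by (meson rtrancl_imp_relpow)
    then show ?thesis unfolding d_def by (rule LeastI)
  qed
  have dec: "\<exists>w. (v, w) \<in> edges P \<and> w \<in> W \<and> d w < d v" if v: "v \<in> W - T" for v
  proof -
    from d[of v] v obtain t where t: "t \<in> T" "(v, t) \<in> E ^^ d v" by auto
    with v obtain k where k: "d v = Suc k" by (cases "d v") auto
    with t obtain w where w: "(v, w) \<in> E" "(w, t) \<in> E ^^ k" by (metis relpow_Suc_D2)
    have "d w \<le> k" unfolding d_def by (rule Least_le) (use t w in auto)
    with w k show ?thesis by (auto simp: E_def)
  qed
  \<comment> \<open>The strategy is memoryless: on \<open>W - T\<close> it decreases the distance,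
    elsewhere it takes any move, which exists as there are no dead ends. At a random vertex
    \<open>s v\<close> merely names a successor that is closer to \<open>T\<close>.\<close>
  have "\<forall>v. \<exists>w. (v \<in> player1 P \<longrightarrow> (v, w) \<in> edges P) \<and> (v \<in> W - T \<longrightarrow> (v, w) \<in> edges P \<and> w \<in> W \<and> d w < d v)"
    using dec dead unfolding no_dead_ends_def by metis
  then obtain s where s: "\<And>v. v \<in> player1 P \<Longrightarrow> (v, s v) \<in> edges P"
    "\<And>v. v \<in> W - T \<Longrightarrow> (v, s v) \<in> edges P \<and> s v \<in> W \<and> d (s v) < d v"
    by metis
  define \<sigma> where "\<sigma> h = s (last h)" for h
  have \<sigma>: "strategy P \<sigma>" using s by (auto simp: strategy_def \<sigma>_def)
  \<comment> \<open>The inserted \<open>1\<close> keeps the minimum defined without random vertices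
    and gives \<open>p \<le> 1\<close>, which covers a player-1 move of probability 1 as
    well.\<close>
  define X where "X = insert 1 ((\<lambda>(v, w). pmf (delta P v) w) ` (edges P \<inter> random P \<times> UNIV))"
  define p where "p = Min X"
  have X: "finite X" "X \<noteq> {}" using fin by (auto simp: X_def)
  have p0: "0 < p" unfolding p_def using X P by (subst Min_gr_iff) (auto simp: X_def is_mdp_def)
  have p1: "p \<le> 1" unfolding p_def using X by (intro Min_le) (auto simp: X_def)
  have p: "p \<le> pmf (delta P v) w" if "v \<in> random P" "(v, w) \<in> edges P" for v w
    unfolding p_def using X that by (intro Min_le) (force simp: X_def)+
  \<comment> \<open>Halving \<open>p\<close> gives \<open>p * q ^ (d v - 1) = 2 * q ^ d v\<close>.
    One copy of \<open>q ^ d v\<close> turns \<open>1\<close> into \<open>g v\<close>, the other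
    pays for the factor \<open>1 - q ^ D\<close>.\<close>
  define q where "q = p / 2"
  have q: "0 < q" "q < 1" "2 * q \<le> 1" "p = 2 * q" using p0 p1 by (auto simp: q_def)
  define D where "D = Max (d ` W)"
  have D: "d v \<le> D" if "v \<in> W" for v unfolding D_def using fin that by (intro Max_ge) auto
  define g where "g v = 1 - q ^ d v" for v
  have g: "0 \<le> g v" "g v \<le> 1" for v using q by (auto simp: g_def power_le_one)
  have key: "1 - p * q ^ d w \<le> (1 - q ^ D) * g v" if "v \<in> W" "d w < d v" for v w
  proof -
    from that obtain k where k: "d v = Suc k" by (cases "d v") auto
    have "q ^ k \<le> q ^ d w" using q that k by (intro power_decreasing) auto
    then have "2 * q ^ d v \<le> p * q ^ d w" using q by (simp add: k)
    moreover have "q ^ D \<le> q ^ d v" using q D[OF that(1)] by (intro power_decreasing) auto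
    moreover have "0 \<le> q ^ D * q ^ d v" using q by simp
    ultimately show ?thesis by (simp add: g_def algebra_simps)
  qed
  have step: "(\<integral>\<^sup>+w. ennreal (g w) \<partial>step_pmf P \<sigma> h) \<le> ennreal (1 - q ^ D) * ennreal (g (last h))"
    if h: "finite_path P h" "last h \<in> W - T" for h
  proof -
    let ?v = "last h"
    note sv = s(2)[OF h(2)]
    have "(\<integral>\<^sup>+w. ennreal (g w) \<partial>step_pmf P \<sigma> h) \<le> ennreal (1 - p * q ^ d (s ?v))"
    proof (rule nn_integral_pmf_le[where w = "s ?v"])
      show "p \<le> pmf (step_pmf P \<sigma> h) (s ?v)"
      proof (cases "?v \<in> player1 P")
        case True then show ?thesis using p1 by (simp add: step_pmf_def \<sigma>_def)
      next
        case False
        then have "?v \<in> random P" using h P by (auto simp: is_mdp_def W_def)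
        then show ?thesis using False p sv by (simp add: step_pmf_def)
      qed
    qed (use g q in \<open>auto simp: g_def\<close>)
    also have "\<dots> \<le> ennreal ((1 - q ^ D) * g ?v)"
      using key[of ?v "s ?v"] sv h by (intro ennreal_leI) auto
    also have "\<dots> = ennreal (1 - q ^ D) * ennreal (g ?v)"
      using q g by (intro ennreal_mult) (auto simp: power_le_one)
    finally show ?thesis .
  qed
  show ?thesis
  proof (rule almost_sure_if_contracting[OF P \<sigma>, where W = W and g = "\<lambda>v. ennreal (g v)" and c = "ennreal (1 - q)"
        and r = "1 - q ^ D"])
    fix h w assume h: "finite_path P h" "last h \<in> W - T" and w: "w \<in> set_pmf (step_pmf P \<sigma> h)"
    show "w \<in> W"
    proof (cases "last h \<in> player1 P")
      case True then show ?thesis using w s(2)[OF h(2)] by (simp add: step_pmf_def \<sigma>_def)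
    next
      case False
      then have "last h \<in> random P" using h P by (auto simp: is_mdp_def W_def)
      then show ?thesis using w False h nonlosing_random_closed[OF P, of "last h" T w]
        by (auto simp: step_pmf_def W_def set_pmf_delta[OF P])
    qed
  next
    fix v assume v: "v \<in> W - T"
    with dec[OF v] have "1 \<le> d v" by auto
    then have "q ^ d v \<le> q ^ 1" using q by (intro power_decreasing) auto
    then show "ennreal (1 - q) \<le> ennreal (g v)" by (intro ennreal_leI) (simp add: g_def)
  qed (use v0 q g step in \<open>auto simp: W_def power_le_one\<close>)
qed

theorem almost_sure_reach_eq:
  fixes P :: "'v::countable mdp"
  assumes "is_mdp P" "no_dead_ends P"
  shows "almost_sure P (Reach P T) = verts P - losing P T"
  using nonlosing_almost_sure[OF assms, of _ T] losing_not_almost_sure[OF assms(1), of _ T]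
  by (auto simp: almost_sure_def)

section \<open>Threshold attractors\<close>

text \<open>Linked lists of edges by target in closed form: one more than the largest index
  \<open>e < i\<close> with \<open>D e = b\<close>, and \<open>0\<close> if there is none. The shift
  by one frees \<open>0\<close> to serve as null pointer.\<close>

primrec last_in :: "(nat \<Rightarrow> nat) \<Rightarrow> nat \<Rightarrow> nat \<Rightarrow> nat" where
  "last_in D 0 b = 0"
| "last_in D (Suc i) b = (if D i = b then Suc i else last_in D i b)"

lemma last_in_upper: "e < i \<Longrightarrow> D e = b \<Longrightarrow> e < last_in D i b"
  by (induction i) (auto simp: less_Suc_eq)

lemma last_in_le: "last_in D i b \<le> i"
  by (induction i) auto

lemma last_in_hit: "0 < last_in D i b \<Longrightarrow> D (last_in D i b - 1) = b"
  by (induction i) auto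

lemma card_less_Suc:
  "card {e. e < Suc i \<and> Q e} = card {e. e < i \<and> Q e} + (if Q i then 1 else 0)"
proof -
  have "{e. e < Suc i \<and> Q e} = (if Q i then insert i {e. e < i \<and> Q e} else {e. e < i \<and> Q e})"
    by (auto simp: less_Suc_eq)
  then show ?thesis by auto
qed

text \<open>The least such set is an attractor in which each node has its own threshold:
  \<open>c b = 0\<close> makes \<open>b\<close> a seed, and \<open>c b > m\<close> keeps it
  out.\<close>

definition threshold_closed :: "nat \<Rightarrow> nat \<Rightarrow> (nat \<Rightarrow> nat) \<Rightarrow> (nat \<Rightarrow> nat) \<Rightarrow> (nat \<Rightarrow> nat) \<Rightarrow> nat set \<Rightarrow> bool" where
  "threshold_closed n m S D c X \<longleftrightarrow>
     (\<forall>b<n. c b \<le> card {e. e < m \<and> S e = b \<and> D e \<in> X} \<longrightarrow> b \<in> X)"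

text \<open>The edges into the first \<open>h\<close> nodes of the queue \<open>Q\<close> that have been processed; those into
  the last of these nodes are visited in decreasing order, and \<open>x\<close> is one more than the next one.\<close>

definition processed :: "nat \<Rightarrow> (nat \<Rightarrow> nat) \<Rightarrow> nat \<Rightarrow> nat \<Rightarrow> (nat \<Rightarrow> nat) \<Rightarrow> nat set" where
  "processed m D h x Q = {e. e < m \<and> (\<exists>i<h. D e = Q i) \<and> \<not> (e < x \<and> D e = Q (h - 1))}"

text \<open>\<open>h\<close> and \<open>t\<close> are front and end of the queue, \<open>x\<close>
  is the edge pointer. The queue holds exactly the nodes with zero counter, each once; a counter is
  the threshold minus the processed edges, in truncated subtraction. The last conjunct is soundness:
  every closed set contains what has been found. Closedness is obtained only when the queue is
  exhausted.\<close>

definition attractor_inv ::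
    "nat \<Rightarrow> nat \<Rightarrow> (nat \<Rightarrow> nat) \<Rightarrow> (nat \<Rightarrow> nat) \<Rightarrow> (nat \<Rightarrow> nat) \<Rightarrow>
     nat \<Rightarrow> nat \<Rightarrow> nat \<Rightarrow> (nat \<Rightarrow> nat) \<Rightarrow> (nat \<Rightarrow> nat) \<Rightarrow> bool" where
  "attractor_inv n m S D c h t x Q cnt \<longleftrightarrow>
     h \<le> t \<and> inj_on Q {..<t} \<and> Q ` {..<t} = {b. b < n \<and> cnt b = 0} \<and>
     (0 < x \<longrightarrow> 0 < h \<and> x \<le> m \<and> D (x - 1) = Q (h - 1)) \<and>
     (\<forall>b<n. cnt b = c b - card {e \<in> processed m D h x Q. S e = b}) \<and>
     (\<forall>X. threshold_closed n m S D c X \<longrightarrow> {b. b < n \<and> cnt b = 0} \<subseteq> X)"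

lemma finite_processed: "finite (processed m D h x Q)"
  by (simp add: processed_def)

lemma attractor_inv_le:
  assumes "attractor_inv n m S D c h t x Q cnt" shows "t \<le> n"
proof -
  have "inj_on Q {..<t}" using assms by (simp add: attractor_inv_def)
  then have "card (Q ` {..<t}) = t" by (simp add: card_image)
  moreover have "card (Q ` {..<t}) \<le> card {..<n}"
    using assms by (intro card_mono) (auto simp: attractor_inv_def)
  ultimately show ?thesis by simp
qed

lemma attractor_inv_init:
  assumes "inj_on Q {..<t}" "Q ` {..<t} = {b. b < n \<and> c b = 0}"
  shows "attractor_inv n m S D c 0 t 0 Q c"
  using assms by (auto simp: attractor_inv_def processed_def threshold_closed_def)

text \<open>The pointer becomes one more than the last edge into the popped node, so none of its
  edges counts as processed yet; injectivity of the queue excludes that an earlier node had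
  accounted for them.\<close>

lemma attractor_inv_pop:
  assumes inv: "attractor_inv n m S D c h t 0 Q cnt" and h: "h < t"
  shows "attractor_inv n m S D c (Suc h) t (last_in D m (Q h)) Q cnt"
    and "processed m D (Suc h) (last_in D m (Q h)) Q = processed m D h 0 Q"
proof -
  have inj: "Q i \<noteq> Q h" if "i < h" for i
    using inv h that by (auto simp: attractor_inv_def inj_on_def)
  show eq: "processed m D (Suc h) (last_in D m (Q h)) Q = processed m D h 0 Q"
    using last_in_upper[of _ m D "Q h"] inj unfolding processed_def by (auto simp: less_Suc_eq) metis
  show "attractor_inv n m S D c (Suc h) t (last_in D m (Q h)) Q cnt"
    using inv h last_in_hit[of D m "Q h"] last_in_le[of D m "Q h"]
    unfolding attractor_inv_def eq by auto
qed

text \<open>Edge \<open>e\<close> is charged to the counter of its source, which is enqueued exactly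
  when the counter drops from \<open>1\<close> to \<open>0\<close>, so never twice. That
  \<open>e < m\<close> and \<open>e\<close> is new makes the number of unprocessed edges
  decrease.\<close>

lemma attractor_inv_step:
  fixes Q' cnt' :: "nat \<Rightarrow> nat"
  assumes inv: "attractor_inv n m S D c h t (Suc e) Q cnt" and Se: "S e < n"
    and cnt': "cnt' = cnt(S e := cnt (S e) - 1)"
    and Q': "if cnt (S e) = 1 then t' = Suc t \<and> Q' = Q(t := S e) else t' = t \<and> Q' = Q"
  shows "attractor_inv n m S D c h t' (last_in D e (D e)) Q' cnt'"
    and "processed m D h (last_in D e (D e)) Q' = insert e (processed m D h (Suc e) Q)"
    and "e < m" and "e \<notin> processed m D h (Suc e) Q"
proof -
  let ?P = "processed m D h (Suc e) Q"
  from inv have h: "0 < h" "h \<le> t" and e: "e < m" and De: "D e = Q (h - 1)"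
    by (auto simp: attractor_inv_def)
  show "e < m" by (rule e)
  show e_new: "e \<notin> ?P" using De by (auto simp: processed_def)
  have Q'_eq: "Q' i = Q i" if "i < h" for i using Q' h that by (auto split: if_splits)
  have Q'_last: "Q' (h - 1) = Q (h - 1)" using h Q'_eq by simp
  have "e < m \<and> (\<exists>i<h. D e = Q' i) \<longleftrightarrow> e < m \<and> (\<exists>i<h. D e = Q i)" for e
    using Q'_eq by auto
  then have "processed m D h x Q' = processed m D h x Q" for x
    unfolding processed_def Q'_last by blast
  moreover have "processed m D h (last_in D e (D e)) Q = insert e ?P"
  proof -
    have "e' = e" if "e' < Suc e" "\<not> e' < last_in D e (D e)" "D e' = D e" for e'
      using that last_in_upper[of e' e D "D e"] by (auto simp: less_Suc_eq)
    moreover have "e' < Suc e" if "e' < last_in D e (D e)" for e'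
      using that last_in_le[of D e "D e"] by simp
    moreover have "\<not> e < last_in D e (D e)" using last_in_le[of D e "D e"] by simp
    moreover have "\<exists>i<h. D e = Q i" using De h by (auto intro!: exI[of _ "h - 1"])
    ultimately show ?thesis using e De unfolding processed_def by auto
  qed
  ultimately show eq: "processed m D h (last_in D e (D e)) Q' = insert e ?P" by simp
  have card: "card {f \<in> insert e ?P. S f = b} = card {f \<in> ?P. S f = b} + (if S e = b then 1 else 0)" for b
  proof -
    have "{f \<in> insert e ?P. S f = b} = (if S e = b then insert e {f \<in> ?P. S f = b} else {f \<in> ?P. S f = b})"
      by auto
    then show ?thesis using e_new finite_processed[of m D h "Suc e" Q] by auto
  qed
  have cnt_eq: "cnt' b = c b - card {f \<in> insert e ?P. S f = b}" if "b < n" for b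
    using inv that unfolding card cnt' by (auto simp: attractor_inv_def)
  have zero: "{b. b < n \<and> cnt' b = 0} =
      (if cnt (S e) = 1 then insert (S e) {b. b < n \<and> cnt b = 0} else {b. b < n \<and> cnt b = 0})"
    using Se by (auto simp: cnt')
  have queue: "inj_on Q' {..<t'} \<and> Q' ` {..<t'} = {b. b < n \<and> cnt' b = 0} \<and> h \<le> t'"
  proof (cases "cnt (S e) = 1")
    case True
    then have t': "t' = Suc t" "Q' = Q(t := S e)" using Q' by auto
    have "S e \<notin> Q ` {..<t}" using inv True by (auto simp: attractor_inv_def)
    moreover have "Q' ` {..<t'} = insert (S e) (Q ` {..<t})" by (auto simp: t' lessThan_Suc)
    moreover have "inj_on Q' {..<t'} \<longleftrightarrow> inj_on Q {..<t} \<and> S e \<notin> Q ` {..<t}"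
      unfolding t' lessThan_Suc by (subst inj_on_insert) (auto simp: inj_on_def)
    ultimately show ?thesis using inv True t' unfolding zero by (auto simp: attractor_inv_def)
  next
    case False
    then show ?thesis using inv Q' unfolding zero by (auto simp: attractor_inv_def)
  qed
  have sound: "{b. b < n \<and> cnt' b = 0} \<subseteq> X" if X: "threshold_closed n m S D c X" for X
  proof -
    have old: "{b. b < n \<and> cnt b = 0} \<subseteq> X" using inv X by (auto simp: attractor_inv_def)
    \<comment> \<open>Processed edges lead to nodes on the queue, which lie in every closed
      \<open>X\<close>; a counter that has reached zero thus witnesses the threshold for
      \<open>X\<close>.\<close>
    have "insert e ?P \<subseteq> {f. f < m \<and> D f \<in> X}"
    proof
      fix f assume "f \<in> insert e ?P"
      moreover have "\<exists>i<h. D e = Q i" using De h by (auto intro!: exI[of _ "h - 1"])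
      ultimately have "f < m" "\<exists>i<h. D f = Q i" using e by (auto simp: processed_def)
      then have "D f \<in> Q ` {..<t}" using h by auto
      then show "f \<in> {f. f < m \<and> D f \<in> X}" using \<open>f < m\<close> inv old by (auto simp: attractor_inv_def)
    qed
    then have le: "card {f \<in> insert e ?P. S f = b} \<le> card {f. f < m \<and> S f = b \<and> D f \<in> X}" for b
      by (intro card_mono) auto
    show ?thesis
    proof (intro subsetI, elim CollectE conjE)
      fix b assume b: "b < n" "cnt' b = 0"
      then have "c b \<le> card {f. f < m \<and> S f = b \<and> D f \<in> X}"
        using cnt_eq[OF b(1)] le[of b] by linarith
      then show "b \<in> X" using X b unfolding threshold_closed_def by blast
    qed
  qed
  show "attractor_inv n m S D c h t' (last_in D e (D e)) Q' cnt'"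
    unfolding attractor_inv_def eq
    using queue cnt_eq sound h e De last_in_hit[of D e "D e"] last_in_le[of D e "D e"] Q'_last by auto
qed

text \<open>Once the queue is exhausted, the processed edges are exactly those leading into
  \<open>L\<close>, so a zero counter says precisely that \<open>L\<close> meets the
  threshold.\<close>

lemma attractor_inv_done:
  assumes inv: "attractor_inv n m S D c h h 0 Q cnt"
  defines "L \<equiv> {b. b < n \<and> cnt b = 0}"
  shows "threshold_closed n m S D c L" and "threshold_closed n m S D c X \<Longrightarrow> L \<subseteq> X"
proof -
  have "Q ` {..<h} = L" using inv by (simp add: attractor_inv_def L_def)
  then have "(\<exists>i<h. D e = Q i) \<longleftrightarrow> D e \<in> L" for e by blast
  then have P: "processed m D h 0 Q = {e. e < m \<and> D e \<in> L}"
    unfolding processed_def by auto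
  have "{e \<in> {e. e < m \<and> D e \<in> L}. S e = b} = {e. e < m \<and> S e = b \<and> D e \<in> L}" for b by auto
  then have "cnt b = c b - card {e. e < m \<and> S e = b \<and> D e \<in> L}" if "b < n" for b
    using inv that by (simp add: attractor_inv_def P)
  then show "threshold_closed n m S D c L" by (simp add: threshold_closed_def L_def)
  show "L \<subseteq> X" if "threshold_closed n m S D c X"
    using inv that by (auto simp: attractor_inv_def L_def)
qed

section \<open>Reasoning about programs\<close>

fun loop_free :: "com \<Rightarrow> bool" where
  "loop_free (Seq c d) \<longleftrightarrow> loop_free c \<and> loop_free d"
| "loop_free (Cond b c d) \<longleftrightarrow> loop_free c \<and> loop_free d"
| "loop_free (While b c) \<longleftrightarrow> False"
| "loop_free _ \<longleftrightarrow> True"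

text \<open>The state transformer of loop-free code, by which the simplifier executes loop bodies
  symbolically. The value on \<open>While\<close> is a dummy.\<close>

fun run :: "com \<Rightarrow> state \<Rightarrow> state" where
  "run Skip s = s"
| "run (Write a i x) s = s(a := (s a)(aval i s := aval x s))"
| "run (Seq c d) s = run d (run c s)"
| "run (Cond b c d) s = (if bval b s then run c s else run d s)"
| "run (While b c) s = s"

text \<open>For loop-free code an upper bound: both branches of a conditional are added, which
  avoids maxima.\<close>

fun cost :: "com \<Rightarrow> nat" where
  "cost (Seq c d) = cost c + cost d"
| "cost (Cond b c d) = Suc (cost c + cost d)"
| "cost _ = 1"

fun writes :: "com \<Rightarrow> nat set" where
  "writes Skip = {}"
| "writes (Write a i x) = {a}"
| "writes (Seq c d) = writes c \<union> writes d"
| "writes (Cond b c d) = writes c \<union> writes d"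
| "writes (While b c) = writes c"

definition agree :: "nat set \<Rightarrow> state \<Rightarrow> state \<Rightarrow> bool" where
  "agree A s s' \<longleftrightarrow> (\<forall>a. a \<notin> A \<longrightarrow> s' a = s a)"

lemma agree_refl: "agree A s s"
  by (simp add: agree_def)

lemma agree_trans: "agree A s s' \<Longrightarrow> agree B s' s'' \<Longrightarrow> A \<subseteq> C \<Longrightarrow> B \<subseteq> C \<Longrightarrow> agree C s s''"
  unfolding agree_def by (metis subsetD)

lemma exec_agree: "exec c s t s' \<Longrightarrow> agree (writes c) s s'"
  by (induction rule: exec.induct) (auto simp: agree_def)

lemma exec_run: "loop_free c \<Longrightarrow> \<exists>t\<le>cost c. exec c s t (run c s)"
proof (induction c arbitrary: s)
  case (Seq c d)
  then obtain t u where "t \<le> cost c" "exec c s t (run c s)" "u \<le> cost d" "exec d (run c s) u (run d (run c s))"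
    by (meson loop_free.simps(1))
  then show ?case by (auto intro!: exI[of _ "t + u"] exec_Seq)
next
  case (Cond b c d)
  then obtain t u where "t \<le> cost c" "exec c s t (run c s)" "u \<le> cost d" "exec d s u (run d s)"
    by (meson loop_free.simps(2))
  then show ?case
    using exec_Cond_True[of b s c t _ d] exec_Cond_False[of b s d u _ c]
    by (cases "bval b s") (auto intro: exI[of _ "Suc t"] exI[of _ "Suc u"])
qed (auto intro!: exI[of _ "Suc 0"] exec_Skip[unfolded One_nat_def] exec_Write[unfolded One_nat_def])

lemma run_agree: "loop_free c \<Longrightarrow> agree (writes c) s (run c s)"
  using exec_run exec_agree by blast

section \<open>Termination within a time bound\<close>

definition terminates :: "com \<Rightarrow> state \<Rightarrow> nat \<Rightarrow> (state \<Rightarrow> bool) \<Rightarrow> bool" where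
  "terminates c s T Q \<longleftrightarrow> (\<exists>t s'. exec c s t s' \<and> t \<le> T \<and> Q s')"

text \<open>The frame comes for free: the new postcondition may use that only arrays in
  \<open>writes c\<close> have changed. \<open>terminates_Seq\<close> offers the same, so a
  postcondition has to mention only what its phase computes.\<close>

lemma terminates_weaken:
  assumes "terminates c s T Q" and "T \<le> T'" and "\<And>s'. Q s' \<Longrightarrow> agree (writes c) s s' \<Longrightarrow> Q' s'"
  shows "terminates c s T' Q'"
proof -
  from assms(1) obtain t s' where "exec c s t s'" "t \<le> T" "Q s'" by (auto simp: terminates_def)
  with assms(2) assms(3)[of s'] exec_agree[of c s t s'] show ?thesis
    unfolding terminates_def by (auto intro!: exI[of _ t] exI[of _ s'])
qed

lemma terminates_Seq:
  assumes "terminates c s T Q" and "\<And>s'. Q s' \<Longrightarrow> agree (writes c) s s' \<Longrightarrow> terminates d s' U R"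
  shows "terminates (Seq c d) s (T + U) R"
proof -
  from assms(1) obtain t s' where c: "exec c s t s'" "t \<le> T" "Q s'" by (auto simp: terminates_def)
  from assms(2)[OF c(3) exec_agree[OF c(1)]] obtain u s'' where d: "exec d s' u s''" "u \<le> U" "R s''"
    by (auto simp: terminates_def)
  from exec_Seq[OF c(1) d(1)] c d show ?thesis
    unfolding terminates_def by (auto intro!: exI[of _ "t + u"] exI[of _ s''])
qed

lemma terminates_run:
  assumes "loop_free c" and "Q (run c s)"
  shows "terminates c s (cost c) Q"
  using exec_run[OF assms(1), of s] assms(2) by (auto simp: terminates_def)

lemma terminates_Seq_run:
  assumes "terminates d s' U R" and "loop_free c" and "run c s = s'" and "cost c + U \<le> T"
  shows "terminates (Seq c d) s T R"
proof -
  have "terminates c s (cost c) (\<lambda>r. r = s')" using assms(2,3) by (rule terminates_run)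
  then have "terminates (Seq c d) s (cost c + U) R"
    by (rule terminates_Seq) (simp add: assms(1))
  then show ?thesis using assms(4) by (rule terminates_weaken)
qed

text \<open>A round costs its test and at most \<open>T\<close> steps and lowers the measure by at
  least one; the final \<open>1\<close> is the failing test.\<close>

lemma terminates_While:
  assumes I: "I s0"
    and step: "\<And>s. I s \<Longrightarrow> bval b s \<Longrightarrow> agree (writes c) s0 s \<Longrightarrow>
      terminates c s T (\<lambda>s'. I s' \<and> \<mu> s' < (\<mu> s :: nat))"
  shows "terminates (While b c) s0 (Suc T * \<mu> s0 + 1) (\<lambda>s. I s \<and> \<not> bval b s)"
proof -
  have "terminates (While b c) s (Suc T * \<mu> s + 1) (\<lambda>s. I s \<and> \<not> bval b s)"
    if "I s" "agree (writes c) s0 s" for s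
    using that
  proof (induction "\<mu> s" arbitrary: s rule: less_induct)
    case less
    show ?case
    proof (cases "bval b s")
      case True
      from step[OF less.prems(1) True less.prems(2)] obtain t s'
        where t: "exec c s t s'" "t \<le> T" "I s'" "\<mu> s' < \<mu> s" by (auto simp: terminates_def)
      have "agree (writes c) s0 s'"
        using less.prems(2) exec_agree[OF t(1)] by (rule agree_trans) auto
      from less.hyps[OF t(4) t(3) this] obtain u s''
        where u: "exec (While b c) s' u s''" "u \<le> Suc T * \<mu> s' + 1" "I s''" "\<not> bval b s''"
        unfolding terminates_def by auto
      have "Suc T * Suc (\<mu> s') \<le> Suc T * \<mu> s" using t(4) by (intro mult_le_mono2) simp
      then have "Suc (t + u) \<le> Suc T * \<mu> s + 1" using t(2) u(2) by simp
      with exec_While_True[OF True t(1) u(1)] u show ?thesis by (auto simp: terminates_def)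
    next
      case False
      with less.prems show ?thesis
        by (auto simp: terminates_def intro!: exI[of _ 1] exec_While_False)
    qed
  qed
  with I show ?thesis by (simp add: agree_refl)
qed

lemma terminates_While_run:
  assumes "loop_free c" "I s0"
    and "\<And>s. I s \<Longrightarrow> bval b s \<Longrightarrow> agree (writes c) s0 s \<Longrightarrow> I (run c s) \<and> \<mu> (run c s) < (\<mu> s :: nat)"
    and "\<mu> s0 \<le> N"
  shows "terminates (While b c) s0 (Suc (cost c) * N + 1) (\<lambda>s. I s \<and> \<not> bval b s)"
proof (rule terminates_weaken[OF terminates_While])
  show "terminates c s (cost c) (\<lambda>s'. I s' \<and> \<mu> s' < \<mu> s)"
    if "I s" "bval b s" "agree (writes c) s0 s" for s
    using assms that by (intro terminates_run) auto
  show "Suc (cost c) * \<mu> s0 + 1 \<le> Suc (cost c) * N + 1"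
    using assms(4) by (simp del: mult_Suc)
qed (use assms in auto)

abbreviation Var :: "nat \<Rightarrow> aexp" where "Var x \<equiv> Read x (Const 0)"
abbreviation assign :: "nat \<Rightarrow> aexp \<Rightarrow> com" where "assign x e \<equiv> Write x (Const 0) e"
abbreviation succ :: "aexp \<Rightarrow> aexp" where "succ e \<equiv> Plus e (Const 1)"
abbreviation incr :: "nat \<Rightarrow> com" where "incr x \<equiv> assign x (succ (Var x))"

definition for_loop :: "nat \<Rightarrow> aexp \<Rightarrow> aexp \<Rightarrow> com \<Rightarrow> com" where
  "for_loop x l u c = Seq (assign x l) (While (Less (Var x) u) (Seq c (incr x)))"

lemma writes_for_loop [simp]: "writes (for_loop x l u c) = insert x (writes c)"
  by (auto simp: for_loop_def)

text \<open>Per round there are the body, the increment and the test; the final \<open>2\<close> is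
  the initial assignment and the failing test. The bound \<open>u\<close> is evaluated anew in each
  round, so it must keep the value \<open>N\<close> in all states that the frame allows.\<close>

lemma terminates_for_loop:
  assumes lf: "loop_free c" and x: "x \<notin> writes c"
    and l: "aval l s0 = i0" and le: "i0 \<le> N"
    and u: "\<And>s. agree (insert x (writes c)) s0 s \<Longrightarrow> aval u s = N"
    and init: "J i0 (s0(x := (s0 x)(0 := i0)))"
    and step: "\<And>s i. i0 \<le> i \<Longrightarrow> i < N \<Longrightarrow> s x 0 = i \<Longrightarrow> J i s \<Longrightarrow> agree (insert x (writes c)) s0 s \<Longrightarrow>
      J (Suc i) (run (Seq c (incr x)) s)"
  shows "terminates (for_loop x l u c) s0 ((cost c + 2) * (N - i0) + 2) (J N)"
proof -
  let ?s = "s0(x := (s0 x)(0 := i0))" and ?c = "Seq c (incr x)"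
  let ?W = "insert x (writes c)"
  have ag: "agree ?W s0 s" if "agree (writes ?c) ?s s" for s
    using that by (auto simp: agree_def)
  have run_x: "run ?c s x 0 = Suc (s x 0)" for s
    using run_agree[OF lf, of s] x by (simp add: agree_def)
  have "terminates (While (Less (Var x) u) ?c) ?s (Suc (cost ?c) * (N - i0) + 1)
      (\<lambda>s. (J (s x 0) s \<and> i0 \<le> s x 0 \<and> s x 0 \<le> N \<and> agree ?W s0 s) \<and> \<not> bval (Less (Var x) u) s)"
  proof (rule terminates_While_run[where \<mu> = "\<lambda>s. N - s x 0"])
    fix s assume I: "J (s x 0) s \<and> i0 \<le> s x 0 \<and> s x 0 \<le> N \<and> agree ?W s0 s"
      and b: "bval (Less (Var x) u) s"
    have "agree ?W s0 (run ?c s)"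
      by (rule agree_trans[of ?W _ s "writes ?c"]) (use I lf run_agree[of ?c s] in auto)
    then show "(J (run ?c s x 0) (run ?c s) \<and> i0 \<le> run ?c s x 0 \<and> run ?c s x 0 \<le> N \<and>
        agree ?W s0 (run ?c s)) \<and> N - run ?c s x 0 < N - s x 0"
      using I b u[of s] step[of "s x 0" s] unfolding run_x by auto
  qed (use lf init le in \<open>auto simp: agree_def\<close>)
  then have "terminates (While (Less (Var x) u) ?c) ?s (Suc (cost ?c) * (N - i0) + 1) (J N)"
    by (rule terminates_weaken) (auto simp: u)
  then have "terminates (for_loop x l u c) s0 (1 + (Suc (cost ?c) * (N - i0) + 1)) (J N)"
    unfolding for_loop_def
    by (intro terminates_Seq[where Q = "\<lambda>s. s = ?s"])
      (use terminates_run[of "assign x l" "\<lambda>s. s = ?s" s0] l in auto)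
  then show ?thesis by (rule terminates_weaken) auto
qed

section \<open>Renaming the arrays of a program\<close>

fun shift_aexp :: "nat \<Rightarrow> aexp \<Rightarrow> aexp" where
  "shift_aexp k (Const n) = Const n"
| "shift_aexp k (Read a i) = Read (a + k) (shift_aexp k i)"
| "shift_aexp k (Plus x y) = Plus (shift_aexp k x) (shift_aexp k y)"
| "shift_aexp k (Minus x y) = Minus (shift_aexp k x) (shift_aexp k y)"

fun shift_bexp :: "nat \<Rightarrow> bexp \<Rightarrow> bexp" where
  "shift_bexp k (Less x y) = Less (shift_aexp k x) (shift_aexp k y)"
| "shift_bexp k (Neg b) = Neg (shift_bexp k b)"
| "shift_bexp k (And b c) = And (shift_bexp k b) (shift_bexp k c)"

fun shift_com :: "nat \<Rightarrow> com \<Rightarrow> com" where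
  "shift_com k Skip = Skip"
| "shift_com k (Write a i x) = Write (a + k) (shift_aexp k i) (shift_aexp k x)"
| "shift_com k (Seq c d) = Seq (shift_com k c) (shift_com k d)"
| "shift_com k (Cond b c d) = Cond (shift_bexp k b) (shift_com k c) (shift_com k d)"
| "shift_com k (While b c) = While (shift_bexp k b) (shift_com k c)"

lemma aval_shift: "aval (shift_aexp k x) s = aval x (\<lambda>a. s (a + k))"
  by (induction x) auto

lemma bval_shift: "bval (shift_bexp k b) s = bval b (\<lambda>a. s (a + k))"
  by (induction b) (auto simp: aval_shift)

lemma writes_shift: "writes (shift_com k c) \<subseteq> {k..}"
  by (induction c) auto

text \<open>The renamed program runs in lockstep with the original on the view
  \<open>\<lambda>a. s (a + k)\<close> of the state, whatever the arrays below \<open>k\<close>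
  hold.\<close>

lemma exec_shift:
  assumes "exec c (\<lambda>a. s (a + k)) t r"
  shows "\<exists>s'. exec (shift_com k c) s t s' \<and> (\<lambda>a. s' (a + k)) = r"
  using assms
proof (induction c "\<lambda>a. s (a + k)" t r arbitrary: s rule: exec.induct)
  case (exec_Write a i x)
  show ?case
    by (rule exI, rule conjI, unfold shift_com.simps, rule exec.exec_Write) (auto simp: aval_shift fun_eq_iff)
next
  case (exec_Seq c t r d u r')
  then obtain s1 where s1: "exec (shift_com k c) s t s1" "(\<lambda>a. s1 (a + k)) = r" by blast
  with exec_Seq obtain s2 where "exec (shift_com k d) s1 u s2" "(\<lambda>a. s2 (a + k)) = r'" by blast
  with s1 show ?case by (auto intro: exec.exec_Seq)
next
  case (exec_While_True b c t r u r')
  then obtain s1 where s1: "exec (shift_com k c) s t s1" "(\<lambda>a. s1 (a + k)) = r" by blast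
  with exec_While_True obtain s2 where "exec (shift_com k (While b c)) s1 u s2" "(\<lambda>a. s2 (a + k)) = r'" by blast
  with s1 exec_While_True.hyps show ?case
    by (auto intro!: exI[of _ s2] exec.exec_While_True simp: bval_shift)
next
  case (exec_Cond_True b c t r d)
  then obtain s1 where "exec (shift_com k c) s t s1" "(\<lambda>a. s1 (a + k)) = r" by blast
  with exec_Cond_True.hyps show ?case
    by (auto intro!: exI[of _ s1] exec.exec_Cond_True simp: bval_shift)
next
  case (exec_Cond_False b d t r c)
  then obtain s1 where "exec (shift_com k d) s t s1" "(\<lambda>a. s1 (a + k)) = r" by blast
  with exec_Cond_False.hyps show ?case
    by (auto intro!: exI[of _ s1] exec.exec_Cond_False simp: bval_shift)
next
  case (exec_While_False b c)
  then show ?case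
    using exec.exec_While_False[of "shift_bexp k b" s "shift_com k c"] by (auto simp: bval_shift)
next
  case (exec_Skip)
  then show ?case using exec.exec_Skip[of s] by auto
qed

section \<open>The phases of the program\<close>

text \<open>
  Arrays above 100 belong to the program for the maximal end components, whose arrays are shifted by
  100 so that it starts from a clean copy of the MDP.  The arrays used here are, apart from inputs and
  outputs:

  \<^item> scalars (at index 0): 10 vertex, 11 edge, 12 target set, 13 position in a list of vertices,
    14 flag for a player-1 dead end, 15 and 16 front and end of the queue, 17 edge pointer
    (0 for none, otherwise one more than the edge), 18 component;
  \<^item> 20 source of an edge, later the block of its source; 21 block representative of a vertex;
    22 nonzero iff player 1 controls the block; 23 initial counters;
  \<^item> 24 and 25 linked lists of the edges into a block: 24 holds the head, 25 the successors;
  \<^item> 26 current counters, zero iff the block is known to be losing; 27 queue; 28 winning vertices.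
\<close>

definition copy_vertex :: com where
  "copy_vertex =
     Seq (Write 101 (Var 10) (Read 1 (Var 10)))
    (Seq (Write 103 (Var 10) (Read 3 (Var 10)))
    (Seq (Write 21 (Var 10) (Var 10))
    (Seq (Write 22 (Var 10) (Read 3 (Var 10)))
      (Cond (And (Less (Const 0) (Read 3 (Var 10)))
                 (Neg (Less (Read 1 (Var 10)) (Read 1 (succ (Var 10))))))
        (assign 14 (Const 1)) Skip))))"

text \<open>For n vertices there are n + 1 list positions; the last one, the number of edges, is
  copied after the loop.\<close>

definition copy_vertices :: com where
  "copy_vertices =
     Seq (for_loop 10 (Const 0) (Var 0) copy_vertex)
       (Seq (Write 101 (Var 0) (Read 1 (Var 0))) (assign 100 (Var 0)))"

lemma terminates_copy_vertices:
  assumes "s0 0 0 = n" "s0 100 = (\<lambda>_. 0)" "s0 101 = (\<lambda>_. 0)" "s0 103 = (\<lambda>_. 0)" "s0 14 0 = 0"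
  shows "terminates copy_vertices s0 (10 * n + 4) (\<lambda>s.
    s 100 = (\<lambda>_. 0)(0 := n) \<and> s 101 = (\<lambda>v. if v \<le> n then s0 1 v else 0) \<and>
    s 103 = (\<lambda>v. if v < n then s0 3 v else 0) \<and>
    (\<forall>v<n. s 21 v = v \<and> s 22 v = s0 3 v) \<and>
    s 14 0 = (if \<exists>v<n. 0 < s0 3 v \<and> \<not> s0 1 v < s0 1 (Suc v) then 1 else 0))"
    (is "terminates _ _ _ ?Q")
proof -
  let ?J = "\<lambda>i s. s 101 = (\<lambda>v. if v < i then s0 1 v else 0) \<and>
    s 103 = (\<lambda>v. if v < i then s0 3 v else 0) \<and>
    (\<forall>v<i. s 21 v = v \<and> s 22 v = s0 3 v) \<and>
    s 14 0 = (if \<exists>v<i. 0 < s0 3 v \<and> \<not> s0 1 v < s0 1 (Suc v) then 1 else 0)"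
  have "terminates (for_loop 10 (Const 0) (Var 0) copy_vertex) s0 ((cost copy_vertex + 2) * (n - 0) + 2) (?J n)"
  proof (rule terminates_for_loop)
    fix s i assume s: "s 10 0 = i" "i < n" "?J i s" and ag: "agree (insert 10 (writes copy_vertex)) s0 s"
    have fr: "s 0 = s0 0" "s (Suc 0) = s0 (Suc 0)" "s 3 = s0 3" using ag by (auto simp: agree_def copy_vertex_def)
    show "?J (Suc i) (run (Seq copy_vertex (incr 10)) s)"
      using s by (auto simp: copy_vertex_def fr fun_eq_iff less_Suc_eq)
  qed (use assms in \<open>auto simp: agree_def copy_vertex_def\<close>)
  then have "terminates copy_vertices s0 ((cost copy_vertex + 2) * (n - 0) + 2 + 2) ?Q"
    unfolding copy_vertices_def
  proof (rule terminates_Seq)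
    fix s assume J: "?J n s" and ag: "agree (writes (for_loop 10 (Const 0) (Var 0) copy_vertex)) s0 s"
    have fr: "s 0 = s0 0" "s (Suc 0) = s0 (Suc 0)" "s 100 = s0 100"
      using ag by (auto simp: agree_def copy_vertex_def)
    show "terminates (Seq (Write 101 (Var 0) (Read 1 (Var 0))) (assign 100 (Var 0))) s 2 ?Q"
      by (rule terminates_weaken[OF terminates_run]) (use J assms in \<open>auto simp: fr fun_eq_iff\<close>)
  qed
  then show ?thesis by (rule terminates_weaken) (auto simp: copy_vertex_def)
qed

text \<open>Nested loops over vertices and their lists, merged into one: a round either assigns the
  next edge to the current vertex or advances the vertex. This gives at most m + n rounds.\<close>

definition copy_edge :: com where
  "copy_edge =
     Cond (Less (Var 11) (Read 1 (succ (Var 10))))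
       (Seq (Write 20 (Var 11) (Var 10))
       (Seq (Write 102 (Var 11) (Read 2 (Var 11)))
         (incr 11)))
       (incr 10)"

definition copy_edges :: com where
  "copy_edges = Seq (Seq (assign 10 (Const 0)) (assign 11 (Const 0)))
     (While (Less (Var 11) (Read 1 (Var 0))) copy_edge)"

lemma terminates_copy_edges:
  assumes "s0 0 0 = n" "s0 1 0 = 0" "s0 1 n = m" "s0 102 = (\<lambda>_. 0)"
  shows "terminates copy_edges s0 (6 * (m + n) + 3) (\<lambda>s.
    s 102 = (\<lambda>e. if e < m then s0 2 e else 0) \<and>
    (\<forall>e<m. s 20 e < n \<and> s0 1 (s 20 e) \<le> e \<and> e < s0 1 (Suc (s 20 e))))"
    (is "terminates _ _ _ ?Q")
proof -
  let ?b = "Less (Var 11) (Read 1 (Var 0))"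
  let ?I = "\<lambda>s. s 11 0 \<le> m \<and> s 10 0 \<le> n \<and> s0 1 (s 10 0) \<le> s 11 0 \<and>
    s 102 = (\<lambda>e. if e < s 11 0 then s0 2 e else 0) \<and>
    (\<forall>e<s 11 0. s 20 e < n \<and> s0 1 (s 20 e) \<le> e \<and> e < s0 1 (Suc (s 20 e)))"
  let ?s = "s0(10 := (s0 10)(0 := 0), 11 := (s0 11)(0 := 0))"
  have "terminates (While ?b copy_edge) ?s (Suc (cost copy_edge) * (m + n) + 1) (\<lambda>s. ?I s \<and> \<not> bval ?b s)"
  proof (rule terminates_While_run[where \<mu> = "\<lambda>s. (m - s 11 0) + (n - s 10 0)"])
    fix s assume I: "?I s" and b: "bval ?b s" and ag: "agree (writes copy_edge) ?s s"
    have fr: "s 0 = s0 0" "s (Suc 0) = s0 (Suc 0)" "s 2 = s0 2"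
      using ag by (auto simp: agree_def copy_edge_def)
    have e: "s 11 0 < m" using b assms by (simp add: fr)
    \<comment> \<open>If all vertices had been passed, the invariant would put the edge pointer at
      \<open>m\<close> or beyond.\<close>
    have v: "s 10 0 < n" using I e assms by (cases "s 10 0 = n") auto
    show "?I (run copy_edge s) \<and>
        (m - run copy_edge s 11 0) + (n - run copy_edge s 10 0) < (m - s 11 0) + (n - s 10 0)"
      using I e v by (auto simp: copy_edge_def fr fun_eq_iff less_Suc_eq)
  qed (use assms in \<open>auto simp: copy_edge_def\<close>)
  then have "terminates (While ?b copy_edge) ?s (6 * (m + n) + 1) ?Q"
  proof (rule terminates_weaken)
    fix s assume I: "?I s \<and> \<not> bval ?b s" and ag: "agree (writes (While ?b copy_edge)) ?s s"
    have fr: "s 0 = s0 0" "s (Suc 0) = s0 (Suc 0)" using ag by (auto simp: agree_def copy_edge_def)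
    have "s 11 0 = m" using I assms by (auto simp: fr)
    then show "?Q s" using I by auto
  qed (simp add: copy_edge_def)
  then show ?thesis
    unfolding copy_edges_def by (rule terminates_Seq_run) auto
qed

text \<open>The same merged loop over the components. The first vertex in the list of a component
  becomes its representative, and all its vertices, random ones included, are marked as controlled
  by player 1.\<close>

definition label_vertex :: com where
  "label_vertex =
     Cond (Less (Var 13) (Read 108 (succ (Var 18))))
       (Seq (Write 21 (Read 109 (Var 13)) (Read 109 (Read 108 (Var 18))))
       (Seq (Write 22 (Read 109 (Var 13)) (Const 1))
         (incr 13)))
       (incr 18)"

definition label_MECs :: com where
  "label_MECs = Seq (Seq (assign 18 (Const 0)) (assign 13 (Const 0)))
     (While (Less (Var 13) (Read 108 (Var 107))) label_vertex)"

lemma terminates_label_MECs: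
  assumes "s0 107 0 = J" "s0 108 0 = 0" "s0 108 J = t"
  shows "terminates label_MECs s0 (6 * (t + J) + 3) (\<lambda>s. \<forall>v.
    (\<forall>p<t. s0 109 p \<noteq> v) \<and> s 21 v = s0 21 v \<and> s 22 v = s0 22 v \<or>
    (\<exists>i<J. \<exists>p<t. s0 109 p = v \<and> s0 108 i \<le> p \<and> p < s0 108 (Suc i) \<and>
       s 21 v = s0 109 (s0 108 i) \<and> s 22 v = 1))"
    (is "terminates _ _ _ ?Q")
proof -
  let ?b = "Less (Var 13) (Read 108 (Var 107))"
  let ?K = "\<lambda>P s v. (\<forall>p<P. s0 109 p \<noteq> v) \<and> s 21 v = s0 21 v \<and> s 22 v = s0 22 v \<or>
    (\<exists>i<J. \<exists>p<P. s0 109 p = v \<and> s0 108 i \<le> p \<and> p < s0 108 (Suc i) \<and>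
       s 21 v = s0 109 (s0 108 i) \<and> s 22 v = (1::nat))"
  let ?I = "\<lambda>s. s 13 0 \<le> t \<and> s 18 0 \<le> J \<and> s0 108 (s 18 0) \<le> s 13 0 \<and> (\<forall>v. ?K (s 13 0) s v)"
  let ?s = "s0(18 := (s0 18)(0 := 0), 13 := (s0 13)(0 := 0))"
  have "terminates (While ?b label_vertex) ?s (Suc (cost label_vertex) * (t + J) + 1) (\<lambda>s. ?I s \<and> \<not> bval ?b s)"
  proof (rule terminates_While_run[where \<mu> = "\<lambda>s. (t - s 13 0) + (J - s 18 0)"])
    fix s assume I: "?I s" and b: "bval ?b s" and ag: "agree (writes label_vertex) ?s s"
    have fr: "s 107 = s0 107" "s 108 = s0 108" "s 109 = s0 109"
      using ag by (auto simp: agree_def label_vertex_def)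
    have p: "s 13 0 < t" using b assms by (simp add: fr)
    have j: "s 18 0 < J" using I p assms by (cases "s 18 0 = J") auto
    have \<mu>: "(t - run label_vertex s 13 0) + (J - run label_vertex s 18 0) < (t - s 13 0) + (J - s 18 0)"
      using p j by (auto simp: label_vertex_def)
    show "?I (run label_vertex s) \<and>
        (t - run label_vertex s 13 0) + (J - run label_vertex s 18 0) < (t - s 13 0) + (J - s 18 0)"
    proof (cases "s 13 0 < s0 108 (Suc (s 18 0))")
      case True
      have K: "?K (run label_vertex s 13 0) (run label_vertex s) v" for v
      proof (cases "v = s0 109 (s 13 0)")
        case v: True
        then show ?thesis using True j I
          by (intro disjI2 exI[of _ "s 18 0"] conjI exI[of _ "s 13 0"]) (auto simp: label_vertex_def fr)
      next
        case False
        have "?K (s 13 0) s v" using I by blast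
        then show ?thesis
        proof (elim disjE)
          assume "\<exists>i<J. \<exists>p<s 13 0. s0 109 p = v \<and> s0 108 i \<le> p \<and> p < s0 108 (Suc i) \<and>
            s 21 v = s0 109 (s0 108 i) \<and> s 22 v = 1"
          then obtain i p where "i < J" "p < s 13 0" "s0 109 p = v" "s0 108 i \<le> p" "p < s0 108 (Suc i)"
            "s 21 v = s0 109 (s0 108 i)" "s 22 v = 1" by blast
          then show ?thesis using False True
            by (intro disjI2 exI[of _ i] conjI exI[of _ p]) (auto simp: label_vertex_def fr)
        qed (use False True in \<open>auto simp: label_vertex_def fr less_Suc_eq\<close>)
      qed
      moreover have "run label_vertex s 13 0 \<le> t \<and> run label_vertex s 18 0 \<le> J \<and>
        s0 108 (run label_vertex s 18 0) \<le> run label_vertex s 13 0"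
        using True I p by (auto simp: label_vertex_def fr)
      ultimately show ?thesis using \<mu> by blast
    next
      case False
      then have r: "run label_vertex s 13 0 = s 13 0" "run label_vertex s 18 0 = Suc (s 18 0)"
        "run label_vertex s 21 = s 21" "run label_vertex s 22 = s 22"
        by (auto simp: label_vertex_def fr)
      show ?thesis using \<mu> I False j unfolding r by auto
    qed
  qed (use assms in \<open>auto simp: label_vertex_def\<close>)
  then have "terminates (While ?b label_vertex) ?s (6 * (t + J) + 1) ?Q"
  proof (rule terminates_weaken)
    fix s assume I: "?I s \<and> \<not> bval ?b s" and ag: "agree (writes (While ?b label_vertex)) ?s s"
    have fr: "s 107 = s0 107" "s 108 = s0 108" using ag by (auto simp: agree_def label_vertex_def)
    have "s 13 0 = t" using I assms by (auto simp: fr)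
    then show "?Q s" using I by simp
  qed (simp add: label_vertex_def)
  then show ?thesis
    unfolding label_MECs_def by (rule terminates_Seq_run) auto
qed

text \<open>The counter starts at \<open>1\<close> where chance decides and at \<open>0\<close>
  where player 1 does; in the latter case the exits are added while the edges are linked.\<close>

definition init_counts :: com where
  "init_counts = for_loop 10 (Const 0) (Var 0)
     (Write 23 (Var 10) (Minus (Const 1) (Read 22 (Var 10))))"

lemma terminates_init_counts:
  assumes "s0 0 0 = n"
  shows "terminates init_counts s0 (3 * n + 2) (\<lambda>s. \<forall>v<n. s 23 v = 1 - s0 22 v)"
proof -
  let ?c = "Write 23 (Var 10) (Minus (Const 1) (Read 22 (Var 10)))"
  let ?J = "\<lambda>i s. \<forall>v<i. s 23 v = 1 - s0 22 v"
  have "terminates init_counts s0 ((cost ?c + 2) * (n - 0) + 2) (?J n)"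
    unfolding init_counts_def
  proof (rule terminates_for_loop)
    fix s i assume s: "s 10 0 = i" "?J i s" and ag: "agree (insert 10 (writes ?c)) s0 s"
    have fr: "s 22 = s0 22" using ag by (auto simp: agree_def)
    show "?J (Suc i) (run (Seq ?c (incr 10)) s)"
      using s by (auto simp: fr less_Suc_eq)
  qed (use assms in \<open>auto simp: agree_def\<close>)
  then show ?thesis by (rule terminates_weaken) auto
qed

abbreviation neq :: "aexp \<Rightarrow> aexp \<Rightarrow> bexp" where
  "neq x y \<equiv> Neg (And (Neg (Less x y)) (Neg (Less y x)))"

text \<open>Prepends the edge, as pointer \<open>e + 1\<close>, to the list of its target block.
  Edges inside a block are linked too, harmlessly, as they are processed only after the block is
  lost; but only exits may enter the threshold of a controlled block.\<close>

definition link_edge :: com where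
  "link_edge =
     Seq (Write 20 (Var 11) (Read 21 (Read 20 (Var 11))))
    (Seq (Write 25 (succ (Var 11)) (Read 24 (Read 21 (Read 2 (Var 11)))))
    (Seq (Write 24 (Read 21 (Read 2 (Var 11))) (succ (Var 11)))
      (Cond (And (neq (Read 20 (Var 11)) (Read 21 (Read 2 (Var 11))))
                 (Less (Const 0) (Read 22 (Read 20 (Var 11)))))
        (Write 23 (Read 20 (Var 11)) (succ (Read 23 (Read 20 (Var 11))))) Skip)))"

definition link_edges :: com where
  "link_edges = for_loop 11 (Const 0) (Read 1 (Var 0)) link_edge"

text \<open>Prepending in increasing order makes \<open>last_in D i\<close> the heads after
  \<open>i\<close> edges. The successor of edge \<open>e\<close> is the head just before
  \<open>e\<close> was added, hence \<open>last_in D e (D e)\<close>.\<close>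

lemma terminates_link_edges:
  fixes s0 :: state
  defines "S \<equiv> \<lambda>e. s0 21 (s0 20 e)" and "D \<equiv> \<lambda>e. s0 21 (s0 2 e)"
  assumes "s0 0 0 = n" "s0 1 n = m" "s0 24 = (\<lambda>_. 0)"
  shows "terminates link_edges s0 (8 * m + 2) (\<lambda>s.
    (\<forall>e<m. s 20 e = S e) \<and> s 24 = last_in D m \<and> (\<forall>e<m. s 25 (Suc e) = last_in D e (D e)) \<and>
    (\<forall>b. s 23 b = s0 23 b + (if 0 < s0 22 b then card {e. e < m \<and> S e = b \<and> D e \<noteq> b} else 0)))"
proof -
  let ?J = "\<lambda>i s. (\<forall>e. s 20 e = (if e < i then S e else s0 20 e)) \<and> s 24 = last_in D i \<and>
    (\<forall>e<i. s 25 (Suc e) = last_in D e (D e)) \<and>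
    (\<forall>b. s 23 b = s0 23 b + (if 0 < s0 22 b then card {e. e < i \<and> S e = b \<and> D e \<noteq> b} else 0))"
  have "terminates link_edges s0 ((cost link_edge + 2) * (m - 0) + 2) (?J m)"
    unfolding link_edges_def
  proof (rule terminates_for_loop)
    fix s i assume s: "s 11 0 = i" "?J i s" and ag: "agree (insert 11 (writes link_edge)) s0 s"
    have fr: "s 2 = s0 2" "s 21 = s0 21" "s 22 = s0 22" using ag by (auto simp: agree_def link_edge_def)
    have Si: "s0 21 (s0 20 e) = S e" "s0 21 (s0 2 e) = D e" for e by (auto simp: S_def D_def)
    show "?J (Suc i) (run (Seq link_edge (incr 11)) s)"
      using s unfolding card_less_Suc
      by (auto simp: link_edge_def fr Si less_Suc_eq fun_eq_iff)
  qed (use assms in \<open>auto simp: agree_def link_edge_def fun_eq_iff\<close>)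
  then show ?thesis by (rule terminates_weaken) (auto simp: link_edge_def)
qed

definition reset_counts :: com where
  "reset_counts = for_loop 10 (Const 0) (Var 0) (Write 26 (Var 10) (Read 23 (Var 10)))"

lemma terminates_reset_counts:
  assumes "s0 0 0 = n"
  shows "terminates reset_counts s0 (3 * n + 2) (\<lambda>s. \<forall>v<n. s 26 v = s0 23 v)"
proof -
  let ?c = "Write 26 (Var 10) (Read 23 (Var 10))"
  let ?J = "\<lambda>i s. \<forall>v<i. s 26 v = s0 23 v"
  have "terminates reset_counts s0 ((cost ?c + 2) * (n - 0) + 2) (?J n)"
    unfolding reset_counts_def
  proof (rule terminates_for_loop)
    fix s i assume s: "s 10 0 = i" "?J i s" and ag: "agree (insert 10 (writes ?c)) s0 s"
    have fr: "s 23 = s0 23" using ag by (auto simp: agree_def)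
    show "?J (Suc i) (run (Seq ?c (incr 10)) s)"
      using s by (auto simp: fr less_Suc_eq)
  qed (use assms in \<open>auto simp: agree_def\<close>)
  then show ?thesis by (rule terminates_weaken) auto
qed

text \<open>The value m + 1 exceeds the number of all edges, so a block that meets the target is
  never lost.\<close>

definition block_targets :: com where
  "block_targets = for_loop 13 (Read 5 (Var 12)) (Read 5 (succ (Var 12)))
     (Write 26 (Read 21 (Read 6 (Var 13))) (succ (Read 1 (Var 0))))"

lemma terminates_block_targets:
  assumes "s0 0 0 = n" "s0 1 n = m" "s0 12 0 = i" "s0 5 i \<le> s0 5 (Suc i)"
  shows "terminates block_targets s0 (3 * (s0 5 (Suc i) - s0 5 i) + 2) (\<lambda>s. \<forall>b.
    s 26 b = (if \<exists>p. s0 5 i \<le> p \<and> p < s0 5 (Suc i) \<and> s0 21 (s0 6 p) = b then Suc m else s0 26 b))"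
proof -
  let ?c = "Write 26 (Read 21 (Read 6 (Var 13))) (succ (Read 1 (Var 0)))"
  let ?J = "\<lambda>j s. \<forall>b. s 26 b = (if \<exists>p. s0 5 i \<le> p \<and> p < j \<and> s0 21 (s0 6 p) = b then Suc m else s0 26 b)"
  have "terminates block_targets s0 ((cost ?c + 2) * (s0 5 (Suc i) - s0 5 i) + 2) (?J (s0 5 (Suc i)))"
    unfolding block_targets_def
  proof (rule terminates_for_loop)
    fix s j assume s: "s 13 0 = j" "?J j s" "s0 5 i \<le> j" and ag: "agree (insert 13 (writes ?c)) s0 s"
    have fr: "s 0 = s0 0" "s (Suc 0) = s0 (Suc 0)" "s 6 = s0 6" "s 21 = s0 21"
      using ag by (auto simp: agree_def)
    show "?J (Suc j) (run (Seq ?c (incr 13)) s)"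
      using s assms by (auto simp: fr less_Suc_eq)
  qed (use assms in \<open>auto simp: agree_def\<close>)
  then show ?thesis by (rule terminates_weaken) auto
qed

definition fill_queue :: com where
  "fill_queue = Seq (assign 16 (Const 0)) (for_loop 10 (Const 0) (Var 0)
     (Cond (Less (Const 0) (Read 26 (Var 10))) Skip
       (Seq (Write 27 (Var 16) (Var 10)) (incr 16))))"

lemma terminates_fill_queue:
  assumes "s0 0 0 = n"
  shows "terminates fill_queue s0 (6 * n + 3) (\<lambda>s.
    inj_on (s 27) {..<s 16 0} \<and> s 27 ` {..<s 16 0} = {b. b < n \<and> s0 26 b = 0})"
    (is "terminates _ _ _ ?Q")
proof -
  let ?c = "Cond (Less (Const 0) (Read 26 (Var 10))) Skip (Seq (Write 27 (Var 16) (Var 10)) (incr 16))"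
  let ?J = "\<lambda>i s. inj_on (s 27) {..<s 16 0} \<and> s 27 ` {..<s 16 0} = {b. b < i \<and> s0 26 b = 0}"
  let ?s = "s0(16 := (s0 16)(0 := 0))"
  have "terminates (for_loop 10 (Const 0) (Var 0) ?c) ?s ((cost ?c + 2) * (n - 0) + 2) (?J n)"
  proof (rule terminates_for_loop)
    fix s i assume s: "s 10 0 = i" "?J i s" and ag: "agree (insert 10 (writes ?c)) ?s s"
    have fr: "s 26 = s0 26" using ag by (auto simp: agree_def)
    show "?J (Suc i) (run (Seq ?c (incr 10)) s)"
    proof (cases "s0 26 i = 0")
      case True
      have "i \<notin> s 27 ` {..<s 16 0}" using s by auto
      then have "inj_on ((s 27)(s 16 0 := i)) {..<Suc (s 16 0)}"
        using s unfolding lessThan_Suc by (subst inj_on_insert) (auto simp: inj_on_def)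
      moreover have "(s 27)(s 16 0 := i) ` {..<Suc (s 16 0)} = insert i (s 27 ` {..<s 16 0})"
        by (auto simp: lessThan_Suc)
      moreover have "\<dots> = {b. b < Suc i \<and> s0 26 b = 0}"
        using s True by (auto simp: less_Suc_eq)
      ultimately show ?thesis using s True by (simp add: fr del: fun_upd_apply) (simp add: fun_upd_def)
    next
      case False
      then have "{b. b < Suc i \<and> s0 26 b = 0} = {b. b < i \<and> s0 26 b = 0}" by (auto simp: less_Suc_eq)
      then show ?thesis using s False by (simp add: fr)
    qed
  qed (use assms in \<open>auto simp: agree_def\<close>)
  then show ?thesis
    unfolding fill_queue_def by (rule terminates_Seq_run) auto
qed

text \<open>Again a flattened double loop: a round handles one edge into the block popped last or,
  if the pointer is null, pops the next block.\<close>

definition attractor_step :: com where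
  "attractor_step =
     Cond (Less (Const 0) (Var 17))
       (Seq (Cond (Less (Const 0) (Read 26 (Read 20 (Minus (Var 17) (Const 1)))))
              (Seq (Write 26 (Read 20 (Minus (Var 17) (Const 1)))
                     (Minus (Read 26 (Read 20 (Minus (Var 17) (Const 1)))) (Const 1)))
                (Cond (Less (Const 0) (Read 26 (Read 20 (Minus (Var 17) (Const 1))))) Skip
                  (Seq (Write 27 (Var 16) (Read 20 (Minus (Var 17) (Const 1)))) (incr 16))))
              Skip)
         (assign 17 (Read 25 (Var 17))))
       (Seq (assign 17 (Read 24 (Read 27 (Var 15)))) (incr 15))"

definition attractor :: com where
  "attractor = Seq (Seq (assign 15 (Const 0)) (assign 17 (Const 0)))
     (While (Neg (And (Neg (Less (Const 0) (Var 17))) (Neg (Less (Var 15) (Var 16))))) attractor_step)"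

lemma terminates_attractor:
  assumes S: "\<And>e. e < m \<Longrightarrow> s0 20 e = S e" "\<And>e. e < m \<Longrightarrow> S e < n"
    and head: "s0 24 = last_in D m" and nxt: "\<And>e. e < m \<Longrightarrow> s0 25 (Suc e) = last_in D e (D e)"
    and queue: "inj_on (s0 27) {..<s0 16 0}" "s0 27 ` {..<s0 16 0} = {b. b < n \<and> s0 26 b = 0}"
  shows "terminates attractor s0 (14 * (m + n) + 3) (\<lambda>s.
    threshold_closed n m S D (s0 26) {b. b < n \<and> s 26 b = 0} \<and>
    (\<forall>X. threshold_closed n m S D (s0 26) X \<longrightarrow> {b. b < n \<and> s 26 b = 0} \<subseteq> X))"
    (is "terminates _ _ _ ?Q")
proof -
  let ?b = "Neg (And (Neg (Less (Const 0) (Var 17))) (Neg (Less (Var 15) (Var 16))))"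
  let ?c = attractor_step
  let ?I = "\<lambda>s. attractor_inv n m S D (s0 26) (s 15 0) (s 16 0) (s 17 0) (s 27) (s 26)"
  let ?P = "\<lambda>s. processed m D (s 15 0) (s 17 0) (s 27)"
  \<comment> \<open>A pop leaves the processed set alone and advances the front; every other round
    processes a new edge. Hence there are at most m + n rounds.\<close>
  let ?\<mu> = "\<lambda>s. card ({..<m} - ?P s) + (n - s 15 0)"
  let ?s = "s0(15 := (s0 15)(0 := 0), 17 := (s0 17)(0 := 0))"
  have "terminates (While ?b ?c) ?s (Suc (cost ?c) * (m + n) + 1) (\<lambda>s. ?I s \<and> \<not> bval ?b s)"
  proof (rule terminates_While_run[where \<mu> = ?\<mu>])
    fix s assume I: "?I s" and b: "bval ?b s" and ag: "agree (writes ?c) ?s s"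
    have fr: "s 20 = s0 20" "s 24 = s0 24" "s 25 = s0 25"
      using ag by (auto simp: agree_def attractor_step_def)
    show "?I (run ?c s) \<and> ?\<mu> (run ?c s) < ?\<mu> s"
    proof (cases "s 17 0")
      case 0
      then have h: "s 15 0 < s 16 0" using b by simp
      have r: "run ?c s 15 0 = Suc (s 15 0)" "run ?c s 16 = s 16" "run ?c s 26 = s 26" "run ?c s 27 = s 27"
        "run ?c s 17 0 = last_in D m (s 27 (s 15 0))"
        using 0 by (auto simp: attractor_step_def fr head)
      note pop = attractor_inv_pop[OF I[unfolded 0] h]
      have "s 15 0 < n" using h attractor_inv_le[OF I] by simp
      then show ?thesis unfolding r pop(2) using pop(1) by (auto simp: 0)
    next
      case (Suc e)
      have e: "e < m" using I Suc by (simp add: attractor_inv_def)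
      have r: "run ?c s 15 = s 15" "run ?c s 17 0 = last_in D e (D e)"
        "run ?c s 26 = (s 26)(S e := s 26 (S e) - 1)"
        "if s 26 (S e) = 1 then run ?c s 16 0 = Suc (s 16 0) \<and> run ?c s 27 = (s 27)(s 16 0 := S e)
           else run ?c s 16 0 = s 16 0 \<and> run ?c s 27 = s 27"
        using Suc S(1)[OF e] nxt[OF e] by (auto simp: attractor_step_def fr fun_eq_iff)
      note step = attractor_inv_step[OF I[unfolded Suc] S(2)[OF e] r(3,4)]
      have "card ({..<m} - insert e (?P s)) < card ({..<m} - ?P s)"
        using step(3,4) Suc by (intro psubset_card_mono) auto
      then show ?thesis using step(1) unfolding r(1,2) step(2) by (simp add: Suc)
    qed
  next
    have "card ({..<m} - ?P ?s) \<le> card {..<m}" by (intro card_mono) auto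
    then show "?\<mu> ?s \<le> m + n" by simp
  qed (use attractor_inv_init[OF queue] in \<open>auto simp: attractor_step_def\<close>)
  then have "terminates (While ?b ?c) ?s (14 * (m + n) + 1) ?Q"
  proof (rule terminates_weaken)
    fix s assume "?I s \<and> \<not> bval ?b s"
    then have I: "?I s" and "\<not> bval ?b s" by blast+
    then have x: "s 17 0 = 0" and "s 15 0 = s 16 0" by (auto simp: attractor_inv_def)
    with I have "attractor_inv n m S D (s0 26) (s 16 0) (s 16 0) 0 (s 27) (s 26)" by simp
    from attractor_inv_done[OF this] show "?Q s" by blast
  qed (simp add: attractor_step_def)
  then show ?thesis
    unfolding attractor_def by (rule terminates_Seq_run) auto
qed

text \<open>A positive counter after the attractor means that the block is not lost. Array 28 is
  never cleared, so it accumulates the union over the target sets.\<close>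

definition collect_wins :: com where
  "collect_wins = for_loop 10 (Const 0) (Var 0)
     (Cond (Less (Const 0) (Read 26 (Read 21 (Var 10)))) (Write 28 (Var 10) (Const 1)) Skip)"

lemma terminates_collect_wins:
  assumes "s0 0 0 = n"
  shows "terminates collect_wins s0 (5 * n + 2) (\<lambda>s. \<forall>v<n.
    0 < s 28 v \<longleftrightarrow> 0 < s0 28 v \<or> 0 < s0 26 (s0 21 v))"
proof -
  let ?c = "Cond (Less (Const 0) (Read 26 (Read 21 (Var 10)))) (Write 28 (Var 10) (Const 1)) Skip"
  let ?J = "\<lambda>i s. (\<forall>v<i. 0 < s 28 v \<longleftrightarrow> 0 < s0 28 v \<or> 0 < s0 26 (s0 21 v)) \<and> (\<forall>v\<ge>i. s 28 v = s0 28 v)"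
  have "terminates collect_wins s0 ((cost ?c + 2) * (n - 0) + 2) (?J n)"
    unfolding collect_wins_def
  proof (rule terminates_for_loop)
    fix s i assume s: "s 10 0 = i" "?J i s" and ag: "agree (insert 10 (writes ?c)) s0 s"
    have fr: "s 21 = s0 21" "s 26 = s0 26" using ag by (auto simp: agree_def)
    show "?J (Suc i) (run (Seq ?c (incr 10)) s)"
      using s by (auto simp: fr less_Suc_eq)
  qed (use assms in \<open>auto simp: agree_def\<close>)
  then show ?thesis by (rule terminates_weaken) auto
qed

text \<open>The dead-end flag suppresses all output; the length in array 7 is then still
  \<open>0\<close>.\<close>

definition output_wins :: com where
  "output_wins = Cond (Less (Const 0) (Var 14)) Skip (for_loop 10 (Const 0) (Var 0)
     (Cond (Less (Const 0) (Read 28 (Var 10))) (Seq (Write 8 (Var 7) (Var 10)) (incr 7)) Skip))"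

lemma terminates_output_wins:
  assumes "s0 0 0 = n" "s0 7 0 = 0"
  shows "terminates output_wins s0 (6 * n + 3) (\<lambda>s. \<exists>xs. holds_list s 7 [length xs] \<and> holds_list s 8 xs \<and>
    list_of_set xs {v. v < n \<and> s0 14 0 = 0 \<and> 0 < s0 28 v})"
    (is "terminates _ _ _ ?Q")
proof (cases "0 < s0 14 0")
  case True
  have Q: "?Q s0" using True assms by (auto simp: holds_list_def list_of_set_def)
  have "exec output_wins s0 (Suc 1) s0" unfolding output_wins_def
    by (rule exec_Cond_True) (use True in \<open>auto intro: exec_Skip[unfolded One_nat_def]\<close>)
  with Q show ?thesis unfolding terminates_def by (auto intro!: exI[of _ "Suc 1"])
next
  case False
  let ?c = "Cond (Less (Const 0) (Read 28 (Var 10))) (Seq (Write 8 (Var 7) (Var 10)) (incr 7)) Skip"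
  let ?J = "\<lambda>i s. s 7 0 = length (filter (\<lambda>v. 0 < s0 28 v) [0..<i]) \<and>
    (\<forall>j<s 7 0. s 8 j = filter (\<lambda>v. 0 < s0 28 v) [0..<i] ! j)"
  have "terminates (for_loop 10 (Const 0) (Var 0) ?c) s0 ((cost ?c + 2) * (n - 0) + 2) (?J n)"
  proof (rule terminates_for_loop)
    fix s i assume s: "s 10 0 = i" "?J i s" and ag: "agree (insert 10 (writes ?c)) s0 s"
    have fr: "s 28 = s0 28" using ag by (auto simp: agree_def)
    show "?J (Suc i) (run (Seq ?c (incr 10)) s)"
      using s by (auto simp: fr nth_append less_Suc_eq)
  qed (use assms in \<open>auto simp: agree_def\<close>)
  then obtain t s where ts: "exec (for_loop 10 (Const 0) (Var 0) ?c) s0 t s"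
    "t \<le> (cost ?c + 2) * (n - 0) + 2" "?J n s" unfolding terminates_def by blast
  have "exec output_wins s0 (Suc t) s"
    unfolding output_wins_def by (rule exec_Cond_False) (use False ts in auto)
  moreover have "?Q s"
    using ts(3) False
    by (intro exI[of _ "filter (\<lambda>v. 0 < s0 28 v) [0..<n]"]) (auto simp: holds_list_def list_of_set_def)
  ultimately show ?thesis using ts(2) unfolding terminates_def by (auto intro!: exI[of _ "Suc t"])
qed

section \<open>Blocks, adjacency lists and lists of components\<close>

text \<open>\<open>blk\<close> picks one member of each block, the same for all its vertices, so
  that blocks can be compared as numbers; \<open>kind\<close> is a truth value.\<close>

definition block_labelling :: "nat mdp \<Rightarrow> nat \<Rightarrow> (nat \<Rightarrow> nat) \<Rightarrow> (nat \<Rightarrow> nat) \<Rightarrow> bool" where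
  "block_labelling P n blk kind \<longleftrightarrow>
     (\<forall>v<n. blk v < n \<and> blk v \<in> block P v \<and> (\<forall>u\<in>block P v. blk u = blk v) \<and>
        (0 < kind v \<longleftrightarrow> v \<in> player1 P \<or> v \<in> \<Union>(MECs P)))"

lemma block_in_verts: "v \<in> verts P \<Longrightarrow> block P v \<subseteq> verts P"
  using MEC_subset_verts by (fastforce simp: block_def)

lemma blk_eq_iff:
  assumes lab: "block_labelling P n blk kind" and "u < n" "v < n"
  shows "blk u = blk v \<longleftrightarrow> u \<in> block P v"
proof
  assume "blk u = blk v"
  then have "blk v \<in> block P u" "blk v \<in> block P v"
    using lab assms unfolding block_labelling_def by metis+
  then have "block P u = block P v" by (metis block_eq)
  then show "u \<in> block P v" using block_self by metis
next
  assume "u \<in> block P v"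
  then show "blk u = blk v" using lab assms unfolding block_labelling_def by blast
qed

text \<open>Blocks of losing vertices lie in \<open>L\<close> by rule induction, since closedness
  mirrors both rules of \<open>losing\<close>. Conversely these blocks form a closed set, and
  \<open>L\<close> is the least one.\<close>

lemma threshold_losing:
  assumes P: "is_mdp P" and n: "verts P = {..<n}"
    and edges: "\<And>u w. (u, w) \<in> edges P \<longleftrightarrow> (\<exists>e<m. src e = u \<and> tgt e = w)"
    and lab: "block_labelling P n blk kind"
    and T: "T \<subseteq> verts P"
    and S: "\<And>e. e < m \<Longrightarrow> S e = blk (src e)" and D: "\<And>e. e < m \<Longrightarrow> D e = blk (tgt e)"
    and c: "\<And>b. b < n \<Longrightarrow> c b = (if b \<in> blk ` T then Suc m
      else if 0 < kind b then card {e. e < m \<and> S e = b \<and> D e \<noteq> b} else 1)"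
    and closed: "threshold_closed n m S D c L"
    and least: "\<And>X. threshold_closed n m S D c X \<Longrightarrow> L \<subseteq> X"
    and v: "v < n"
  shows "blk v \<in> L \<longleftrightarrow> v \<in> losing P T"
proof
  have st: "src e < n" "tgt e < n" "(src e, tgt e) \<in> edges P" if "e < m" for e
  proof -
    show "(src e, tgt e) \<in> edges P" using that edges by blast
    then show "src e < n" "tgt e < n" using P n by (auto simp: is_mdp_def)
  qed
  have blk_lt: "blk v < n" if "v < n" for v using lab that by (simp add: block_labelling_def)
  note eq_iff = blk_eq_iff[OF lab]
  have blk_T: "blk v \<in> blk ` T \<longleftrightarrow> block P v \<inter> T \<noteq> {}" if v: "v < n" for v
  proof -
    have "blk v = blk t \<longleftrightarrow> t \<in> block P v" if "t \<in> T" for t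
      using eq_iff[of t v] that T n v by auto
    then show ?thesis by (auto simp: image_iff)
  qed
  have kind_blk: "0 < kind (blk v) \<longleftrightarrow> v \<in> player1 P \<or> v \<in> \<Union>(MECs P)" if v: "v < n" for v
  proof -
    have b: "blk v \<in> block P v" "blk v < n" using lab v by (auto simp: block_labelling_def)
    show ?thesis
    proof (cases "v \<in> \<Union>(MECs P)")
      case True
      then obtain M where M: "M \<in> MECs P" "v \<in> M" by auto
      then have "blk v \<in> M" using b by (simp add: block_MEC)
      then show ?thesis using M b lab by (auto simp: block_labelling_def)
    next
      case False
      then have "blk v = v" using b by (simp add: block_not_MEC)
      then show ?thesis using lab v by (simp add: block_labelling_def)
    qed
  qed
  {
    assume "v \<in> losing P T"
    then show "blk v \<in> L"
    proof induction
      case (choice v)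
      have v: "v < n" using choice.hyps n by simp
      have "blk v \<notin> blk ` T" using blk_T[OF v] choice.hyps by simp
      then have cv: "c (blk v) = card {e. e < m \<and> S e = blk v \<and> D e \<noteq> blk v}"
        using c[OF blk_lt[OF v]] kind_blk[OF v] choice.hyps by simp
      have "D e \<in> L" if e: "e < m" "S e = blk v" "D e \<noteq> blk v" for e
      proof -
        have "src e \<in> block P v" using e S st(1)[OF e(1)] eq_iff[of "src e" v] v by simp
        moreover have "tgt e \<notin> block P v" using e D st(2)[OF e(1)] eq_iff[of "tgt e" v] v by simp
        ultimately show ?thesis using choice.IH[of "src e" "tgt e"] st(3)[OF e(1)] D[OF e(1)] by simp
      qed
      then have "card {e. e < m \<and> S e = blk v \<and> D e \<noteq> blk v} \<le> card {e. e < m \<and> S e = blk v \<and> D e \<in> L}"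
        by (intro card_mono) auto
      then show ?case using closed blk_lt[OF v] cv unfolding threshold_closed_def by auto
    next
      case (chance v w)
      have v: "v < n" using chance.hyps n P by (auto simp: is_mdp_def)
      have b: "block P v = {v}" using chance.hyps by (simp add: block_not_MEC)
      have "v \<notin> player1 P" using chance.hyps P by (auto simp: is_mdp_def)
      then have cv: "c (blk v) = 1"
        using c[OF blk_lt[OF v]] kind_blk[OF v] blk_T[OF v] chance.hyps b by auto
      obtain e where e: "e < m" "src e = v" "tgt e = w" using chance.hyps edges by blast
      then have "e \<in> {e. e < m \<and> S e = blk v \<and> D e \<in> L}" using S D chance.IH by simp
      then have "card {e. e < m \<and> S e = blk v \<and> D e \<in> L} > 0"
        by (subst card_gt_0_iff) auto
      then show ?case using closed blk_lt[OF v] cv unfolding threshold_closed_def by auto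
    qed
  }
  \<comment> \<open>Numbers that represent no block belong to \<open>X\<close> vacuously. They have
    to: a component vertex other than the representative has no edges counted for it, so its
    threshold is zero and it enters \<open>L\<close>.\<close>
  define X where "X = {b. \<forall>v<n. blk v = b \<longrightarrow> v \<in> losing P T}"
  have "threshold_closed n m S D c X"
    unfolding threshold_closed_def
  proof (intro allI impI, rule ccontr)
    fix b assume b: "b < n" and le: "c b \<le> card {e. e < m \<and> S e = b \<and> D e \<in> X}" and nX: "b \<notin> X"
    from nX obtain v where v: "v < n" "blk v = b" "v \<notin> losing P T" by (auto simp: X_def)
    \<comment> \<open>As \<open>b\<close> is not in \<open>X\<close>, edges from \<open>b\<close>
      into \<open>X\<close> leave the block.\<close>
    have sub: "{e. e < m \<and> S e = b \<and> D e \<in> X} \<subseteq> {e. e < m \<and> S e = b \<and> D e \<noteq> b}" using nX by auto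
    have "card {e. e < m \<and> S e = b \<and> D e \<in> X} \<le> card {..<m}" by (intro card_mono) auto
    then have nT: "b \<notin> blk ` T" using le c[OF b] by (auto split: if_splits)
    then have disj: "block P v \<inter> T = {}" using blk_T[OF v(1)] v by auto
    show False
    proof (cases "0 < kind b")
      case True
      \<comment> \<open>The threshold counts all exits, so the exits into \<open>X\<close>, being at
        least as many, are all of them.\<close>
      then have "{e. e < m \<and> S e = b \<and> D e \<in> X} = {e. e < m \<and> S e = b \<and> D e \<noteq> b}"
        using le c[OF b] nT by (intro card_seteq sub) auto
      then have exits: "D e \<in> X" if "e < m" "S e = b" "D e \<noteq> b" for e using that by blast
      have "v \<in> losing P T"
      proof (rule losing.choice)
        show "v \<in> verts P" using v n by simp
        show "v \<in> player1 P \<or> v \<in> \<Union>(MECs P)" using kind_blk[OF v(1)] True v by simp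
        show "block P v \<inter> T = {}" by (rule disj)
        fix u w assume uw: "u \<in> block P v" "(u, w) \<in> edges P" "w \<notin> block P v"
        then obtain e where e: "e < m" "src e = u" "tgt e = w" using edges by blast
        then have "S e = b" "D e \<noteq> b" using S D uw v eq_iff[of u v] eq_iff[of w v] st[OF e(1)] by auto
        with exits e have "D e \<in> X" by simp
        then show "w \<in> losing P T" using e D st[OF e(1)] by (auto simp: X_def)
      qed
      with v show False by simp
    next
      case False
      then have "card {e. e < m \<and> S e = b \<and> D e \<in> X} > 0" using le c[OF b] nT by simp
      then obtain e where e: "e < m" "S e = b" "D e \<in> X"
        by (subst (asm) card_gt_0_iff) auto
      have nM: "v \<notin> \<Union>(MECs P)" "v \<notin> player1 P" using kind_blk[OF v(1)] False v by auto
      then have bv: "block P v = {v}" by (simp add: block_not_MEC)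
      have "src e \<in> block P v" using e S v eq_iff[of "src e" v] st[OF e(1)] by simp
      then have "src e = v" using bv by simp
      moreover have "tgt e \<in> losing P T" using e D st[OF e(1)] by (auto simp: X_def)
      moreover have "v \<in> random P" using nM v n P by (auto simp: is_mdp_def)
      ultimately have "v \<in> losing P T"
        using losing.chance[of v P T "tgt e"] nM disj bv st(3)[OF e(1)] by auto
      with v show False by simp
    qed
  qed
  then have "L \<subseteq> X" by (rule least)
  then show "v \<in> losing P T" if "blk v \<in> L" using that v by (auto simp: X_def)
qed

section \<open>Lists stored by offsets\<close>

abbreviation offset :: "'a list list \<Rightarrow> nat \<Rightarrow> nat" where
  "offset xss i \<equiv> length (concat (take i xss))"

lemma offset_Suc: "i < length xss \<Longrightarrow> offset xss (Suc i) = offset xss i + length (xss ! i)"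
  by (simp add: take_Suc_conv_app_nth)

lemma offset_mono: "i \<le> j \<Longrightarrow> offset xss i \<le> offset xss j"
  by (metis concat_append le_add1 le_add_diff_inverse length_append take_add)

lemma offset_le: "offset xss i \<le> length (concat xss)"
  using offset_mono[of i "max i (length xss)" xss] by simp

lemma offset_unique:
  assumes "offset xss i \<le> p" "p < offset xss (Suc i)" "offset xss j \<le> p" "p < offset xss (Suc j)"
  shows "i = j"
proof (rule linorder_cases[of i j])
  show "i = j" if "i < j" using offset_mono[of "Suc i" j xss] that assms by simp
  show "i = j" if "j < i" using offset_mono[of "Suc j" i xss] that assms by simp
qed

lemma nth_concat_offset:
  assumes "i < length xss" "j < length (xss ! i)"
  shows "concat xss ! (offset xss i + j) = xss ! i ! j"
proof -
  have "concat xss = concat (take i xss) @ xss ! i @ concat (drop (Suc i) xss)"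
    by (metis append_take_drop_id assms(1) concat.simps(2) concat_append id_take_nth_drop)
  then show ?thesis using assms(2) by (simp add: nth_append)
qed

lemma set_nth_offset:
  assumes "i < length xss"
  shows "x \<in> set (xss ! i) \<longleftrightarrow> (\<exists>p. offset xss i \<le> p \<and> p < offset xss (Suc i) \<and> concat xss ! p = x)"
proof
  assume "x \<in> set (xss ! i)"
  then obtain j where "j < length (xss ! i)" "xss ! i ! j = x" by (auto simp: in_set_conv_nth)
  then show "\<exists>p. offset xss i \<le> p \<and> p < offset xss (Suc i) \<and> concat xss ! p = x"
    using assms by (intro exI[of _ "offset xss i + j"]) (simp add: offset_Suc nth_concat_offset)
next
  assume "\<exists>p. offset xss i \<le> p \<and> p < offset xss (Suc i) \<and> concat xss ! p = x"
  then obtain p where p: "offset xss i \<le> p" "p < offset xss (Suc i)" "concat xss ! p = x" by blast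
  then have "p - offset xss i < length (xss ! i)" using assms by (simp add: offset_Suc)
  with nth_concat_offset[OF assms this] p show "x \<in> set (xss ! i)"
    by (metis le_add_diff_inverse nth_mem)
qed

lemma array_of_offsets: "i \<le> length xss \<Longrightarrow> array_of (offsets xss) i = offset xss i"
  by (simp add: array_of_def offsets_def del: upt_Suc)

lemma array_of_nth: "i < length xs \<Longrightarrow> array_of xs i = xs ! i"
  by (simp add: array_of_def)

lemma array_of_offsets_beyond: "length xss < i \<Longrightarrow> array_of (offsets xss) i = 0"
  by (simp add: array_of_def offsets_def)

lemma length_le_length_concat: "[] \<notin> set xss \<Longrightarrow> length xss \<le> length (concat xss)"
proof (induction xss)
  case (Cons xs xss)
  then show ?case by (cases xs) auto
qed simp

lemma edges_eq_adjacency: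
  assumes "is_mdp P" "adjacency_lists P adj"
  shows "(u, w) \<in> edges P \<longleftrightarrow> u < length adj \<and> w \<in> set (adj ! u)"
  using assms by (auto simp: adjacency_lists_def list_of_set_def is_mdp_def)

lemma card_edges_adjacency:
  assumes "is_mdp P" "adjacency_lists P adj"
  shows "card (edges P) = length (concat adj)"
proof -
  have "edges P = (SIGMA v:{..<length adj}. set (adj ! v))"
    using edges_eq_adjacency[OF assms] by auto
  then have "card (edges P) = (\<Sum>v<length adj. card (set (adj ! v)))" by simp
  also have "\<dots> = (\<Sum>v<length adj. length (adj ! v))"
    using assms(2) by (intro sum.cong refl distinct_card) (auto simp: adjacency_lists_def list_of_set_def)
  also have "\<dots> = length (concat adj)"
    by (simp add: length_concat sum_list_sum_nth atLeast0LessThan)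
  finally show ?thesis .
qed

text \<open>A position in the concatenated lists serves as edge number; its source is determined by
  the segment it lies in, since segments are disjoint.\<close>

lemma edges_by_index:
  assumes P: "is_mdp P" and adj: "adjacency_lists P adj"
    and src: "\<And>e. e < length (concat adj) \<Longrightarrow> src e < length adj \<and>
      offset adj (src e) \<le> e \<and> e < offset adj (Suc (src e))"
  shows "(u, w) \<in> edges P \<longleftrightarrow> (\<exists>e<length (concat adj). src e = u \<and> concat adj ! e = w)"
  unfolding edges_eq_adjacency[OF P adj]
proof safe
  assume u: "u < length adj" and "w \<in> set (adj ! u)"
  then obtain p where p: "offset adj u \<le> p" "p < offset adj (Suc u)" "concat adj ! p = w"
    using set_nth_offset[OF u, of w] by blast
  then have "p < length (concat adj)" using offset_le[where xss = adj and i = "Suc u"] by simp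
  moreover have "src p = u" using offset_unique[where xss = adj and i = "src p" and j = u and p = p] src[OF calculation] p by simp
  ultimately show "\<exists>e<length (concat adj). src e = u \<and> concat adj ! e = w" using p by blast
next
  fix e assume e: "e < length (concat adj)"
  show "src e < length adj" using src[OF e] by blast
  then show "concat adj ! e \<in> set (adj ! src e)"
    using src[OF e] set_nth_offset[of "src e" adj "concat adj ! e"] by blast
qed

text \<open>Components are disjoint and nonempty, so their lists are jointly free of repetitions.
  This keeps the labelling phase linear in the number of vertices.\<close>

lemma MEC_lists:
  assumes P: "is_mdp P" and dist: "\<forall>xs\<in>set mecs. distinct xs" "distinct (map set mecs)"
    and mecs: "set (map set mecs) = MECs P"
  shows "length (concat mecs) \<le> card (verts P)" and "length mecs \<le> card (verts P)"
    and "set (concat mecs) = \<Union>(MECs P)"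
    and "i < length mecs \<Longrightarrow> set (mecs ! i) \<in> MECs P"
proof -
  show un: "set (concat mecs) = \<Union>(MECs P)" using mecs by (auto simp flip: mecs)
  show MEC: "set (mecs ! i) \<in> MECs P" if "i < length mecs" for i
    using that by (auto simp flip: mecs)
  have "distinct (concat mecs)"
  proof (rule distinct_concat)
    show "distinct mecs" using dist(2) by (simp add: distinct_map)
    fix xs ys assume "xs \<in> set mecs" "ys \<in> set mecs" "xs \<noteq> ys"
    moreover from this have "set xs \<noteq> set ys" using dist(2) by (auto simp: distinct_map inj_on_def)
    moreover from calculation have "set xs \<in> MECs P" "set ys \<in> MECs P" by (auto simp flip: mecs)
    ultimately show "set xs \<inter> set ys = {}" using MECs_disjoint by blast
  qed (use dist in auto)
  then have "length (concat mecs) = card (\<Union>(MECs P))" using distinct_card un by metis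
  moreover have "\<dots> \<le> card (verts P)"
    using P MEC_subset_verts by (intro card_mono) (auto simp: is_mdp_def)
  ultimately show "length (concat mecs) \<le> card (verts P)" by simp
  moreover have "[] \<notin> set mecs"
  proof
    assume "[] \<in> set mecs"
    then have "{} \<in> MECs P" by (force simp flip: mecs)
    then show False using MEC_nonempty by blast
  qed
  ultimately show "length mecs \<le> card (verts P)" using length_le_length_concat[of mecs] by simp
qed

text \<open>By disjointness the component found for a vertex is the only one containing it, so all
  vertices of a component receive the same label, the first element of its list.\<close>

lemma block_labelling_MEC_lists:
  assumes P: "is_mdp P" and n: "verts P = {..<n}"
    and dist: "\<forall>xs\<in>set mecs. distinct xs" "distinct (map set mecs)"
    and mecs: "set (map set mecs) = MECs P"
    and lab: "\<And>v. v < n \<Longrightarrow>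
      (\<forall>p<length (concat mecs). concat mecs ! p \<noteq> v) \<and> blk v = v \<and> kind v = (if v \<in> player1 P then 1 else 0) \<or>
      (\<exists>i<length mecs. \<exists>p<length (concat mecs). concat mecs ! p = v \<and> offset mecs i \<le> p \<and>
         p < offset mecs (Suc i) \<and> blk v = concat mecs ! offset mecs i \<and> kind v = 1)"
  shows "block_labelling P n blk kind"
  unfolding block_labelling_def
proof (intro allI impI)
  note mec = MEC_lists[OF P dist mecs]
  have in_MEC: "blk v = mecs ! i ! 0 \<and> mecs ! i ! 0 \<in> set (mecs ! i) \<and> kind v = 1"
    if i: "i < length mecs" and v: "v \<in> set (mecs ! i)" for i v
  proof -
    have Mi: "set (mecs ! i) \<in> MECs P" using i by (rule mec(4))
    have "v \<in> \<Union>(MECs P)" using v Mi by auto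
    then have "v \<in> set (concat mecs)" using mec(3) by simp
    then obtain q where q: "q < length (concat mecs)" "concat mecs ! q = v" by (meson in_set_conv_nth)
    have "v < n" using v Mi MEC_subset_verts[of _ P] n by auto
    from lab[OF this] q obtain j p where j: "j < length mecs" "concat mecs ! p = v" "offset mecs j \<le> p"
      "p < offset mecs (Suc j)" "blk v = concat mecs ! offset mecs j" "kind v = 1"
      by blast
    then have vj: "v \<in> set (mecs ! j)" using set_nth_offset[OF j(1), of v] by blast
    then have "set (mecs ! i) = set (mecs ! j)" using MECs_disjoint[OF Mi mec(4)[OF j(1)]] v by blast
    then have ij: "i = j" using dist(2) i j(1) by (metis distinct_conv_nth length_map nth_map)
    have "0 < length (mecs ! j)" using vj by (cases "mecs ! j") auto
    with nth_concat_offset[OF j(1), of 0] j ij show ?thesis by simp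
  qed
  fix v assume v: "v < n"
  have "blk v \<in> block P v \<and> (\<forall>u\<in>block P v. blk u = blk v) \<and>
    (0 < kind v \<longleftrightarrow> v \<in> player1 P \<or> v \<in> \<Union>(MECs P))"
  proof (cases "v \<in> \<Union>(MECs P)")
    case True
    then obtain xs where "xs \<in> set mecs" "v \<in> set xs"
      unfolding mec(3)[symmetric] by auto
    then obtain i where i: "i < length mecs" "v \<in> set (mecs ! i)" by (metis in_set_conv_nth)
    have "block P v = set (mecs ! i)" by (rule block_MEC[OF mec(4)[OF i(1)] i(2)])
    then show ?thesis using in_MEC[OF i] in_MEC[OF i(1)] True by auto
  next
    case False
    then have "v \<notin> set (concat mecs)" using mec(3) by simp
    then have "\<forall>p<length (concat mecs). concat mecs ! p \<noteq> v" by (metis nth_mem)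
    then have "blk v = v \<and> kind v = (if v \<in> player1 P then 1 else 0)" using lab[OF v] by blast
    then show ?thesis using False by (auto simp: block_not_MEC)
  qed
  moreover from this have "blk v < n" using block_in_verts[of v P] v n by auto
  ultimately show "blk v < n \<and> blk v \<in> block P v \<and> (\<forall>u\<in>block P v. blk u = blk v) \<and>
    (0 < kind v \<longleftrightarrow> v \<in> player1 P \<or> v \<in> \<Union>(MECs P))" by blast
qed

section \<open>The complete program\<close>

definition prepare :: "com \<Rightarrow> com" where
  "prepare mec = Seq copy_vertices (Seq copy_edges (Seq (shift_com 100 mec)
     (Seq label_MECs (Seq init_counts link_edges))))"

definition query :: com where
  "query = Seq reset_counts (Seq block_targets (Seq fill_queue (Seq attractor (Seq collect_wins (incr 12)))))"

text \<open>The initial test serves the time bound: without vertices m = 0, and k * m + MEC leaves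
  no room for k rounds, however short.\<close>

definition disjunctive_reach :: "com \<Rightarrow> com" where
  "disjunctive_reach mec = Cond (Less (Const 0) (Var 0))
     (Seq (prepare mec) (Seq (Seq (assign 12 (Const 0)) (While (Less (Var 12) (Var 4)) query)) output_wins))
     Skip"

text \<open>What all queries share; none of the arrays involved is written by \<open>query\<close>.
  The source map is existentially quantified because array 20 by then holds blocks instead of
  sources.\<close>

definition prepared :: "nat mdp \<Rightarrow> nat list list \<Rightarrow> state \<Rightarrow> bool" where
  "prepared P adj s \<longleftrightarrow>
     (\<exists>src. (\<forall>u w. (u, w) \<in> edges P \<longleftrightarrow> (\<exists>e<length (concat adj). src e = u \<and> concat adj ! e = w)) \<and>
        (\<forall>e<length (concat adj). s 20 e = s 21 (src e))) \<and>
     block_labelling P (length adj) (s 21) (s 22) \<and>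
     s 24 = last_in (\<lambda>e. s 21 (s 2 e)) (length (concat adj)) \<and>
     (\<forall>e<length (concat adj). s 25 (Suc e) = last_in (\<lambda>e. s 21 (s 2 e)) e (s 21 (s 2 e))) \<and>
     (\<forall>b<length adj. s 23 b = (if 0 < s 22 b
        then card {e. e < length (concat adj) \<and> s 20 e = b \<and> s 21 (s 2 e) \<noteq> b} else 1))"

lemma writes_copy_vertices: "writes copy_vertices = {10, 101, 103, 21, 22, 14, 100}"
  by (auto simp: copy_vertices_def copy_vertex_def)

lemma writes_copy_edges: "writes copy_edges = {10, 11, 20, 102}"
  by (auto simp: copy_edges_def copy_edge_def)

lemma writes_label_MECs: "writes label_MECs = {18, 13, 21, 22}"
  by (auto simp: label_MECs_def label_vertex_def)

lemma writes_init_counts: "writes init_counts = {10, 23}"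
  by (auto simp: init_counts_def)

lemma writes_link_edges: "writes link_edges = {11, 20, 25, 24, 23}"
  by (auto simp: link_edges_def link_edge_def)

lemma writes_reset_counts: "writes reset_counts = {10, 26}"
  by (auto simp: reset_counts_def)

lemma writes_block_targets: "writes block_targets = {13, 26}"
  by (auto simp: block_targets_def)

lemma writes_fill_queue: "writes fill_queue = {16, 10, 27}"
  by (auto simp: fill_queue_def)

lemma writes_attractor: "writes attractor = {15, 17, 26, 27, 16}"
  by (auto simp: attractor_def attractor_step_def)

lemma writes_collect_wins: "writes collect_wins = {10, 28}"
  by (auto simp: collect_wins_def)

lemmas writes_phases = writes_copy_vertices writes_copy_edges writes_label_MECs writes_init_counts
  writes_link_edges writes_reset_counts writes_block_targets writes_fill_queue writes_attractor
  writes_collect_wins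

lemma query_input_arrays:
  "query_input P adj ts 0 = array_of [length adj]" "query_input P adj ts (Suc 0) = array_of (offsets adj)"
  "query_input P adj ts 2 = array_of (concat adj)"
  "query_input P adj ts 3 = (\<lambda>v. if v \<in> player1 P then 1 else 0)"
  "query_input P adj ts 4 = array_of [length ts]" "query_input P adj ts 5 = array_of (offsets ts)"
  "query_input P adj ts 6 = array_of (concat ts)"
  "6 < a \<Longrightarrow> query_input P adj ts a = (\<lambda>_. 0)"
  by (auto simp: query_input_def mdp_input_def store_lists_def)

lemma mdp_input_arrays:
  "mdp_input P adj 0 = array_of [length adj]" "mdp_input P adj (Suc 0) = array_of (offsets adj)"
  "mdp_input P adj 2 = array_of (concat adj)"
  "mdp_input P adj 3 = (\<lambda>v. if v \<in> player1 P then 1 else 0)"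
  "3 < a \<Longrightarrow> mdp_input P adj a = (\<lambda>_. 0)"
  by (auto simp: mdp_input_def store_lists_def)

text \<open>Yields \<open>1 \<le> MEC P\<close>, which absorbs the additive constant in the final
  bound.\<close>

lemma exec_pos: "exec c s t s' \<Longrightarrow> 0 < t"
  by (induction rule: exec.induct) auto

lemma terminates_shift_MECs:
  assumes mec: "computes_MECs mec MEC"
    and P: "is_mdp P" "card (verts P) \<le> card (edges P)" "adjacency_lists P adj"
    and s: "(\<lambda>a. s (a + 100)) = mdp_input P adj"
  shows "terminates (shift_com 100 mec) s (MEC P) (\<lambda>s'. \<exists>mecs.
    s' 107 0 = length mecs \<and> (\<forall>i\<le>length mecs. s' 108 i = offset mecs i) \<and>
    (\<forall>p<length (concat mecs). s' 109 p = concat mecs ! p) \<and>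
    (\<forall>xs\<in>set mecs. distinct xs) \<and> distinct (map set mecs) \<and> set (map set mecs) = MECs P)"
proof -
  from mec P obtain t r mecs where ex: "exec mec (mdp_input P adj) t r" "t \<le> MEC P"
    and holds: "holds_lists r 7 mecs"
    and mecs: "\<forall>xs\<in>set mecs. distinct xs" "distinct (map set mecs)" "set (map set mecs) = MECs P"
    unfolding computes_MECs_def by blast
  from exec_shift[of mec s 100 t r] ex s obtain s' where s': "exec (shift_com 100 mec) s t s'"
    "(\<lambda>a. s' (a + 100)) = r" by auto
  have r: "r 7 = s' 107" "r 8 = s' 108" "r 9 = s' 109" using s'(2) by (auto simp flip: s'(2))
  have off: "s' 108 i = offset mecs i" if "i \<le> length mecs" for i
    using holds that array_of_offsets[OF that] r
    by (simp add: holds_lists_def holds_list_def array_of_def offsets_def del: upt_Suc)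
  show ?thesis unfolding terminates_def
    using s'(1) ex(2) mecs holds off r
    by (intro exI[of _ t] exI[of _ s'] conjI exI[of _ mecs]) (auto simp: holds_lists_def holds_list_def)
qed

lemma dead_end_iff:
  assumes P: "is_mdp P" and adj: "adjacency_lists P adj"
  shows "(\<exists>v<length adj. v \<in> player1 P \<and> \<not> offset adj v < offset adj (Suc v)) \<longleftrightarrow> \<not> no_dead_ends P"
proof -
  have "v < length adj" if "v \<in> player1 P" for v
    using P adj that by (auto simp: is_mdp_def adjacency_lists_def)
  moreover have "\<not> offset adj v < offset adj (Suc v) \<longleftrightarrow> (\<forall>w. (v, w) \<notin> edges P)" if "v < length adj" for v
    using that edges_eq_adjacency[OF P adj] by (simp add: offset_Suc)
  ultimately show ?thesis unfolding no_dead_ends_def by blast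
qed

text \<open>The bound adds up the phases: m with 6 + 8, n with 10 + 6 + 12 + 3, and constants 4 + 3
  + 3 + 2 + 2.\<close>

lemma terminates_prepare:
  fixes P :: "nat mdp" and ts :: "nat list list"
  assumes mec: "computes_MECs mec MEC"
    and P: "is_mdp P" "card (verts P) \<le> card (edges P)" "adjacency_lists P adj"
  defines "s0 \<equiv> query_input P adj ts"
  shows "terminates (prepare mec) s0 (14 * card (edges P) + 31 * card (verts P) + 14 + MEC P) (\<lambda>s.
    prepared P adj s \<and> (\<forall>a\<le>8. s a = s0 a) \<and> s 28 = (\<lambda>_. 0) \<and>
    (s 14 0 = 0 \<longleftrightarrow> no_dead_ends P))"
proof -
  define n where "n = length adj"
  define m where "m = length (concat adj)"
  have verts: "verts P = {..<n}" using P(3) by (simp add: adjacency_lists_def n_def)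
  have cm: "card (edges P) = m" using card_edges_adjacency[OF P(1,3)] by (simp add: m_def)
  have cn: "card (verts P) = n" by (simp add: verts)
  have i0: "s0 0 0 = n" by (simp add: s0_def query_input_arrays array_of_def n_def)
  have i1: "s0 (Suc 0) v = offset adj v" if "v \<le> n" for v
    using that by (simp add: s0_def query_input_arrays array_of_offsets n_def)
  have i2: "s0 2 e = concat adj ! e" if "e < m" for e
    using that by (simp add: s0_def query_input_arrays array_of_nth m_def)
  have i3: "s0 3 v = (if v \<in> player1 P then 1 else 0)" for v by (simp add: s0_def query_input_arrays)
  have i7: "s0 a = (\<lambda>_. 0)" if "6 < a" for a using that by (simp add: s0_def query_input_arrays)
  have off: "s0 (Suc 0) 0 = 0" "s0 (Suc 0) n = m" using i1[of 0] i1[of n] by (auto simp: n_def m_def)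
  show ?thesis unfolding prepare_def
  proof (rule terminates_weaken)
    show "terminates (Seq copy_vertices (Seq copy_edges (Seq (shift_com 100 mec)
        (Seq label_MECs (Seq init_counts link_edges))))) s0
      ((10 * n + 4) + ((6 * (m + n) + 3) + (MEC P + ((6 * (n + n) + 3) + ((3 * n + 2) + (8 * m + 2)))))) (\<lambda>s.
        prepared P adj s \<and> (\<forall>a\<le>8. s a = s0 a) \<and> s 28 = (\<lambda>_. 0) \<and> (s 14 0 = 0 \<longleftrightarrow> no_dead_ends P))"
    proof (rule terminates_Seq[OF terminates_copy_vertices[where n = n]])
      fix s1 assume s1: "s1 100 = (\<lambda>_. 0)(0 := n) \<and> s1 101 = (\<lambda>v. if v \<le> n then s0 1 v else 0) \<and>
        s1 103 = (\<lambda>v. if v < n then s0 3 v else 0) \<and> (\<forall>v<n. s1 21 v = v \<and> s1 22 v = s0 3 v) \<and>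
        s1 14 0 = (if \<exists>v<n. 0 < s0 3 v \<and> \<not> s0 1 v < s0 1 (Suc v) then 1 else 0)"
        and "agree (writes copy_vertices) s0 s1"
      then have ag1: "\<And>a. a \<notin> {10, 101, 103, 21, 22, 14, 100} \<Longrightarrow> s1 a = s0 a"
        by (simp add: agree_def writes_phases)
      have dead: "s1 14 0 = 0 \<longleftrightarrow> no_dead_ends P"
        using s1 dead_end_iff[OF P(1,3)] i1 unfolding i3 n_def[symmetric] by (auto split: if_splits)
      show "terminates (Seq copy_edges (Seq (shift_com 100 mec) (Seq label_MECs (Seq init_counts link_edges)))) s1
        ((6 * (m + n) + 3) + (MEC P + ((6 * (n + n) + 3) + ((3 * n + 2) + (8 * m + 2))))) (\<lambda>s.
        prepared P adj s \<and> (\<forall>a\<le>8. s a = s0 a) \<and> s 28 = (\<lambda>_. 0) \<and> (s 14 0 = 0 \<longleftrightarrow> no_dead_ends P))"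
      proof (rule terminates_Seq[OF terminates_copy_edges[where n = n]])
        fix s2 assume s2: "s2 102 = (\<lambda>e. if e < m then s1 2 e else 0) \<and>
          (\<forall>e<m. s2 20 e < n \<and> s1 1 (s2 20 e) \<le> e \<and> e < s1 1 (Suc (s2 20 e)))"
          and "agree (writes copy_edges) s1 s2"
        then have ag2: "\<And>a. a \<notin> {10, 11, 20, 102} \<Longrightarrow> s2 a = s1 a"
          by (simp add: agree_def writes_phases)
        define src where "src = s2 20"
        have src: "src e < n \<and> offset adj (src e) \<le> e \<and> e < offset adj (Suc (src e))" if "e < m" for e
          using s2 that i1 by (auto simp: src_def ag1)
        have edges: "(u, w) \<in> edges P \<longleftrightarrow> (\<exists>e<m. src e = u \<and> concat adj ! e = w)" for u w
          unfolding m_def by (rule edges_by_index[OF P(1,3)]) (use src in \<open>auto simp: m_def n_def\<close>)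
        \<comment> \<open>The component program is specified only for this exact state, so the copy
          must agree in all arrays and at all indices, including the zeros beyond the lists.\<close>
        have mdp: "(\<lambda>a. s2 (a + 100)) = mdp_input P adj"
        proof
          fix a :: nat
          consider "a = 0" | "a = 1" | "a = 2" | "a = 3" | "3 < a" by linarith
          then show "s2 (a + 100) = mdp_input P adj a"
          proof cases
            case 1
            then show ?thesis using s1 ag2[of 100]
              by (auto simp: mdp_input_arrays array_of_def fun_eq_iff n_def)
          next
            case 2
            then show ?thesis using s1 ag2[of 101] i1 array_of_offsets[of _ adj] array_of_offsets_beyond[of adj]
              by (auto simp: mdp_input_arrays fun_eq_iff n_def)
          next
            case 3
            then show ?thesis using s2 i2 ag1[of 2]
              by (auto simp: mdp_input_arrays fun_eq_iff m_def array_of_def)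
          next
            case 4
            have "player1 P \<subseteq> {..<n}" using P(1) verts by (auto simp: is_mdp_def)
            then show ?thesis using 4 s1 ag2[of 103] i3 by (auto simp: mdp_input_arrays fun_eq_iff)
          next
            case 5
            then have "s2 (a + 100) = s0 (a + 100)" using ag1[of "a + 100"] ag2[of "a + 100"] by auto
            then show ?thesis using 5 i7[of "a + 100"] by (simp add: mdp_input_arrays)
          qed
        qed
        show "terminates (Seq (shift_com 100 mec) (Seq label_MECs (Seq init_counts link_edges))) s2
          (MEC P + ((6 * (n + n) + 3) + ((3 * n + 2) + (8 * m + 2)))) (\<lambda>s.
          prepared P adj s \<and> (\<forall>a\<le>8. s a = s0 a) \<and> s 28 = (\<lambda>_. 0) \<and> (s 14 0 = 0 \<longleftrightarrow> no_dead_ends P))"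
        proof (rule terminates_Seq[OF terminates_shift_MECs[OF mec P mdp]], elim exE conjE)
          fix s3 mecs assume s3: "s3 107 0 = length mecs" "\<forall>i\<le>length mecs. s3 108 i = offset mecs i"
            "\<forall>p<length (concat mecs). s3 109 p = concat mecs ! p"
            and mecs: "\<forall>xs\<in>set mecs. distinct xs" "distinct (map set mecs)" "set (map set mecs) = MECs P"
            and "agree (writes (shift_com 100 mec)) s2 s3"
          then have ag3: "\<And>a. a < 100 \<Longrightarrow> s3 a = s2 a"
            using writes_shift[of 100 mec] by (auto simp: agree_def subset_iff)
          note ml = MEC_lists[OF P(1) mecs]
          define t where "t = length (concat mecs)"
          have t: "t \<le> n" "length mecs \<le> n" using ml(1,2) cn by (auto simp: t_def)
          have off3: "s3 108 0 = 0" "s3 108 (length mecs) = t" using s3(2) by (auto simp: t_def)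
          have "terminates label_MECs s3 (6 * (n + n) + 3) (\<lambda>s. \<forall>v.
            (\<forall>p<t. s3 109 p \<noteq> v) \<and> s 21 v = s3 21 v \<and> s 22 v = s3 22 v \<or>
            (\<exists>i<length mecs. \<exists>p<t. s3 109 p = v \<and> s3 108 i \<le> p \<and> p < s3 108 (Suc i) \<and>
               s 21 v = s3 109 (s3 108 i) \<and> s 22 v = 1))"
            by (rule terminates_weaken[OF terminates_label_MECs[where ?s0.0 = s3, OF s3(1) off3]]) (use t in auto)
          then show "terminates (Seq label_MECs (Seq init_counts link_edges)) s3
            ((6 * (n + n) + 3) + ((3 * n + 2) + (8 * m + 2))) (\<lambda>s.
            prepared P adj s \<and> (\<forall>a\<le>8. s a = s0 a) \<and> s 28 = (\<lambda>_. 0) \<and> (s 14 0 = 0 \<longleftrightarrow> no_dead_ends P))"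
          proof (rule terminates_Seq)
            fix s4 assume lab: "\<forall>v.
              (\<forall>p<t. s3 109 p \<noteq> v) \<and> s4 21 v = s3 21 v \<and> s4 22 v = s3 22 v \<or>
              (\<exists>i<length mecs. \<exists>p<t. s3 109 p = v \<and> s3 108 i \<le> p \<and> p < s3 108 (Suc i) \<and>
                 s4 21 v = s3 109 (s3 108 i) \<and> s4 22 v = 1)"
              and "agree (writes label_MECs) s3 s4"
            then have ag4: "\<And>a. a \<notin> {18, 13, 21, 22} \<Longrightarrow> s4 a = s3 a"
              by (simp add: agree_def writes_phases)
            have old: "s3 21 v = v" "s3 22 v = (if v \<in> player1 P then 1 else 0)" if "v < n" for v
              using s1 that by (auto simp: ag3 ag2 i3)
            have lab': "(\<forall>p<t. concat mecs ! p \<noteq> v) \<and> s4 21 v = v \<and> s4 22 v = (if v \<in> player1 P then 1 else 0) \<or>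
              (\<exists>i<length mecs. \<exists>p<t. concat mecs ! p = v \<and> offset mecs i \<le> p \<and> p < offset mecs (Suc i) \<and>
                 s4 21 v = concat mecs ! offset mecs i \<and> s4 22 v = 1)" if v: "v < n" for v
              using lab[rule_format, of v]
            proof (elim disjE exE conjE)
              fix i p assume ip: "i < length mecs" "p < t" "s3 109 p = v" "s3 108 i \<le> p" "p < s3 108 (Suc i)"
                "s4 21 v = s3 109 (s3 108 i)" "s4 22 v = 1"
              have "s3 108 i = offset mecs i" "s3 108 (Suc i) = offset mecs (Suc i)" using s3(2) ip(1) by auto
              moreover from this have "s3 109 (s3 108 i) = concat mecs ! offset mecs i"
                using s3(3) ip by (simp add: t_def)
              moreover have "s3 109 p = concat mecs ! p" using s3(3) ip by (simp add: t_def)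
              ultimately show ?thesis using ip by (intro disjI2 exI[of _ i] exI[of _ p] conjI) simp_all
            qed (use s3(3) old[OF v] in \<open>auto simp: t_def\<close>)
            have blk: "block_labelling P n (s4 21) (s4 22)"
              by (rule block_labelling_MEC_lists[OF P(1) verts mecs lab'[unfolded t_def]])
            have kind: "s4 22 v \<le> 1" if "v < n" for v using lab'[OF that] by (auto split: if_splits)
            have fr4: "s4 0 = s0 0" "s4 (Suc 0) = s0 (Suc 0)" "s4 2 = s0 2" "s4 20 = src" "s4 24 = s0 24"
              by (simp_all add: ag4 ag3 ag2 ag1 src_def)
            show "terminates (Seq init_counts link_edges) s4 ((3 * n + 2) + (8 * m + 2)) (\<lambda>s.
              prepared P adj s \<and> (\<forall>a\<le>8. s a = s0 a) \<and> s 28 = (\<lambda>_. 0) \<and> (s 14 0 = 0 \<longleftrightarrow> no_dead_ends P))"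
            proof (rule terminates_Seq[OF terminates_init_counts])
              fix s5 assume s5: "\<forall>v<n. s5 23 v = 1 - s4 22 v" and "agree (writes init_counts) s4 s5"
              then have ag5: "\<And>a. a \<notin> {10, 23} \<Longrightarrow> s5 a = s4 a"
                by (simp add: agree_def writes_phases)
              have fr5: "s5 0 = s0 0" "s5 (Suc 0) = s0 (Suc 0)" "s5 2 = s0 2" "s5 20 = src" "s5 24 = s0 24"
                "s5 21 = s4 21" "s5 22 = s4 22"
                using fr4 by (simp_all add: ag5)
              show "terminates link_edges s5 (8 * m + 2) (\<lambda>s.
                prepared P adj s \<and> (\<forall>a\<le>8. s a = s0 a) \<and> s 28 = (\<lambda>_. 0) \<and> (s 14 0 = 0 \<longleftrightarrow> no_dead_ends P))"
              proof (rule terminates_weaken[OF terminates_link_edges[where n = n]])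
                fix s
                assume s6: "(\<forall>e<m. s 20 e = s5 21 (s5 20 e)) \<and>
                  s 24 = last_in (\<lambda>e. s5 21 (s5 2 e)) m \<and>
                  (\<forall>e<m. s 25 (Suc e) = last_in (\<lambda>e. s5 21 (s5 2 e)) e (s5 21 (s5 2 e))) \<and>
                  (\<forall>b. s 23 b = s5 23 b + (if 0 < s5 22 b then
                     card {e. e < m \<and> s5 21 (s5 20 e) = b \<and> s5 21 (s5 2 e) \<noteq> b} else 0))"
                  and "agree (writes link_edges) s5 s"
                then have ag6: "\<And>a. a \<notin> {11, 20, 25, 24, 23} \<Longrightarrow> s a = s5 a"
                  by (simp add: agree_def writes_phases)
                have fr6: "s 2 = s0 2" "s 21 = s4 21" "s 22 = s4 22" using fr5 by (simp_all add: ag6)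
                have low: "s a = s0 a" if "a \<le> 8" for a
                  using that by (simp add: ag6 ag5 ag4 ag3 ag2 ag1)
                have "s 28 = s0 28" "s 14 = s1 14" by (simp_all add: ag6 ag5 ag4 ag3 ag2 ag1)
                then have "s 28 = (\<lambda>_. 0)" "s 14 0 = 0 \<longleftrightarrow> no_dead_ends P" using i7[of 28] dead by simp_all
                moreover have "prepared P adj s"
                  unfolding prepared_def n_def[symmetric] m_def[symmetric]
                proof (intro conjI)
                  have "\<forall>e<m. s 20 e = s 21 (src e)" using s6 by (simp add: fr5 fr6)
                  then show "\<exists>src. (\<forall>u w. (u, w) \<in> edges P \<longleftrightarrow> (\<exists>e<m. src e = u \<and> concat adj ! e = w)) \<and>
                    (\<forall>e<m. s 20 e = s 21 (src e))" using edges by blast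
                  show "block_labelling P n (s 21) (s 22)" using blk by (simp add: fr6)
                  show "s 24 = last_in (\<lambda>e. s 21 (s 2 e)) m"
                    "\<forall>e<m. s 25 (Suc e) = last_in (\<lambda>e. s 21 (s 2 e)) e (s 21 (s 2 e))"
                    using s6 by (simp_all add: fr5 fr6)
                  show "\<forall>b<n. s 23 b = (if 0 < s 22 b
                    then card {e. e < m \<and> s 20 e = b \<and> s 21 (s 2 e) \<noteq> b} else 1)"
                  proof (intro allI impI)
                    fix b assume b: "b < n"
                    have "{e. e < m \<and> s 20 e = b \<and> s 21 (s 2 e) \<noteq> b} =
                      {e. e < m \<and> s5 21 (s5 20 e) = b \<and> s5 21 (s5 2 e) \<noteq> b}"
                      using s6 by (auto simp: fr5 fr6)
                    then show "s 23 b = (if 0 < s 22 b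
                      then card {e. e < m \<and> s 20 e = b \<and> s 21 (s 2 e) \<noteq> b} else 1)"
                      using s6 s5 b kind[OF b] by (auto simp: fr5 fr6)
                  qed
                qed
                ultimately show "prepared P adj s \<and> (\<forall>a\<le>8. s a = s0 a) \<and> s 28 = (\<lambda>_. 0) \<and>
                  (s 14 0 = 0 \<longleftrightarrow> no_dead_ends P)" using low by blast
              qed (use fr5 i0 off i7 in auto)
            qed (use fr4 i0 in auto)
          qed
        qed
      qed (use i0 off i7 ag1 in auto)
    qed (use i0 i7 in auto)
  qed (auto simp: cm cn)
qed


lemma terminates_query:
  assumes P: "is_mdp P" "adjacency_lists P adj"
    and ts: "list_all2 list_of_set ts Ts" "\<forall>T\<in>set Ts. T \<subseteq> verts P"
    and prep: "prepared P adj s" and inp: "\<forall>a\<le>8. s a = query_input P adj ts a"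
    and i: "s 12 0 = i" "i < length Ts"
  shows "terminates query s (14 * card (edges P) + 31 * card (verts P) + 13) (\<lambda>s'.
    s' 12 0 = Suc i \<and>
    (\<forall>v<length adj. 0 < s' 28 v \<longleftrightarrow> 0 < s 28 v \<or> v \<notin> losing P (Ts ! i)))"
proof -
  define n where "n = length adj"
  define m where "m = length (concat adj)"
  define T where "T = Ts ! i"
  have verts: "verts P = {..<n}" using P(2) by (simp add: adjacency_lists_def n_def)
  have cm: "card (edges P) = m" using card_edges_adjacency[OF P] by (simp add: m_def)
  have cn: "card (verts P) = n" by (simp add: verts)
  have len: "length ts = length Ts" using ts(1) by (rule list_all2_lengthD)
  have Ti: "distinct (ts ! i)" "set (ts ! i) = T"
    using list_all2_nthD2[OF ts(1) i(2)] by (auto simp: list_of_set_def T_def)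
  have T: "T \<subseteq> verts P" using ts(2) i(2) by (auto simp: T_def)
  have n0: "s 0 0 = n" using inp by (simp add: query_input_arrays array_of_def n_def)
  have m0: "s (Suc 0) n = m" using inp by (simp add: query_input_arrays array_of_offsets n_def m_def)
  have i2: "s 2 e = concat adj ! e" if "e < m" for e
    using inp that by (simp add: query_input_arrays array_of_nth m_def)
  have i5: "s 5 j = offset ts j" if "j \<le> length Ts" for j
    using inp that by (simp add: query_input_arrays array_of_offsets len)
  have i6: "s 6 p = concat ts ! p" if "p < length (concat ts)" for p
    using inp that by (simp add: query_input_arrays array_of_nth)
  have toff: "s 5 i = offset ts i" "s 5 (Suc i) = offset ts i + length (ts ! i)"
    using i5[of i] i5[of "Suc i"] i(2) by (simp_all add: offset_Suc len)
  \<comment> \<open>Targets are listed without repetition, so one query scans at most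
    \<open>n\<close> of them.\<close>
  have len_T: "length (ts ! i) \<le> n"
    using distinct_card[OF Ti(1)] card_mono[OF _ T] verts Ti(2) by simp
  have target: "(\<exists>p. s 5 i \<le> p \<and> p < s 5 (Suc i) \<and> s 21 (s 6 p) = b) \<longleftrightarrow> b \<in> s 21 ` T" for b
  proof -
    have eq5: "s 5 i = offset ts i" "s 5 (Suc i) = offset ts (Suc i)" using i5 i(2) by auto
    have "s 6 p = concat ts ! p" if "p < offset ts (Suc i)" for p
      using that offset_le[where xss = ts and i = "Suc i"] i6[of p] by simp
    then have "(\<exists>p. s 5 i \<le> p \<and> p < s 5 (Suc i) \<and> s 6 p = t) \<longleftrightarrow>
        (\<exists>p. offset ts i \<le> p \<and> p < offset ts (Suc i) \<and> concat ts ! p = t)" for t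
      unfolding eq5 by metis
    moreover have "(\<exists>p. offset ts i \<le> p \<and> p < offset ts (Suc i) \<and> concat ts ! p = t) \<longleftrightarrow> t \<in> T" for t
      using set_nth_offset[of i ts t] Ti(2) i(2) len by simp
    ultimately have mem: "(\<exists>p. s 5 i \<le> p \<and> p < s 5 (Suc i) \<and> s 6 p = t) \<longleftrightarrow> t \<in> T" for t by metis
    have "T = s 6 ` {p. s 5 i \<le> p \<and> p < s 5 (Suc i)}"
    proof (rule set_eqI)
      fix t show "t \<in> T \<longleftrightarrow> t \<in> s 6 ` {p. s 5 i \<le> p \<and> p < s 5 (Suc i)}"
        using mem[of t] by blast
    qed
    then show ?thesis by auto
  qed
  obtain src where src: "\<And>u w. (u, w) \<in> edges P \<longleftrightarrow> (\<exists>e<m. src e = u \<and> concat adj ! e = w)"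
    "\<And>e. e < m \<Longrightarrow> s 20 e = s 21 (src e)"
    using prep unfolding prepared_def m_def by blast
  define S where "S = s 20"
  define D where "D = (\<lambda>e. s 21 (s 2 e))"
  have lab: "block_labelling P n (s 21) (s 22)"
    and head: "s 24 = last_in D m" and nxt: "\<And>e. e < m \<Longrightarrow> s 25 (Suc e) = last_in D e (D e)"
    and c0: "\<And>b. b < n \<Longrightarrow> s 23 b = (if 0 < s 22 b then card {e. e < m \<and> S e = b \<and> D e \<noteq> b} else 1)"
    using prep unfolding prepared_def n_def m_def S_def D_def by auto
  have src_lt: "src e < n" if "e < m" for e
  proof -
    have "(src e, concat adj ! e) \<in> edges P" using src(1) that by blast
    then show ?thesis using P(1) verts by (auto simp: is_mdp_def)
  qed
  have S_lt: "S e < n" if "e < m" for e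
    using lab src_lt[OF that] src(2)[OF that] by (simp add: block_labelling_def S_def)
  show ?thesis unfolding query_def
  proof (rule terminates_weaken)
    let ?Q = "\<lambda>s'. s' 12 0 = Suc i \<and> (\<forall>v<n. 0 < s' 28 v \<longleftrightarrow> 0 < s 28 v \<or> v \<notin> losing P T)"
    show "terminates (Seq reset_counts (Seq block_targets (Seq fill_queue (Seq attractor
        (Seq collect_wins (incr 12)))))) s
      ((3 * n + 2) + ((3 * n + 2) + ((6 * n + 3) + ((14 * (m + n) + 3) + ((5 * n + 2) + 1))))) ?Q"
    proof (rule terminates_Seq[OF terminates_reset_counts[where ?s0.0 = s, OF n0]])
      fix s1 assume s1: "\<forall>v<n. s1 26 v = s 23 v" and "agree (writes reset_counts) s s1"
      then have ag1: "\<And>a. a \<notin> {10, 26} \<Longrightarrow> s1 a = s a" by (simp add: agree_def writes_phases)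
      have "terminates block_targets s1 (3 * n + 2) (\<lambda>r. \<forall>b.
        r 26 b = (if \<exists>p. s1 5 i \<le> p \<and> p < s1 5 (Suc i) \<and> s1 21 (s1 6 p) = b then Suc m else s1 26 b))"
        by (rule terminates_weaken[OF terminates_block_targets[where n = n]])
          (use n0 m0 i toff len_T in \<open>auto simp: ag1\<close>)
      then show "terminates (Seq block_targets (Seq fill_queue (Seq attractor (Seq collect_wins (incr 12))))) s1
        ((3 * n + 2) + ((6 * n + 3) + ((14 * (m + n) + 3) + ((5 * n + 2) + 1)))) ?Q"
      proof (rule terminates_Seq)
        fix s2
        assume s2: "\<forall>b. s2 26 b =
            (if \<exists>p. s1 5 i \<le> p \<and> p < s1 5 (Suc i) \<and> s1 21 (s1 6 p) = b then Suc m else s1 26 b)"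
          and "agree (writes block_targets) s1 s2"
        then have ag2: "\<And>a. a \<notin> {13, 26} \<Longrightarrow> s2 a = s1 a" by (simp add: agree_def writes_phases)
        define c where "c = s2 26"
        have c: "c b = (if b \<in> s 21 ` T then Suc m
            else if 0 < s 22 b then card {e. e < m \<and> S e = b \<and> D e \<noteq> b} else 1)" if "b < n" for b
          using s2 s1 that target[of b] c0[OF that] by (simp add: c_def ag1)
        show "terminates (Seq fill_queue (Seq attractor (Seq collect_wins (incr 12)))) s2
          ((6 * n + 3) + ((14 * (m + n) + 3) + ((5 * n + 2) + 1))) ?Q"
        proof (rule terminates_Seq[OF terminates_fill_queue[where n = n]])
          show "s2 0 0 = n" using n0 by (simp add: ag1 ag2)
          fix s3 assume s3: "inj_on (s3 27) {..<s3 16 0} \<and> s3 27 ` {..<s3 16 0} = {b. b < n \<and> s2 26 b = 0}"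
            and "agree (writes fill_queue) s2 s3"
          then have ag3: "\<And>a. a \<notin> {16, 10, 27} \<Longrightarrow> s3 a = s2 a" by (simp add: agree_def writes_phases)
          have s3_26: "s3 26 = c" by (simp add: ag3 c_def)
          show "terminates (Seq attractor (Seq collect_wins (incr 12))) s3
            ((14 * (m + n) + 3) + ((5 * n + 2) + 1)) ?Q"
          proof (rule terminates_Seq[OF terminates_attractor[where n = n and m = m and S = S and D = D]])
            fix s4
            assume s4: "threshold_closed n m S D (s3 26) {b. b < n \<and> s4 26 b = 0} \<and>
              (\<forall>X. threshold_closed n m S D (s3 26) X \<longrightarrow> {b. b < n \<and> s4 26 b = 0} \<subseteq> X)"
              and "agree (writes attractor) s3 s4"
            then have ag4: "\<And>a. a \<notin> {15, 17, 26, 27, 16} \<Longrightarrow> s4 a = s3 a"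
              by (simp add: agree_def writes_phases)
            have win: "0 < s4 26 (s 21 v) \<longleftrightarrow> v \<notin> losing P T" if v: "v < n" for v
            proof -
              have "s 21 v \<in> {b. b < n \<and> s4 26 b = 0} \<longleftrightarrow> v \<in> losing P T"
                by (rule threshold_losing[OF P(1) verts src(1) lab T _ _ c])
                  (use s4 v src(2) i2 in \<open>auto simp: S_def D_def s3_26\<close>)
              moreover have "s 21 v < n" using lab v by (simp add: block_labelling_def)
              ultimately show ?thesis by auto
            qed
            show "terminates (Seq collect_wins (incr 12)) s4 ((5 * n + 2) + 1) ?Q"
            proof (rule terminates_Seq[OF terminates_collect_wins[where n = n]])
              show "s4 0 0 = n" using n0 by (simp add: ag1 ag2 ag3 ag4)
              fix s5 assume s5: "\<forall>v<n. 0 < s5 28 v \<longleftrightarrow> 0 < s4 28 v \<or> 0 < s4 26 (s4 21 v)"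
                and "agree (writes collect_wins) s4 s5"
              then have ag5: "\<And>a. a \<notin> {10, 28} \<Longrightarrow> s5 a = s4 a" by (simp add: agree_def writes_phases)
              have fr: "s4 28 = s 28" "s4 21 = s 21" "s5 12 = s 12" by (simp_all add: ag1 ag2 ag3 ag4 ag5)
              have "?Q (run (incr 12) s5)" using s5 win i by (simp add: fr)
              then show "terminates (incr 12) s5 1 ?Q"
                using terminates_run[of "incr 12" ?Q s5] by simp
            qed
          qed (use s3 src(2) S_lt head nxt in \<open>auto simp: ag1 ag2 ag3 S_def\<close>)
        qed
      qed
    qed
  qed (auto simp: cm cn n_def T_def)
qed

lemma writes_query: "writes query = {10, 26, 13, 16, 27, 15, 17, 28, 12}"
  by (auto simp: query_def writes_phases)

lemma prepared_agree:
  "prepared P adj s \<Longrightarrow> agree (writes query) s s' \<Longrightarrow> prepared P adj s'"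
  by (auto simp: prepared_def agree_def writes_query)

text \<open>With n \<le> m and 1 \<le> m, linear bounds become multiples of m: the preparation 14 +
  31 + 14 = 59, a query 14 + 31 + 13 = 58 and one more for its loop test, the output 6 + 3 = 9. The
  factor 71 covers 59 + 9 and a few single steps.\<close>

lemma disjunctive_reach_correct:
  assumes mec: "computes_MECs mec MEC"
    and P: "is_mdp P" "card (verts P) \<le> card (edges P)" "adjacency_lists P adj"
    and ts: "list_all2 list_of_set ts Ts" "\<forall>T\<in>set Ts. T \<subseteq> verts P"
  shows "terminates (disjunctive_reach mec) (query_input P adj ts)
    (59 * (length Ts * card (edges P)) + 71 * card (edges P) + MEC P + 2) (\<lambda>s. \<exists>xs.
      holds_list s 7 [length xs] \<and> holds_list s 8 xs \<and>
      list_of_set xs (\<Union>i<length Ts. almost_sure P (Reach P (Ts ! i))))"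
    (is "terminates _ ?s0 _ ?Q")
proof -
  define n where "n = length adj"
  define m where "m = card (edges P)"
  have verts: "verts P = {..<n}" using P(3) by (simp add: adjacency_lists_def n_def)
  have nm: "n \<le> m" using P(2) verts by (simp add: m_def)
  have n0: "?s0 0 0 = n" by (simp add: query_input_arrays array_of_def n_def)
  have len: "length ts = length Ts" using ts(1) by (rule list_all2_lengthD)
  let ?win = "\<lambda>k v. \<exists>i<k. v \<notin> losing P (Ts ! i)"
  show ?thesis
  proof (cases "n = 0")
    case True
    then have "almost_sure P \<psi> = {}" for \<psi> using verts by (auto simp: almost_sure_def)
    then have Q: "?Q ?s0" by (intro exI[of _ "[]"]) (simp add: holds_list_def list_of_set_def query_input_arrays)
    have "exec (disjunctive_reach mec) ?s0 (Suc 1) ?s0"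
      unfolding disjunctive_reach_def using True n0 by (intro exec_Cond_False exec_Skip) auto
    with Q show ?thesis unfolding terminates_def by (intro exI[of _ "Suc 1"] exI[of _ ?s0]) simp
  next
    case False
    then have m1: "1 \<le> m" using nm by simp
    let ?loop = "While (Less (Var 12) (Var 4)) query"
    let ?A = "\<lambda>s. prepared P adj s \<and> (\<forall>a\<le>8. s a = ?s0 a) \<and> (s 14 0 = 0 \<longleftrightarrow> no_dead_ends P)"
    have "terminates (Seq (prepare mec) (Seq (Seq (assign 12 (Const 0)) ?loop) output_wins)) ?s0
      ((59 * m + MEC P) + ((59 * (length Ts * m) + 2) + 9 * m)) ?Q"
    proof (rule terminates_Seq)
      show "terminates (prepare mec) ?s0 (59 * m + MEC P) (\<lambda>s. ?A s \<and> s 28 = (\<lambda>_. 0))"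
        by (rule terminates_weaken[OF terminates_prepare[OF mec P]]) (use nm m1 in \<open>auto simp: verts m_def\<close>)
      fix s1 assume s1: "?A s1 \<and> s1 28 = (\<lambda>_. 0)"
      let ?s = "s1(12 := (s1 12)(0 := 0))"
      let ?I = "\<lambda>s. s 12 0 \<le> length Ts \<and> (\<forall>v<n. 0 < s 28 v \<longleftrightarrow> ?win (s 12 0) v)"
      have A: "?A s" if "agree (writes query) ?s s" for s
      proof -
        have "agree (writes query) s1 s" using that by (auto simp: agree_def writes_query)
        then show ?thesis using s1 prepared_agree[of P adj s1 s]
          by (auto simp: agree_def writes_query)
      qed
      have k: "s 4 0 = length Ts" if "?A s" for s
        using that by (simp add: query_input_arrays array_of_def len)
      have "terminates ?loop ?s (Suc (58 * m) * (length Ts - ?s 12 0) + 1)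
        (\<lambda>s. ?I s \<and> \<not> bval (Less (Var 12) (Var 4)) s)"
      proof (rule terminates_While[where \<mu> = "\<lambda>s. length Ts - s 12 0"])
        show "?I ?s" using s1 by simp
        fix s assume I: "?I s" and b: "bval (Less (Var 12) (Var 4)) s" and ag: "agree (writes query) ?s s"
        have lt: "s 12 0 < length Ts" using b k[OF A[OF ag]] by simp
        have "terminates query s (14 * card (edges P) + 31 * card (verts P) + 13) (\<lambda>s'.
          s' 12 0 = Suc (s 12 0) \<and>
          (\<forall>v<length adj. 0 < s' 28 v \<longleftrightarrow> 0 < s 28 v \<or> v \<notin> losing P (Ts ! s 12 0)))"
          by (rule terminates_query[OF P(1,3) ts]) (use A[OF ag] lt in auto)
        then show "terminates query s (58 * m) (\<lambda>s'. ?I s' \<and> length Ts - s' 12 0 < length Ts - s 12 0)"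
          by (rule terminates_weaken)
            (use I lt nm m1 in \<open>auto simp: verts m_def n_def less_Suc_eq\<close>)
      qed
      then have "terminates ?loop ?s (59 * (length Ts * m) + 1)
        (\<lambda>s. ?A s \<and> (\<forall>v<n. 0 < s 28 v \<longleftrightarrow> ?win (length Ts) v))"
      proof (rule terminates_weaken)
        have "Suc (58 * m) * length Ts \<le> (59 * m) * length Ts" using m1 by (intro mult_le_mono1) simp
        then show "Suc (58 * m) * (length Ts - ?s 12 0) + 1 \<le> 59 * (length Ts * m) + 1"
          by (simp add: algebra_simps)
        fix s assume I: "?I s \<and> \<not> bval (Less (Var 12) (Var 4)) s" and ag: "agree (writes ?loop) ?s s"
        from A[of s] ag have As: "?A s" by simp
        then have "s 12 0 = length Ts" using I k[OF As] by auto
        then show "?A s \<and> (\<forall>v<n. 0 < s 28 v \<longleftrightarrow> ?win (length Ts) v)" using I As by simp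
      qed
      then have loop: "terminates (Seq (assign 12 (Const 0)) ?loop) s1 (59 * (length Ts * m) + 2)
        (\<lambda>s. ?A s \<and> (\<forall>v<n. 0 < s 28 v \<longleftrightarrow> ?win (length Ts) v))"
        by (rule terminates_Seq_run) auto
      show "terminates (Seq (Seq (assign 12 (Const 0)) ?loop) output_wins) s1
        ((59 * (length Ts * m) + 2) + 9 * m) ?Q"
      proof (rule terminates_Seq[OF loop])
        fix s2 assume s2: "?A s2 \<and> (\<forall>v<n. 0 < s2 28 v \<longleftrightarrow> ?win (length Ts) v)"
        have "{v. v < n \<and> s2 14 0 = 0 \<and> 0 < s2 28 v} = (\<Union>i<length Ts. almost_sure P (Reach P (Ts ! i)))"
        proof (cases "no_dead_ends P")
          case True
          then show ?thesis using s2 unfolding almost_sure_reach_eq[OF P(1) True] verts by auto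
        next
          case False
          then show ?thesis using s2 almost_sure_dead_end[OF P(1) False] by auto
        qed
        moreover have "s2 0 0 = n" "s2 7 0 = 0" using s2 n0 by (auto simp: query_input_arrays)
        ultimately show "terminates output_wins s2 (9 * m) ?Q"
          using terminates_weaken[OF terminates_output_wins[where ?s0.0 = s2 and n = n], of "9 * m" ?Q] nm m1 by simp
      qed
    qed
    then obtain t s where ex: "exec (Seq (prepare mec) (Seq (Seq (assign 12 (Const 0)) ?loop) output_wins)) ?s0 t s"
      "t \<le> (59 * m + MEC P) + ((59 * (length Ts * m) + 2) + 9 * m)" "?Q s" unfolding terminates_def by blast
    have "exec (disjunctive_reach mec) ?s0 (Suc t) s"
      unfolding disjunctive_reach_def by (rule exec_Cond_True) (use ex(1) False n0 in auto)
    moreover have "Suc t \<le> 59 * (length Ts * m) + 71 * m + MEC P + 2" using ex(2) m1 by simp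
    ultimately show ?thesis using ex(3) unfolding terminates_def m_def by blast
  qed
qed

theorem theorem1:
  fixes mec_program :: com and MEC :: "nat mdp \<Rightarrow> nat"
  assumes "computes_MECs mec_program MEC"
    and "\<exists>c>0. \<forall>P adj. is_mdp P \<and> card (verts P) \<le> card (edges P) \<and> adjacency_lists P adj \<longrightarrow>
           c * real (card (edges P)) \<le> real (MEC P)"
  shows "\<exists>program C. computes_disjunctive_reach program
           (\<lambda>P Ts. C * (length Ts * card (edges P) + MEC P))"
proof -
  from assms(2) obtain c where c: "c > 0" "\<And>P adj. is_mdp P \<Longrightarrow> card (verts P) \<le> card (edges P) \<Longrightarrow>
    adjacency_lists P adj \<Longrightarrow> c * real (card (edges P)) \<le> real (MEC P)" by blast
  \<comment> \<open>Turns the assumed lower bound on MEC into m \<le> d * MEC with a natural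
    factor.\<close>
  define d where "d = nat \<lceil>1 / c\<rceil>"
  have d: "card (edges P) \<le> d * MEC P"
    if "is_mdp P" "card (verts P) \<le> card (edges P)" "adjacency_lists P adj" for P adj
  proof -
    have "real (card (edges P)) = (1 / c) * (c * real (card (edges P)))" using c(1) by simp
    also have "\<dots> \<le> (1 / c) * real (MEC P)" using c(1) c(2)[OF that] by (intro mult_left_mono) auto
    also have "\<dots> \<le> real d * real (MEC P)" unfolding d_def by (intro mult_right_mono real_nat_ceiling_ge) auto
    finally have "real (card (edges P)) \<le> real (d * MEC P)" by simp
    then show ?thesis by (simp only: of_nat_le_iff)
  qed
  \<comment> \<open>59 pays for the queries, 71 * d for the linear part through m \<le> d * MEC, and
    3 for MEC + 2, as MEC is at least 1.\<close>
  have "computes_disjunctive_reach (disjunctive_reach mec_program)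
    (\<lambda>P Ts. (59 + 71 * d + 3) * (length Ts * card (edges P) + MEC P))"
    unfolding computes_disjunctive_reach_def
  proof (intro allI impI, elim conjE)
    fix P adj Ts ts
    assume P: "is_mdp P" "card (verts P) \<le> card (edges P)" "adjacency_lists P adj"
      and Ts: "\<forall>T\<in>set Ts. T \<subseteq> verts P" "list_all2 list_of_set ts Ts"
    obtain t s where "exec mec_program (mdp_input P adj) t s" "t \<le> MEC P"
      using assms(1) P unfolding computes_MECs_def by blast
    then have "1 \<le> MEC P" using exec_pos[of mec_program "mdp_input P adj" t s] by simp
    moreover have "71 * card (edges P) \<le> 71 * (d * MEC P)" using d[OF P] by simp
    ultimately have le: "59 * (length Ts * card (edges P)) + 71 * card (edges P) + MEC P + 2
      \<le> (59 + 71 * d + 3) * (length Ts * card (edges P) + MEC P)"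
      by (simp add: algebra_simps)
    show "\<exists>t s xs. exec (disjunctive_reach mec_program) (query_input P adj ts) t s \<and>
      t \<le> (59 + 71 * d + 3) * (length Ts * card (edges P) + MEC P) \<and>
      holds_list s 7 [length xs] \<and> holds_list s 8 xs \<and>
      list_of_set xs (\<Union>i<length Ts. almost_sure P (Reach P (Ts ! i)))"
    proof -
      from disjunctive_reach_correct[OF assms(1) P Ts(2,1)] obtain t s xs
        where "exec (disjunctive_reach mec_program) (query_input P adj ts) t s"
          "t \<le> 59 * (length Ts * card (edges P)) + 71 * card (edges P) + MEC P + 2"
          "holds_list s 7 [length xs]" "holds_list s 8 xs"
          "list_of_set xs (\<Union>i<length Ts. almost_sure P (Reach P (Ts ! i)))"
        unfolding terminates_def by (elim exE conjE)
      with le show ?thesis by (intro exI conjI) (assumption | erule order_trans)+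
    qed
  qed
  then show ?thesis by blast
qed

end
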